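(* Let $\mathcal{C}\subset\mathbb{T}$ be a regular $C^2$ curve such that the set $\{z\in\mathcal{C}:\kappa(z)\ne0\}$ of points of nonzero curvature is absolutely winning on $\mathcal{C}$. Then the set $$\{p\in\mathcal{C}:\ A^+p\ \text{is not fiberwise divergent}\}$$ is hyperplane absolute winning (HAW) on $\mathcal{C}$. In particular, it has full Hausdorff dimension in $\mathcal{C}$.
   Context: Let $X_3=\mathrm{SL}_3(\mathbb{R})/\mathrm{SL}_3(\mathbb{Z})$. For $(x,y)\in\mathbb{R}^2$ put $$p_{x,y}=\begin{pmatrix}1&0&x\\0&1&y\\0&0&1\end{pmatrix}\cdot\mathrm{SL}_3(\mathbb{Z})\in X_3,$$ and let $\mathbb{T}=\{p_{x,y}:(x,y)\in\mathbb{R}^2\}\subset X_3$, a two-dimensional subtorus, with $(x,y)\mapsto p_{x,y}$ a local diffeomorphism from $\mathbb{R}^2$ onto $\mathbb{T}$. A regular $C^2$ curve in $\mathbb{T}$ is a one-dimensional embedded $C^2$ submanifold, and its curvature $\kappa$ is computed in the local coordinates $(x,y)$ of $\mathbb{R}^2$. Let $A^+=\{\mathrm{diag}(e^s,e^t,e^{-(s+t)}):s,t\ge0\}$, acting on $X_3$ by left translation, and for $T\ge0$ let $L_T^+=\{\mathrm{diag}(e^s,e^t,e^{-(s+t)}):s,t\ge0,\ s+t=T\}$. For $p\in X_3$, the orbit $A^+p$ is fiberwise divergent if for every compact $K\subset X_3$ there exists $T_0>0$ such that $L_T^+p\not\subseteq K$ for all $T>T_0$. Hyperplane absolute winning (HAW).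 Let $U\subset\mathbb{R}^d$ be open, $S\subset\mathbb{R}^d$, $\beta\in(0,1/3)$. For an affine hyperplane $L\subset\mathbb{R}^d$ and $r>0$ put $L^{(r)}=\{z\in\mathbb{R}^d:\mathrm{dist}(z,L)\le r\}$. Bob first chooses a closed ball $B_0\subset U$ of radius $\rho_0>0$. After Bob chooses a closed ball $B_n$ of radius $\rho_n$, Alice chooses $L_n^{(r_n)}$ with $r_n\le\beta\rho_n$, and then Bob chooses a closed ball $B_{n+1}\subset B_n\setminus L_n^{(r_n)}$ of radius $\rho_{n+1}\ge\beta\rho_n$. Alice wins by default if at any time Bob has no legal move, or if $\rho_n\not\to0$; otherwise Alice wins iff $\bigcap_nB_n\cap S\ne\varnothing$. $S$ is HAW on $U$ if for every $\beta\in(0,1/3)$ Alice has a winning strategy. A subset $S$ of a $d$-dimensional $C^1$ manifold $M$ with $C^1$ atlas $\{(U_\alpha,\varphi_\alpha)\}$ is HAW on $M$ if $\varphi_\alpha(S\cap U_\alpha)$ is HAW on $\varphi_\alpha(U_\alpha)$ for each $\alpha$ (this is independent of the atlas). On a one-dimensional manifold (where affine hyperplanes of the chart space $\mathbb{R}$ are points), "absolutely winning" is equivalent to HAW. *)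

theory Defs
  imports "HOL-Analysis.Analysis"
begin

section \<open>The space of unimodular lattices in three-space\<close>

definition SL3R :: "(real^3^3) set" where
  "SL3R = {g. det g = 1}"

definition SL3Z :: "(real^3^3) set" where
  "SL3Z = {g. det g = 1 \<and> (\<forall>i j. g $ i $ j \<in> \<int>)}"

definition coset :: "real^3^3 \<Rightarrow> (real^3^3) set" where
  "coset g = (\<lambda>\<gamma>. g ** \<gamma>) ` SL3Z"

definition X3 :: "(real^3^3) set set" where
  "X3 = coset ` SL3R"

definition X3_topology :: "(real^3^3) set topology" where
  "X3_topology =
     topology (\<lambda>V. V \<subseteq> X3 \<and> openin (top_of_set SL3R) {g \<in> SL3R. coset g \<in> V})"

lemma openin_X3_topology:
  "openin X3_topology V \<longleftrightarrow>
     V \<subseteq> X3 \<and> openin (top_of_set SL3R) {g \<in> SL3R. coset g \<in> V}"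
proof -
  let ?P = "\<lambda>V. V \<subseteq> X3 \<and> openin (top_of_set SL3R) {g \<in> SL3R. coset g \<in> V}"
  have "istopology ?P"
    unfolding istopology_def
  proof (intro conjI allI impI)
    fix V W assume VW: "?P V" "?P W"
    then show "V \<inter> W \<subseteq> X3" by blast
    have "{g \<in> SL3R. coset g \<in> V \<inter> W} = {g \<in> SL3R. coset g \<in> V} \<inter> {g \<in> SL3R. coset g \<in> W}"
      by blast
    then show "openin (top_of_set SL3R) {g \<in> SL3R. coset g \<in> V \<inter> W}"
      using VW by (simp add: openin_Int)
  next
    fix \<V> assume V: "\<forall>V\<in>\<V>. ?P V"
    then show "\<Union>\<V> \<subseteq> X3" by blast
    have "{g \<in> SL3R. coset g \<in> \<Union>\<V>} = \<Union>((\<lambda>V. {g \<in> SL3R. coset g \<in> V}) ` \<V>)"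
      by blast
    then show "openin (top_of_set SL3R) {g \<in> SL3R. coset g \<in> \<Union>\<V>}"
      using V by (auto intro!: openin_Union)
  qed
  then show ?thesis
    by (simp add: X3_topology_def topology_inverse')
qed

lemma topspace_X3_topology: "topspace X3_topology = X3"
proof -
  have "openin X3_topology X3"
  proof -
    have "{g \<in> SL3R. coset g \<in> X3} = SL3R" by (auto simp: X3_def)
    then show ?thesis by (simp add: openin_X3_topology)
  qed
  then show ?thesis
    by (simp add: openin_X3_topology subset_antisym openin_subset openin_X3_topology[THEN iffD1, OF openin_topspace])
qed

lemma quotient_map_coset: "quotient_map (top_of_set SL3R) X3_topology coset"
  by (auto simp: quotient_map_def topspace_X3_topology openin_X3_topology X3_def)

definition left_translate :: "real^3^3 \<Rightarrow> (real^3^3) set \<Rightarrow> (real^3^3) set" where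
  "left_translate a P = (\<lambda>g. a ** g) ` P"

lemma left_translate_coset: "left_translate a (coset g) = coset (a ** g)"
  by (simp add: left_translate_def coset_def image_image matrix_mul_assoc)

section \<open>Fiberwise divergent orbits\<close>

definition diag3 :: "real \<Rightarrow> real \<Rightarrow> real^3^3" where
  "diag3 s t =
     vector [vector [exp s, 0, 0],
             vector [0, exp t, 0],
             vector [0, 0, exp (- (s + t))]]"

definition A_plus :: "(real^3^3) set" where
  "A_plus = {diag3 s t | s t. s \<ge> 0 \<and> t \<ge> 0}"

definition L_plus :: "real \<Rightarrow> (real^3^3) set" where
  "L_plus T = {diag3 s t | s t. s \<ge> 0 \<and> t \<ge> 0 \<and> s + t = T}"

lemma A_plus_eq_Union_L_plus: "A_plus = (\<Union>T\<in>{0..}. L_plus T)"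
proof -
  have "diag3 s t \<in> (\<Union>T\<in>{0..}. L_plus T)" if "s \<ge> 0" "t \<ge> 0" for s t
    using that by (intro UN_I[of "s + t"]) (auto simp: L_plus_def)
  then show ?thesis
    by (auto simp: A_plus_def L_plus_def)
qed

text \<open>The fibers are the pieces \<open>L_plus T\<close> that make up \<open>A_plus\<close>;
  this is the property ``\<open>A_plus p\<close> is fiberwise divergent''.\<close>

definition fiberwise_divergent :: "(real^3^3) set \<Rightarrow> bool" where
  "fiberwise_divergent p \<longleftrightarrow>
     (\<forall>K. compactin X3_topology K \<longrightarrow>
        (\<exists>T0>0. \<forall>T>T0. \<not> (\<lambda>a. left_translate a p) ` L_plus T \<subseteq> K))"

section \<open>The torus and curves in it\<close>

definition torus_pt :: "real \<times> real \<Rightarrow> (real^3^3) set" where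
  "torus_pt v =
     coset (vector [vector [1, 0, fst v],
                    vector [0, 1, snd v],
                    vector [0, 0, 1]])"

definition torus :: "(real^3^3) set set" where
  "torus = range torus_pt"

text \<open>A local \<open>C\<^sup>1\<close> parametrization of \<open>C\<close> on an open set \<open>J\<close> of parameters is written in
  the coordinates of the plane as \<open>\<gamma>\<close>; the actual parametrization is \<open>torus_pt \<circ> \<gamma>\<close>, which is
  a homeomorphism onto a relatively open part of \<open>C\<close>. Since \<open>torus_pt\<close> is a covering map, every
  parametrization by a subset of the line has such a lift.\<close>

definition C1_param ::
  "(real^3^3) set set \<Rightarrow> real set \<Rightarrow> (real \<Rightarrow> real \<times> real) \<Rightarrow> bool" where
  "C1_param C J \<gamma> \<longleftrightarrow>
     open J \<and>
     \<gamma> C1_differentiable_on J \<and>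
     (\<forall>t\<in>J. vector_derivative \<gamma> (at t) \<noteq> 0) \<and>
     embedding_map (top_of_set J) X3_topology (torus_pt \<circ> \<gamma>) \<and>
     openin (subtopology X3_topology C) ((torus_pt \<circ> \<gamma>) ` J)"

definition C2_param ::
  "(real^3^3) set set \<Rightarrow> real set \<Rightarrow> (real \<Rightarrow> real \<times> real) \<Rightarrow> bool" where
  "C2_param C J \<gamma> \<longleftrightarrow>
     C1_param C J \<gamma> \<and>
     (\<lambda>t. vector_derivative \<gamma> (at t)) C1_differentiable_on J"

definition regular_C2_curve :: "(real^3^3) set set \<Rightarrow> bool" where
  "regular_C2_curve C \<longleftrightarrow>
     C \<subseteq> torus \<and> (\<forall>z\<in>C. \<exists>J \<gamma>. C2_param C J \<gamma> \<and> z \<in> (torus_pt \<circ> \<gamma>) ` J)"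

definition param_curvature :: "(real \<Rightarrow> real \<times> real) \<Rightarrow> real \<Rightarrow> real" where
  "param_curvature \<gamma> t =
     (let v = vector_derivative \<gamma> (at t);
          a = vector_derivative (\<lambda>s. vector_derivative \<gamma> (at s)) (at t)
      in \<bar>fst v * snd a - snd v * fst a\<bar> / norm v ^ 3)"

text \<open>The unsigned curvature depends neither on the parametrization nor on the lift to the plane,
  so the description below is proper for \<open>C\<close> a regular \<open>C\<^sup>2\<close> curve and \<open>z \<in> C\<close>.\<close>

definition curvature :: "(real^3^3) set set \<Rightarrow> (real^3^3) set \<Rightarrow> real" where
  "curvature C z =
     (THE k. \<exists>J \<gamma> t. C2_param C J \<gamma> \<and> t \<in> J \<and> torus_pt (\<gamma> t) = z \<and> k = param_curvature \<gamma> t)"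

text \<open>A chart is a pair of a domain and a coordinate map. Atlases consist of \<open>C\<^sup>1\<close> charts, because
  the notion of winning sets on a manifold only uses the \<open>C\<^sup>1\<close> structure.\<close>

definition C1_chart ::
  "(real^3^3) set set \<Rightarrow> (real^3^3) set set \<times> ((real^3^3) set \<Rightarrow> real) \<Rightarrow> bool" where
  "C1_chart C = (\<lambda>(U, \<phi>).
     \<exists>\<gamma>. C1_param C (\<phi> ` U) \<gamma> \<and> (\<forall>z\<in>U. torus_pt (\<gamma> (\<phi> z)) = z))"

definition C1_atlas ::
  "(real^3^3) set set \<Rightarrow> ((real^3^3) set set \<times> ((real^3^3) set \<Rightarrow> real)) set \<Rightarrow> bool" where
  "C1_atlas C \<A> \<longleftrightarrow> (\<forall>c\<in>\<A>. C1_chart C c) \<and> (\<Union>c\<in>\<A>. fst c) = C"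

section \<open>Absolute games\<close>

definition closed_nbhd :: "'a::euclidean_space set \<Rightarrow> real \<Rightarrow> 'a set" where
  "closed_nbhd L r = {z. infdist z L \<le> r}"

text \<open>A closed ball is given by its center and radius. Bob's \<open>n\<close>-th ball is \<open>B n\<close>. A strategy of
  Alice maps the list of the balls \<open>B 0, \<dots>, B n\<close> to her answer \<open>(L, r)\<close>, where \<open>L\<close> has to come from
  the family \<open>\<L>\<close> and \<open>closed_nbhd L r\<close> is the set that she deletes.\<close>

type_synonym 'a strategy = "('a \<times> real) list \<Rightarrow> 'a set \<times> real"

definition legal_strategy ::
  "'a::euclidean_space set set \<Rightarrow> real \<Rightarrow> 'a strategy \<Rightarrow> bool" where
  "legal_strategy \<L> \<beta> \<sigma> \<longleftrightarrow>
     (\<forall>h. h \<noteq> [] \<and> snd (last h) > 0 \<longrightarrow>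
        fst (\<sigma> h) \<in> \<L> \<and> 0 < snd (\<sigma> h) \<and> snd (\<sigma> h) \<le> \<beta> * snd (last h))"

definition legal_play ::
  "real \<Rightarrow> 'a::euclidean_space set \<Rightarrow> 'a strategy \<Rightarrow> (nat \<Rightarrow> 'a \<times> real) \<Rightarrow> bool" where
  "legal_play \<beta> U \<sigma> B \<longleftrightarrow>
     snd (B 0) > 0 \<and> cball (fst (B 0)) (snd (B 0)) \<subseteq> U \<and>
     (\<forall>n. snd (B (Suc n)) \<ge> \<beta> * snd (B n) \<and>
          cball (fst (B (Suc n))) (snd (B (Suc n)))
            \<subseteq> cball (fst (B n)) (snd (B n))
               - case_prod closed_nbhd (\<sigma> (map B [0..<Suc n])))"

text \<open>Plays in which Bob gets stuck are won by Alice, so only infinite plays need to be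
  considered.\<close>

definition alice_wins ::
  "'a::euclidean_space set set \<Rightarrow> real \<Rightarrow> 'a set \<Rightarrow> 'a set \<Rightarrow> bool" where
  "alice_wins \<L> \<beta> U S \<longleftrightarrow>
     (\<exists>\<sigma>. legal_strategy \<L> \<beta> \<sigma> \<and>
        (\<forall>B. legal_play \<beta> U \<sigma> B \<longrightarrow> (\<lambda>n. snd (B n)) \<longlonglongrightarrow> 0 \<longrightarrow>
           (\<Inter>n. cball (fst (B n)) (snd (B n))) \<inter> S \<noteq> {}))"

definition affine_hyperplanes :: "'a::euclidean_space set set" where
  "affine_hyperplanes = {L. affine L \<and> aff_dim L = int DIM('a) - 1}"

definition HAW_on :: "'a::euclidean_space set \<Rightarrow> 'a set \<Rightarrow> bool" where
  "HAW_on U S \<longleftrightarrow> (\<forall>\<beta>\<in>{0<..<1/3}. alice_wins affine_hyperplanes \<beta> U S)"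

text \<open>In McMullen's absolute game Alice deletes balls, the neighborhoods of points.\<close>

definition absolutely_winning_on :: "'a::euclidean_space set \<Rightarrow> 'a set \<Rightarrow> bool" where
  "absolutely_winning_on U S \<longleftrightarrow> (\<forall>\<beta>\<in>{0<..<1/3}. alice_wins (range (\<lambda>c. {c})) \<beta> U S)"

lemma absolutely_winning_on_real_iff_HAW_on:
  fixes U S :: "real set"
  shows "absolutely_winning_on U S \<longleftrightarrow> HAW_on U S"
proof -
  have "(affine_hyperplanes :: real set set) = range (\<lambda>c. {c})"
    by (auto simp: affine_hyperplanes_def aff_dim_eq_0)
  then show ?thesis
    by (simp add: absolutely_winning_on_def HAW_on_def)
qed

definition HAW_on_manifold ::
  "('m set \<times> ('m \<Rightarrow> 'a::euclidean_space)) set \<Rightarrow> 'm set \<Rightarrow> bool" where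
  "HAW_on_manifold \<A> S \<longleftrightarrow> (\<forall>(U, \<phi>)\<in>\<A>. HAW_on (\<phi> ` U) (\<phi> ` (S \<inter> U)))"

definition absolutely_winning_on_manifold ::
  "('m set \<times> ('m \<Rightarrow> 'a::euclidean_space)) set \<Rightarrow> 'm set \<Rightarrow> bool" where
  "absolutely_winning_on_manifold \<A> S \<longleftrightarrow>
     (\<forall>(U, \<phi>)\<in>\<A>. absolutely_winning_on (\<phi> ` U) (\<phi> ` (S \<inter> U)))"

section \<open>Hausdorff dimension\<close>

text \<open>\<open>d\<close> is the metric. As \<open>s > 0\<close>, the supremum of \<open>d x y powr s\<close> over \<open>x, y \<in> E\<close> is the \<open>s\<close>-th
  power of the diameter of \<open>E\<close> (and 0 for empty \<open>E\<close>). Intersecting the members of a cover with \<open>A\<close>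
  does not increase diameters, so covers by subsets of \<open>A\<close> suffice.\<close>

definition hausdorff_premeasure ::
  "('m \<Rightarrow> 'm \<Rightarrow> real) \<Rightarrow> real \<Rightarrow> real \<Rightarrow> 'm set \<Rightarrow> ennreal" where
  "hausdorff_premeasure d s \<delta> A =
     (INF E \<in> {E :: nat \<Rightarrow> 'm set. (\<Union>i. E i) = A \<and> (\<forall>i. \<forall>x\<in>E i. \<forall>y\<in>E i. d x y \<le> \<delta>)}.
        \<Sum>i. SUP x\<in>E i. SUP y\<in>E i. ennreal (d x y powr s))"

definition hausdorff_measure :: "('m \<Rightarrow> 'm \<Rightarrow> real) \<Rightarrow> real \<Rightarrow> 'm set \<Rightarrow> ennreal" where
  "hausdorff_measure d s A = (SUP \<delta>\<in>{0<..}. hausdorff_premeasure d s \<delta> A)"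

definition hausdorff_dim :: "('m \<Rightarrow> 'm \<Rightarrow> real) \<Rightarrow> 'm set \<Rightarrow> ennreal" where
  "hausdorff_dim d A = Inf {ennreal s | s. s > 0 \<and> hausdorff_measure d s A = 0}"

text \<open>The flat metric of the torus as a quotient of the plane.\<close>

definition torus_dist :: "(real^3^3) set \<Rightarrow> (real^3^3) set \<Rightarrow> real" where
  "torus_dist z w = setdist (torus_pt -` {z}) (torus_pt -` {w})"

end

theory Submission
  imports Defs
begin

text \<open>Write \<open>Q = exp T\<close> and \<open>u = exp s\<close>. The lattice \<open>diag3 s (T - s)\<close> applied to the point of the
  torus over \<open>(x, y)\<close> has a vector shorter than \<open>\<epsilon>\<close> only if there is a rational point \<open>(p / q, r / q)\<close>
  with \<open>q \<le> \<epsilon> Q\<close>, \<open>\<bar>q x - p\<bar> < \<epsilon> / u\<close> and \<open>\<bar>q y - r\<bar> < \<epsilon> u / Q\<close>. If this happens for no \<open>u\<close> in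
  \<open>[1, Q]\<close>, then the whole fiber \<open>L_plus T\<close> of the orbit stays in a compact set, by Mahler's criterion
  (\<open>mahler_compactness\<close>). So Alice has to avoid the set of bad points \<open>(x, y)\<close> for one fixed \<open>\<epsilon>\<close> and for
  arbitrarily large \<open>Q\<close>, not for all of them. She picks these \<open>Q\<close> one after the other, each so large
  that the cover of its bad set weighs little at the scale of the current ball.

  Bounding the measure of the bad set by a sum over the rational points does not help, since there are
  about \<open>log Q\<close> scales and each of them contributes a comparable amount. The structure of the bad set
  is used instead. By the pigeonhole principle each rational point \<open>(p / q, r / q)\<close> lies on a line \<open>A x + B y + C = 0\<close>
  with \<open>\<bar>A\<bar> \<le> sqrt (q / Q) u\<close> and \<open>\<bar>B\<bar> \<le> sqrt (q Q) / u\<close>, and \<open>f = A x + B y + C\<close> is tiny at the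
  corresponding bad points. Sort the points by the size of \<open>q\<close> and by the slope of \<open>f\<close> along the curve.
  Within a class, and in an interval of length about \<open>1 / (q slope)\<close>, all rational points lie on a
  single one of these lines, because an integer of absolute value less than 1 vanishes
  (\<open>line_passes_through\<close>). So the bad points of a class in such an interval lie where one \<open>f\<close> is tiny, that is, in
  two sets of small relative diameter: either \<open>f\<close> is steep, or the curvature makes \<open>f\<close>
  uniformly convex or concave (\<open>class_cover\<close>). The relative diameters decay geometrically with
  \<open>log (\<epsilon> Q / q)\<close>, hence any positive power of them is summable (\<open>tame_families_exist\<close>).

  Such a family is handled by a potential: the sum of the \<open>g\<close>-th powers of the diameters of the pending
  sets that meet the ball. On the line two subballs which both carry most of the potential
  share one of these sets, so all such subballs come close to a common point and Alice can forbid all of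
  them with one move (\<open>potential_game\<close>). The hypothesis on the curvature only serves to reach a
  neighborhood in which the curvature does not vanish; winning is local after that
  (\<open>alice_wins_switch\<close>).

  For the dimension, Bob plays against a cover of small Hausdorff weight: he divides his ball into
  \<open>N\<close> parts, of which Alice forbids at most three, and moves into a part that carries little weight.
  Since Alice wins, the limit point is in her set but outside of the cover, so the winning set has
  positive \<open>s\<close>-dimensional measure for every \<open>s < 1\<close> (\<open>HAW_not_null\<close>).\<close>

section \<open>Manipulating winning strategies\<close>

lemma alice_wins_mono:
  assumes "alice_wins \<L> \<beta> U S" "U' \<subseteq> U" "U' \<inter> S \<subseteq> S'"
  shows "alice_wins \<L> \<beta> U' S'"
proof -
  obtain \<sigma> where \<sigma>: "legal_strategy \<L> \<beta> \<sigma>"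
    "\<And>B. legal_play \<beta> U \<sigma> B \<Longrightarrow> (\<lambda>n. snd (B n)) \<longlonglongrightarrow> 0 \<Longrightarrow>
           (\<Inter>n. cball (fst (B n)) (snd (B n))) \<inter> S \<noteq> {}"
    using assms(1) unfolding alice_wins_def by blast
  have "(\<Inter>n. cball (fst (B n)) (snd (B n))) \<inter> S' \<noteq> {}"
    if B: "legal_play \<beta> U' \<sigma> B" "(\<lambda>n. snd (B n)) \<longlonglongrightarrow> 0" for B
  proof -
    have "legal_play \<beta> U \<sigma> B"
      using B(1) assms(2) unfolding legal_play_def by (meson order_trans)
    then obtain z where "z \<in> (\<Inter>n. cball (fst (B n)) (snd (B n)))" "z \<in> S"
      using \<sigma>(2) B(2) by blast
    moreover from this have "z \<in> U'"
      using B(1) unfolding legal_play_def by blast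
    ultimately show ?thesis using assms(3) by blast
  qed
  then show ?thesis using \<sigma>(1) unfolding alice_wins_def by blast
qed

context
  fixes \<beta> :: real and U :: "'a::euclidean_space set" and \<sigma> :: "'a strategy"
    and B :: "nat \<Rightarrow> 'a \<times> real"
  assumes \<beta>: "\<beta> > 0" and B: "legal_play \<beta> U \<sigma> B"
begin

lemma legal_play_radius_pos: "snd (B n) > 0"
proof (induction n)
  case 0
  then show ?case using B by (simp add: legal_play_def)
next
  case (Suc n)
  then have "0 < \<beta> * snd (B n)" using \<beta> by simp
  also have "\<dots> \<le> snd (B (Suc n))" using B by (simp add: legal_play_def)
  finally show ?case .
qed

lemma legal_play_ball_Suc:
  "cball (fst (B (Suc n))) (snd (B (Suc n))) \<subseteq> cball (fst (B n)) (snd (B n))"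
  using B unfolding legal_play_def by blast

lemma legal_play_ball_antimono:
  "m \<le> n \<Longrightarrow> cball (fst (B n)) (snd (B n)) \<subseteq> cball (fst (B m)) (snd (B m))"
  using legal_play_ball_Suc by (rule lift_Suc_antimono_le) 

lemma legal_play_ball_subset: "cball (fst (B n)) (snd (B n)) \<subseteq> U"
  using legal_play_ball_antimono[of 0 n] B unfolding legal_play_def by blast

lemma legal_play_limit_exists: "\<exists>z. \<forall>n. z \<in> cball (fst (B n)) (snd (B n))"
proof -
  have "\<Inter>(range (\<lambda>n. cball (fst (B n)) (snd (B n)))) \<noteq> {}"
    by (rule compact_nest)
       (use legal_play_radius_pos legal_play_ball_antimono in \<open>auto simp: less_imp_le not_less\<close>)
  then show ?thesis by blast
qed

end

text \<open>Winning is a local property: once the ball lies in an open set on which Alice can win, she may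
  forget the past and start afresh. An open winning set \<open>O'\<close> gets her there after finitely many
  moves.\<close>

lemma alice_wins_switch:
  fixes U O' S :: "'a::euclidean_space set"
  assumes \<beta>: "\<beta> > 0" and first: "alice_wins \<L> \<beta> U O'"
    and local: "\<And>z. z \<in> O' \<Longrightarrow> \<exists>V. open V \<and> z \<in> V \<and> alice_wins \<L> \<beta> V S"
  shows "alice_wins \<L> \<beta> U S"
proof -
  obtain \<sigma>1 where \<sigma>1: "legal_strategy \<L> \<beta> \<sigma>1"
    "\<And>B. legal_play \<beta> U \<sigma>1 B \<Longrightarrow> (\<lambda>n. snd (B n)) \<longlonglongrightarrow> 0 \<Longrightarrow>
           (\<Inter>n. cball (fst (B n)) (snd (B n))) \<inter> O' \<noteq> {}"
    using first unfolding alice_wins_def by blast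
  define wins where "wins = (\<lambda>b \<sigma>. \<exists>V. cball (fst b) (snd b) \<subseteq> V \<and> legal_strategy \<L> \<beta> \<sigma> \<and>
    (\<forall>B. legal_play \<beta> V \<sigma> B \<longrightarrow> (\<lambda>n. snd (B n)) \<longlonglongrightarrow> 0 \<longrightarrow>
           (\<Inter>n. cball (fst (B n)) (snd (B n))) \<inter> S \<noteq> {}))"
  define good where "good = (\<lambda>b. \<exists>\<sigma>. wins b \<sigma>)"
  define s2 where "s2 = (\<lambda>b. SOME \<sigma>. wins b \<sigma>)"
  have s2: "wins b (s2 b)" if "good b" for b
    using that unfolding good_def s2_def by (rule someI_ex)
  define \<sigma> where "\<sigma> = (\<lambda>h. if \<exists>i<length h. good (h ! i)
      then (let i = (LEAST i. i < length h \<and> good (h ! i)) in s2 (h ! i) (drop i h)) else \<sigma>1 h)"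
  have legal: "legal_strategy \<L> \<beta> \<sigma>"
    unfolding legal_strategy_def
  proof (intro allI impI)
    fix h :: "('a \<times> real) list" assume h: "h \<noteq> [] \<and> snd (last h) > 0"
    show "fst (\<sigma> h) \<in> \<L> \<and> 0 < snd (\<sigma> h) \<and> snd (\<sigma> h) \<le> \<beta> * snd (last h)"
    proof (cases "\<exists>i<length h. good (h ! i)")
      case True
      define i where "i = (LEAST i. i < length h \<and> good (h ! i))"
      have i: "i < length h" "good (h ! i)"
        using LeastI_ex[OF True] unfolding i_def by auto
      have "legal_strategy \<L> \<beta> (s2 (h ! i))" using s2[OF i(2)] unfolding wins_def by blast
      moreover have "\<sigma> h = s2 (h ! i) (drop i h)"
        using True unfolding \<sigma>_def i_def Let_def by (rule if_P)
      moreover have "drop i h \<noteq> []" "last (drop i h) = last h" using i by auto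
      ultimately show ?thesis using h unfolding legal_strategy_def by metis
    next
      case False
      then have "\<sigma> h = \<sigma>1 h" unfolding \<sigma>_def by (rule if_not_P)
      then show ?thesis using h \<sigma>1(1) unfolding legal_strategy_def by metis
    qed
  qed
  have "(\<Inter>n. cball (fst (B n)) (snd (B n))) \<inter> S \<noteq> {}"
    if B: "legal_play \<beta> U \<sigma> B" and lim: "(\<lambda>n. snd (B n)) \<longlonglongrightarrow> 0" for B
  proof (cases "\<exists>i. good (B i)")
    case False
    have "\<sigma> (map B [0..<Suc n]) = \<sigma>1 (map B [0..<Suc n])" for n
    proof -
      have "\<not> (\<exists>i<length (map B [0..<Suc n]). good (map B [0..<Suc n] ! i))"
        using False by (auto simp del: upt_Suc)
      then show ?thesis unfolding \<sigma>_def by (rule if_not_P)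
    qed
    then have "legal_play \<beta> U \<sigma>1 B" using B unfolding legal_play_def by simp
    from \<sigma>1(2)[OF this lim]
    obtain z where z: "\<And>n. z \<in> cball (fst (B n)) (snd (B n))" "z \<in> O'"
      by blast
    obtain V where V: "open V" "z \<in> V" "alice_wins \<L> \<beta> V S" using local z(2) by blast
    obtain e where e: "e > 0" "ball z e \<subseteq> V" using V openE by blast
    have "eventually (\<lambda>n. snd (B n) < e / 2) sequentially"
      using lim e(1) order_tendstoD(2) half_gt_zero by blast
    then obtain n where n: "snd (B n) < e / 2"
      using eventually_sequentially by auto
    have "cball (fst (B n)) (snd (B n)) \<subseteq> ball z e"
    proof
      fix y assume "y \<in> cball (fst (B n)) (snd (B n))"
      then have "dist z y \<le> 2 * snd (B n)"
        using z(1)[of n] dist_triangle2[of z y "fst (B n)"] by (simp add: dist_commute)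
      then show "y \<in> ball z e" using n by simp
    qed
    then have "cball (fst (B n)) (snd (B n)) \<subseteq> V" using e(2) by blast
    then have "good (B n)"
      using V(3) unfolding good_def wins_def alice_wins_def by blast
    then show ?thesis using False by blast
  next
    case True
    define i where "i = (LEAST i. good (B i))"
    have i: "good (B i)" "\<And>j. good (B j) \<Longrightarrow> i \<le> j"
      using LeastI_ex[OF True] Least_le unfolding i_def by auto
    obtain V where V: "cball (fst (B i)) (snd (B i)) \<subseteq> V"
      "\<And>B'. legal_play \<beta> V (s2 (B i)) B' \<Longrightarrow> (\<lambda>n. snd (B' n)) \<longlonglongrightarrow> 0 \<Longrightarrow>
           (\<Inter>n. cball (fst (B' n)) (snd (B' n))) \<inter> S \<noteq> {}"
      using s2[OF i(1)] unfolding wins_def by blast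
    define B' where "B' = (\<lambda>n. B (i + n))"
    have \<sigma>B: "\<sigma> (map B [0..<Suc (i + n)]) = s2 (B i) (map B' [0..<Suc n])" for n
    proof -
      let ?h = "map B [0..<Suc (i + n)]"
      have nth: "?h ! j = B j" if "j < length ?h" for j
        using that by (simp del: upt_Suc)
      have len: "length ?h = Suc (i + n)" by simp
      have eq: "(LEAST j. j < length ?h \<and> good (?h ! j)) = i"
        by (rule Least_equality) (use i nth len in auto)
      have ex: "\<exists>j<length ?h. good (?h ! j)"
        using i(1) nth[of i] len by (intro exI[of _ i]) auto
      have "drop i ?h = map B' [0..<Suc n]"
        by (rule nth_equalityI) (auto simp: B'_def simp del: upt_Suc)
      then show ?thesis
        using ex eq nth[of i] len unfolding \<sigma>_def Let_def by simp
    qed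
    have "legal_play \<beta> V (s2 (B i)) B'"
      unfolding legal_play_def
    proof (intro conjI allI)
      show "snd (B' 0) > 0" using legal_play_radius_pos[OF \<beta> B] by (simp add: B'_def)
      show "cball (fst (B' 0)) (snd (B' 0)) \<subseteq> V" using V(1) by (simp add: B'_def)
      fix n
      show "snd (B' (Suc n)) \<ge> \<beta> * snd (B' n)"
        using B unfolding legal_play_def B'_def by simp
      have "cball (fst (B (Suc (i + n)))) (snd (B (Suc (i + n))))
            \<subseteq> cball (fst (B (i + n))) (snd (B (i + n)))
               - case_prod closed_nbhd (\<sigma> (map B [0..<Suc (i + n)]))"
        using B unfolding legal_play_def by meson
      then show "cball (fst (B' (Suc n))) (snd (B' (Suc n)))
            \<subseteq> cball (fst (B' n)) (snd (B' n))
               - case_prod closed_nbhd (s2 (B i) (map B' [0..<Suc n]))"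
        unfolding \<sigma>B by (simp add: B'_def)
    qed
    moreover have "(\<lambda>n. snd (B' n)) \<longlonglongrightarrow> 0"
      using LIMSEQ_ignore_initial_segment[OF lim, of i] by (simp add: B'_def add.commute)
    ultimately have "(\<Inter>n. cball (fst (B' n)) (snd (B' n))) \<inter> S \<noteq> {}" by (rule V(2))
    then obtain z where z: "\<And>n. z \<in> cball (fst (B (i + n))) (snd (B (i + n)))" "z \<in> S"
      unfolding B'_def by blast
    have "z \<in> cball (fst (B n)) (snd (B n))" for n
      using z(1)[of n] legal_play_ball_antimono[OF \<beta> B, of n "i + n"] by auto
    then show ?thesis using z(2) by blast
  qed
  then show ?thesis using legal unfolding alice_wins_def by blast
qed

lemma closed_nbhd_singleton: "closed_nbhd {z} r = cball z r"
  by (auto simp: closed_nbhd_def dist_commute)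

lemma alice_wins_remove_point:
  fixes V :: "'a::euclidean_space set"
  assumes \<beta>: "\<beta> > 0"
  shows "alice_wins (range (\<lambda>c. {c})) \<beta> V (V - {z})"
proof -
  define \<sigma> :: "'a strategy" where "\<sigma> = (\<lambda>h. ({z}, \<beta> * snd (last h)))"
  have "legal_strategy (range (\<lambda>c. {c})) \<beta> \<sigma>"
    using \<beta> by (auto simp: legal_strategy_def \<sigma>_def)
  moreover have "(\<Inter>n. cball (fst (B n)) (snd (B n))) \<inter> (V - {z}) \<noteq> {}"
    if B: "legal_play \<beta> V \<sigma> B" for B
  proof -
    obtain y where y: "\<And>n. y \<in> cball (fst (B n)) (snd (B n))"
      using legal_play_limit_exists[OF \<beta> B] by blast
    have "cball (fst (B (Suc 0))) (snd (B (Suc 0)))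
            \<subseteq> cball (fst (B 0)) (snd (B 0)) - case_prod closed_nbhd (\<sigma> (map B [0..<Suc 0]))"
      using B unfolding legal_play_def by meson
    then have "y \<notin> case_prod closed_nbhd (\<sigma> (map B [0..<Suc 0]))"
      using y[of "Suc 0"] by (meson DiffD2 subsetD)
    then have "y \<noteq> z"
      using \<beta> legal_play_radius_pos[OF \<beta> B, of 0]
      by (auto simp: \<sigma>_def closed_nbhd_singleton less_imp_le)
    moreover have "y \<in> V" using y[of 0] legal_play_ball_subset[OF \<beta> B, of 0] by (rule rev_subsetD)
    ultimately show ?thesis using y by blast
  qed
  ultimately show ?thesis unfolding alice_wins_def by blast
qed

section \<open>A potential game on the line\<close>

text \<open>A member \<open>(E, s, R)\<close> of a family is a set \<open>E\<close> that Alice wants to avoid, a bound \<open>s\<close> for its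
  diameter, and the radius \<open>R\<close> of the ball at which it becomes pending. The weight counts the members
  that meet \<open>B\<close> and have their scale in \<open>K\<close>.\<close>

definition live_weight ::
  "real \<Rightarrow> ('a set \<times> real \<times> real) set \<Rightarrow> 'a set \<Rightarrow> real set \<Rightarrow> real" where
  "live_weight g F B K = (\<Sum>(E, s, R) \<in> {(E, s, R) \<in> F. E \<inter> B \<noteq> {} \<and> R \<in> K}. s powr g)"

text \<open>The members pending at radius \<open>\<rho>\<close> weigh at most half of \<open>\<rho> powr g\<close>, and those which become pending
  during one more move at most a quarter. The exponent \<open>g\<close> will satisfy \<open>\<beta> powr g = 3 / 4\<close>, so that the
  sum of both is \<open>(\<beta> \<rho>) powr g\<close>: each member is then shorter than the radius that Alice may delete,
  and a legal ball of Bob violates the bound only if it carries more than half of this sum.\<close>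

definition tame_family ::
  "real \<Rightarrow> real \<Rightarrow> real \<Rightarrow> real \<Rightarrow> (real set \<times> real \<times> real) set \<Rightarrow> bool" where
  "tame_family \<beta> g c \<rho> F \<longleftrightarrow>
     finite F \<and> (\<forall>(E, s, R) \<in> F. 0 < s \<and> 0 < R \<and> (\<forall>x\<in>E. \<forall>y\<in>E. \<bar>x - y\<bar> \<le> s)) \<and>
     live_weight g F (cball c \<rho>) {\<rho>..} \<le> \<rho> powr g / 2 \<and>
     (\<forall>c' \<rho>'. 0 < \<rho>' \<longrightarrow> \<rho>' \<le> \<rho> \<longrightarrow> cball c' \<rho>' \<subseteq> cball c \<rho> \<longrightarrow>
        live_weight g F (cball c' \<rho>') {\<beta> * \<rho>'..<\<rho>'} \<le> \<rho>' powr g / 4)"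

lemma live_weight_mono:
  assumes "finite F" "B \<subseteq> B'" "K \<subseteq> K'"
  shows "live_weight g F B K \<le> live_weight g F B' K'"
  unfolding live_weight_def
proof (rule sum_mono2)
  show "finite {(E, s, R) \<in> F. E \<inter> B' \<noteq> {} \<and> R \<in> K'}"
    using assms(1) by (rule rev_finite_subset) auto
qed (use assms in auto)

lemma live_weight_split:
  assumes "finite F" "K \<inter> K' = {}"
  shows "live_weight g F B (K \<union> K') = live_weight g F B K + live_weight g F B K'"
proof -
  have "{(E, s, R) \<in> F. E \<inter> B \<noteq> {} \<and> R \<in> K \<union> K'} =
    {(E, s, R) \<in> F. E \<inter> B \<noteq> {} \<and> R \<in> K} \<union> {(E, s, R) \<in> F. E \<inter> B \<noteq> {} \<and> R \<in> K'}"
    by auto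
  then show ?thesis
    unfolding live_weight_def
    by (simp only:, intro sum.union_disjoint finite_subset[OF _ assms(1)]) (use assms(2) in auto)
qed

lemma powr_le_live_weight:
  assumes "finite F" "(E, s, R) \<in> F" "E \<inter> B \<noteq> {}" "R \<in> K"
  shows "s powr g \<le> live_weight g F B K"
proof -
  have "(\<Sum>(E, s, R) \<in> {(E, s, R)}. s powr g) \<le> live_weight g F B K"
    unfolding live_weight_def
  proof (rule sum_mono2)
    show "finite {(E, s, R) \<in> F. E \<inter> B \<noteq> {} \<and> R \<in> K}"
      using assms(1) by (rule rev_finite_subset) auto
  qed (use assms in auto)
  then show ?thesis by simp
qed

text \<open>Two balls which both carry more than half of the weight share a small set \<open>E\<close> and so almost
  intersect. By the one-dimensional Helly property there is then one point close to all the
  heavy balls.\<close>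

lemma heavy_balls_near_common_point:
  fixes F :: "(real set \<times> real \<times> real) set"
  assumes fin: "finite F"
    and F: "\<And>E s R. (E, s, R) \<in> F \<Longrightarrow> 0 < s \<and> (\<forall>x\<in>E. \<forall>y\<in>E. \<bar>x - y\<bar> \<le> s)"
    and \<beta>: "0 < \<beta>" "\<beta> < 1" and g: "0 < g" "\<beta> powr g = 3 / 4" and \<rho>: "0 < \<rho>"
    and w: "live_weight g F (cball c \<rho>) {\<beta> * \<rho>..} \<le> 3 / 4 * \<rho> powr g"
  shows "\<exists>z. \<forall>c' \<rho>'. \<beta> * \<rho> \<le> \<rho>' \<longrightarrow> cball c' \<rho>' \<subseteq> cball c \<rho> - cball z (\<beta> * \<rho>) \<longrightarrow>
     live_weight g F (cball c' \<rho>') {\<rho>'..} \<le> \<rho>' powr g / 2"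
proof -
  define bad where "bad = {(c', \<rho>'). \<beta> * \<rho> \<le> \<rho>' \<and> cball c' \<rho>' \<subseteq> cball c \<rho> \<and>
    \<not> live_weight g F (cball c' \<rho>') {\<rho>'..} \<le> \<rho>' powr g / 2}"
  have \<beta>\<rho>: "0 < \<beta> * \<rho>" using \<beta> \<rho> by simp
  have near: "a - r \<le> a' + r' + \<beta> * \<rho>" if "(a, r) \<in> bad" "(a', r') \<in> bad" for a r a' r'
  proof -
    let ?A = "\<lambda>a r. {(E, s, R) \<in> F. E \<inter> cball a r \<noteq> {} \<and> R \<in> {\<beta> * \<rho>..}}"
    have sub: "?A b t \<subseteq> ?A c \<rho>" if "(b, t) \<in> bad" for b t
      using that unfolding bad_def by fast
    have finA: "finite (?A b t)" for b t
      using fin by (rule rev_finite_subset) auto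
    have heavy: "3 / 8 * \<rho> powr g < (\<Sum>(E, s, R) \<in> ?A b t. s powr g)" if "(b, t) \<in> bad" for b t
    proof -
      have t: "\<beta> * \<rho> \<le> t" using that unfolding bad_def by auto
      have "3 / 8 * \<rho> powr g = (\<beta> * \<rho>) powr g / 2"
        using \<beta> \<rho> g(2) by (simp add: powr_mult)
      also have "\<dots> \<le> t powr g / 2"
        using powr_mono2[of g "\<beta> * \<rho>" t] \<beta>\<rho> g t by simp
      also have "\<dots> < live_weight g F (cball b t) {t..}"
        using that unfolding bad_def by auto
      also have "\<dots> \<le> live_weight g F (cball b t) {\<beta> * \<rho>..}"
        using t by (intro live_weight_mono fin) auto
      finally show ?thesis unfolding live_weight_def .
    qed
    have "?A a r \<inter> ?A a' r' \<noteq> {}"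
    proof
      assume disj: "?A a r \<inter> ?A a' r' = {}"
      have "(\<Sum>(E, s, R) \<in> ?A a r. s powr g) + (\<Sum>(E, s, R) \<in> ?A a' r'. s powr g)
         = (\<Sum>(E, s, R) \<in> ?A a r \<union> ?A a' r'. s powr g)"
        by (rule sum.union_disjoint[OF finA finA disj, symmetric])
      also have "\<dots> \<le> (\<Sum>(E, s, R) \<in> ?A c \<rho>. s powr g)"
        by (rule sum_mono2[OF finA]) (use sub[OF that(1)] sub[OF that(2)] in auto)
      also have "\<dots> \<le> 3 / 4 * \<rho> powr g" using w unfolding live_weight_def .
      finally show False using heavy[OF that(1)] heavy[OF that(2)] by linarith
    qed
    then obtain E s R where E: "(E, s, R) \<in> F" "E \<inter> cball a r \<noteq> {}" "E \<inter> cball a' r' \<noteq> {}"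
       "R \<ge> \<beta> * \<rho>" by auto
    have "E \<inter> cball c \<rho> \<noteq> {}" using E(2) that(1) unfolding bad_def by auto
    then have "s powr g \<le> 3 / 4 * \<rho> powr g"
      using powr_le_live_weight[OF fin E(1), of "cball c \<rho>" "{\<beta> * \<rho>..}" g] E(4) w by simp
    also have "\<dots> = (\<beta> * \<rho>) powr g" using \<beta> \<rho> g(2) by (simp add: powr_mult)
    finally have s: "s \<le> \<beta> * \<rho>"
      using powr_less_mono2[of g "\<beta> * \<rho>" s] \<beta>\<rho> g(1) by linarith
    obtain x y where "x \<in> E" "y \<in> E" "x \<in> cball a r" "y \<in> cball a' r'" using E by blast
    then show ?thesis using F[OF E(1)] s by (fastforce simp: dist_real_def)
  qed
  have rpos: "r > 0" if "(a, r) \<in> bad" for a r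
    using that \<beta>\<rho> unfolding bad_def by auto
  define z where "z = (SUP (a, r) \<in> bad. a - r)"
  have z: "a - r \<le> z \<and> z \<le> a + r + \<beta> * \<rho>" if "(a, r) \<in> bad" for a r
  proof
    have "bdd_above ((\<lambda>(a, r). a - r) ` bad)"
      using near[OF _ that] by (intro bdd_aboveI[of _ "a + r + \<beta> * \<rho>"]) auto
    then show "a - r \<le> z" unfolding z_def using that by (intro cSUP_upper2[of _ _ "(a, r)"]) auto
    show "z \<le> a + r + \<beta> * \<rho>"
      unfolding z_def using near[OF _ that] that by (intro cSUP_least) auto
  qed
  show ?thesis
  proof (intro exI[of _ z] allI impI)
    fix c' \<rho>' assume *: "\<beta> * \<rho> \<le> \<rho>'" "cball c' \<rho>' \<subseteq> cball c \<rho> - cball z (\<beta> * \<rho>)"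
    show "live_weight g F (cball c' \<rho>') {\<rho>'..} \<le> \<rho>' powr g / 2"
    proof (rule ccontr)
      assume "\<not> ?thesis"
      then have b: "(c', \<rho>') \<in> bad" using * unfolding bad_def by auto
      have "min z (c' + \<rho>') \<in> cball c' \<rho>'" "min z (c' + \<rho>') \<in> cball z (\<beta> * \<rho>)"
        using z[OF b] rpos[OF b] \<beta>\<rho> by (auto simp: dist_real_def min_def)
      then show False using *(2) by blast
    qed
  qed
qed

text \<open>Deleting a neighborhood of the common point preserves tameness under every legal answer.\<close>

lemma tame_family_move:
  assumes tame: "tame_family \<beta> g c \<rho> F"
    and \<beta>: "0 < \<beta>" "\<beta> < 1" and g: "0 < g" "\<beta> powr g = 3 / 4" and \<rho>: "0 < \<rho>"
  shows "\<exists>z. \<forall>c' \<rho>'. \<beta> * \<rho> \<le> \<rho>' \<longrightarrow> cball c' \<rho>' \<subseteq> cball c \<rho> - cball z (\<beta> * \<rho>) \<longrightarrow>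
     tame_family \<beta> g c' \<rho>' F"
proof -
  have fin: "finite F" and F: "\<And>E s R. (E, s, R) \<in> F \<Longrightarrow> 0 < s \<and> (\<forall>x\<in>E. \<forall>y\<in>E. \<bar>x - y\<bar> \<le> s)"
    using tame unfolding tame_family_def by auto
  have "{\<beta> * \<rho>..} = {\<beta> * \<rho>..<\<rho>} \<union> {\<rho>..}"
    using \<beta> \<rho> by (auto simp: mult_le_cancel_right1) (metis \<beta>(2) less_eq_real_def mult_le_cancel_right1 not_less order_trans)
  moreover have "{\<beta> * \<rho>..<\<rho>} \<inter> {\<rho>..} = {}" by auto
  ultimately have "live_weight g F (cball c \<rho>) {\<beta> * \<rho>..} =
     live_weight g F (cball c \<rho>) {\<beta> * \<rho>..<\<rho>} + live_weight g F (cball c \<rho>) {\<rho>..}"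
    using live_weight_split[OF fin, of "{\<beta> * \<rho>..<\<rho>}" "{\<rho>..}"] by simp
  also have "\<dots> \<le> \<rho> powr g / 4 + \<rho> powr g / 2"
    using tame \<rho> unfolding tame_family_def by (intro add_mono) auto
  finally have w: "live_weight g F (cball c \<rho>) {\<beta> * \<rho>..} \<le> 3 / 4 * \<rho> powr g" by simp
  obtain z where z: "\<And>c' \<rho>'. \<beta> * \<rho> \<le> \<rho>' \<Longrightarrow> cball c' \<rho>' \<subseteq> cball c \<rho> - cball z (\<beta> * \<rho>) \<Longrightarrow>
     live_weight g F (cball c' \<rho>') {\<rho>'..} \<le> \<rho>' powr g / 2"
    using heavy_balls_near_common_point[OF fin _ \<beta> g \<rho> w] F by blast
  have "tame_family \<beta> g c' \<rho>' F"
    if *: "\<beta> * \<rho> \<le> \<rho>'" "cball c' \<rho>' \<subseteq> cball c \<rho> - cball z (\<beta> * \<rho>)" for c' \<rho>'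
  proof -
    have sub: "cball c' \<rho>' \<subseteq> cball c \<rho>" using *(2) by blast
    have "0 < \<beta> * \<rho>" using \<beta> \<rho> by simp
    then have "0 < \<rho>'" using *(1) by linarith
    then have "dist c' c + \<rho>' \<le> \<rho>" using sub by (simp add: cball_subset_cball_iff)
    then have "\<rho>' \<le> \<rho>" using zero_le_dist[of c' c] by linarith
    then show ?thesis
      using \<open>0 < \<rho>'\<close> tame z[OF *] sub unfolding tame_family_def by (meson order_trans)
  qed
  then show ?thesis by blast
qed

text \<open>Alice keeps one tame family alive until the ball avoids all of its sets, and then turns to the
  next one. A ball that is small compared with all members of the family avoids them, since the
  weight of each of them exceeds the weight that a tame family puts on the ball.\<close>

lemma potential_game:
  fixes V :: "real set" and G :: "nat \<Rightarrow> real set"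
  assumes \<beta>: "0 < \<beta>" "\<beta> < 1" and g: "0 < g" "\<beta> powr g = 3 / 4"
    and fam: "\<And>N c \<rho>. 0 < \<rho> \<Longrightarrow> cball c \<rho> \<subseteq> V \<Longrightarrow>
      \<exists>F. tame_family \<beta> g c \<rho> F \<and> V - \<Union>(fst ` F) \<subseteq> G N"
  shows "alice_wins (range (\<lambda>c. {c})) \<beta> V (\<Inter>N. G N)"
proof -
  define fm where "fm = (\<lambda>N b. SOME F. tame_family \<beta> g (fst b) (snd b) F \<and> V - \<Union>(fst ` F) \<subseteq> G N)"
  have fm: "tame_family \<beta> g (fst b) (snd b) (fm N b)" "V - \<Union>(fst ` (fm N b)) \<subseteq> G N"
    if "0 < snd b" "cball (fst b) (snd b) \<subseteq> V" for N b
    using someI_ex[OF fam[OF that, of N]] unfolding fm_def by auto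
  define avoids :: "(real set \<times> real \<times> real) set \<Rightarrow> real \<times> real \<Rightarrow> bool"
    where "avoids = (\<lambda>F b. cball (fst b) (snd b) \<inter> \<Union>(fst ` F) = ({} :: real set))"
  define step where "step = (\<lambda>st b. if avoids (snd st) b
     then (Suc (fst st), fm (Suc (fst st)) b) else (st :: nat \<times> (real set \<times> real \<times> real) set))"
  define state where "state = (\<lambda>h. foldl step (0, fm 0 (hd h)) (tl h))"
  define good where "good = (\<lambda>F b z. \<forall>c' \<rho>'. \<beta> * snd b \<le> \<rho>' \<longrightarrow>
     cball c' \<rho>' \<subseteq> cball (fst b) (snd b) - cball z (\<beta> * snd b) \<longrightarrow> tame_family \<beta> g c' \<rho>' F)"
  define mv where "mv = (\<lambda>F b. SOME z. good F b z)"
  define \<sigma> :: "real strategy" where "\<sigma> = (\<lambda>h. ({mv (snd (state h)) (last h)}, \<beta> * snd (last h)))"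
  have "legal_strategy (range (\<lambda>c. {c})) \<beta> \<sigma>"
    using \<beta> by (auto simp: legal_strategy_def \<sigma>_def)
  moreover have "(\<Inter>n. cball (fst (B n)) (snd (B n))) \<inter> (\<Inter>N. G N) \<noteq> {}"
    if B: "legal_play \<beta> V \<sigma> B" and lim: "(\<lambda>n. snd (B n)) \<longlonglongrightarrow> 0" for B
  proof -
    note pos = legal_play_radius_pos[OF \<beta>(1) B] and inV = legal_play_ball_subset[OF \<beta>(1) B]
    define st where "st = (\<lambda>n. state (map B [0..<Suc n]))"
    have st0: "st 0 = (0, fm 0 (B 0))" by (simp add: st_def state_def)
    have stSuc: "st (Suc n) = step (st n) (B (Suc n))" for n
    proof -
      have tl: "tl (map B [0..<Suc (Suc n)]) = tl (map B [0..<Suc n]) @ [B (Suc n)]"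
        by (simp add: upt_rec[of 0])
      have hd: "hd (map B [0..<Suc m]) = B 0" for m by (simp add: upt_rec[of 0])
      show ?thesis unfolding st_def state_def tl hd by simp
    qed
    have inv: "tame_family \<beta> g (fst (B n)) (snd (B n)) (snd (st n)) \<and>
               V - \<Union>(fst ` (snd (st n))) \<subseteq> G (fst (st n))" for n
    proof (induction n)
      case 0
      then show ?case using fm[OF pos inV, of 0 0] unfolding st0 fst_conv snd_conv by blast
    next
      case (Suc n)
      let ?F = "snd (st n)"
      have "\<exists>z. good ?F (B n) z"
        unfolding good_def using tame_family_move[OF _ \<beta> g pos] Suc by blast
      then have mv: "good ?F (B n) (mv ?F (B n))" unfolding mv_def by (rule someI_ex)
      have "cball (fst (B (Suc n))) (snd (B (Suc n)))
            \<subseteq> cball (fst (B n)) (snd (B n)) - case_prod closed_nbhd (\<sigma> (map B [0..<Suc n]))"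
          "\<beta> * snd (B n) \<le> snd (B (Suc n))"
        using B unfolding legal_play_def by meson+
      moreover have "case_prod closed_nbhd (\<sigma> (map B [0..<Suc n])) =
         cball (mv ?F (B n)) (\<beta> * snd (B n))"
        by (simp add: \<sigma>_def closed_nbhd_singleton st_def del: upt_Suc) simp
      ultimately have "tame_family \<beta> g (fst (B (Suc n))) (snd (B (Suc n))) ?F"
        using mv unfolding good_def by metis
      then show ?case
        using fm[OF pos inV] Suc by (auto simp: stSuc step_def)
    qed
    have avoid: "\<exists>m>n. avoids (snd (st n)) (B m)" for n
    proof (rule ccontr)
      assume no: "\<not> (\<exists>m>n. avoids (snd (st n)) (B m))"
      define F where "F = snd (st n)"
      have same: "st (n + k) = st n" for k
        using no by (induction k) (auto simp: stSuc step_def)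
      have finF: "finite F" and posF: "\<And>E s R. (E, s, R) \<in> F \<Longrightarrow> 0 < s \<and> 0 < R"
        using inv[of n] unfolding tame_family_def F_def by auto
      have ev: "eventually (\<lambda>m. snd (B m) < min R s) sequentially" if "(E, s, R) \<in> F" for E s R
        by (intro order_tendstoD(2)[OF lim]) (use posF[OF that] in simp)
      have "eventually (\<lambda>m. \<forall>(E, s, R)\<in>F. snd (B m) < min R s) sequentially"
        using ev by (auto simp: eventually_ball_finite_distrib[OF finF] split: prod.splits)
      then obtain m0 where m0: "\<And>m. m \<ge> m0 \<Longrightarrow> \<forall>(E, s, R)\<in>F. snd (B m) < min R s"
        unfolding eventually_sequentially by blast
      define m where "m = n + Suc m0"
      have "st m = st n" using same unfolding m_def by blast
      then have "tame_family \<beta> g (fst (B m)) (snd (B m)) F" using inv[of m] unfolding F_def by simp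
      then have le: "live_weight g F (cball (fst (B m)) (snd (B m))) {snd (B m)..} \<le> snd (B m) powr g / 2"
        unfolding tame_family_def by blast
      have "\<not> avoids F (B m)" using no unfolding m_def F_def by auto
      then obtain E s R where E: "(E, s, R) \<in> F" "E \<inter> cball (fst (B m)) (snd (B m)) \<noteq> {}"
        unfolding avoids_def by fastforce
      have sm: "snd (B m) < R" "snd (B m) < s" using m0[of m] E(1) unfolding m_def by auto
      have "s powr g \<le> snd (B m) powr g / 2"
        using powr_le_live_weight[OF finF E, of "{snd (B m)..}" g] le sm by auto
      also have "\<dots> < snd (B m) powr g" using pos[of m] by simp
      also have "\<dots> < s powr g" using sm pos[of m] g by (intro powr_less_mono2) auto
      finally have "s powr g < s powr g" .
      then show False by simp
    qed
    have round: "\<exists>n. fst (st n) = N" for N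
    proof (induction N)
      case 0
      then show ?case using st0 by (metis fst_conv)
    next
      case (Suc N)
      then obtain n where n: "fst (st n) = N" by blast
      define m where "m = (LEAST m. m > n \<and> avoids (snd (st n)) (B m))"
      have m: "m > n" "avoids (snd (st n)) (B m)"
        using LeastI_ex[OF avoid[of n]] unfolding m_def by auto
      have before: "\<not> avoids (snd (st n)) (B k)" if "n < k" "k < m" for k
        using not_less_Least[of k "\<lambda>m. m > n \<and> avoids (snd (st n)) (B m)"] that unfolding m_def by blast
      have "n + k < m \<longrightarrow> st (n + k) = st n" for k
        using before by (induction k) (auto simp: stSuc step_def)
      from this[of "m - 1 - n"] have "st (m - 1) = st n" using m(1) by auto
      then have "st m = step (st n) (B m)" using stSuc[of "m - 1"] m(1) by simp
      then have "fst (st m) = Suc N" using m(2) n by (simp add: step_def)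
      then show ?case by blast
    qed
    obtain z where z: "\<And>n. z \<in> cball (fst (B n)) (snd (B n))"
      using legal_play_limit_exists[OF \<beta>(1) B] by blast
    have "z \<in> G N" for N
    proof -
      obtain n where n: "fst (st n) = N" using round by blast
      obtain m where "avoids (snd (st n)) (B m)" using avoid by blast
      then have "z \<notin> \<Union>(fst ` (snd (st n)))" using z[of m] unfolding avoids_def by blast
      moreover have "z \<in> V" using z[of 0] inV[of 0] by (rule rev_subsetD)
      ultimately show ?thesis using inv[of n] n by blast
    qed
    then show ?thesis using z by blast
  qed
  ultimately show ?thesis unfolding alice_wins_def by blast
qed

section \<open>Rational points near a planar curve\<close>

text \<open>The parameter \<open>u\<close> is \<open>exp s\<close> for the element \<open>diag3 s (T - s)\<close> of the fiber, and \<open>Q = exp T\<close>.\<close>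

definition bad_point :: "real \<Rightarrow> real \<Rightarrow> real \<Rightarrow> real \<Rightarrow> bool" where
  "bad_point Q \<epsilon> x y \<longleftrightarrow>
     (\<exists>(q::int) (p::int) (r::int) u. (1::int) \<le> q \<and> q \<le> \<epsilon> * Q \<and> 1 \<le> u \<and> u \<le> Q \<and>
        \<bar>q * x - p\<bar> < \<epsilon> / u \<and> \<bar>q * y - r\<bar> < \<epsilon> * u / Q)"
  for Q \<epsilon> x y :: real

text \<open>The pairs \<open>(A, B)\<close> with \<open>q dvd A p + B r\<close> form a lattice of covolume at most \<open>q\<close>; two of the
  more than \<open>q\<close> pairs in the box give the same residue.\<close>

lemma small_line_through_rational_point:
  fixes p r q :: int and a b :: real
  assumes q: "1 \<le> q" and ab: "0 \<le> a" "0 \<le> b" "q \<le> a * b"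
  shows "\<exists>A B C :: int. (A \<noteq> 0 \<or> B \<noteq> 0) \<and> \<bar>A\<bar> \<le> a \<and> \<bar>B\<bar> \<le> b \<and> A * p + B * r + C * q = 0"
proof -
  define D where "D = {0..\<lfloor>a\<rfloor>} \<times> {0..\<lfloor>b\<rfloor>}"
  define f where "f = (\<lambda>(u, v). (u * p + v * r) mod q)"
  have fl: "0 \<le> \<lfloor>a\<rfloor>" "0 \<le> \<lfloor>b\<rfloor>" using ab by auto
  have "real_of_int q \<le> a * b" by (rule ab(3))
  also have "\<dots> < real_of_int (\<lfloor>a\<rfloor> + 1) * real_of_int (\<lfloor>b\<rfloor> + 1)"
    using ab(1,2) by (intro mult_strict_mono') linarith+
  finally have "q < (\<lfloor>a\<rfloor> + 1) * (\<lfloor>b\<rfloor> + 1)" by (metis of_int_less_iff of_int_mult)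
  moreover have "card D = nat ((\<lfloor>a\<rfloor> + 1) * (\<lfloor>b\<rfloor> + 1))"
    using fl by (simp add: D_def card_cartesian_product nat_mult_distrib)
  moreover have "f ` D \<subseteq> {0..<q}" using q by (auto simp: f_def)
  then have "card (f ` D) \<le> nat q" using card_mono[of "{0..<q}" "f ` D"] by simp
  ultimately have "card (f ` D) < card D" using q by linarith
  then have "\<not> inj_on f D" by (rule pigeonhole)
  then obtain u v u' v' where uv: "(u, v) \<in> D" "(u', v') \<in> D" "(u, v) \<noteq> (u', v')"
    "(u * p + v * r) mod q = (u' * p + v' * r) mod q"
    unfolding inj_on_def f_def by auto
  from uv(4) have "q dvd (u * p + v * r) - (u' * p + v' * r)" by (simp add: mod_eq_dvd_iff)
  then obtain k where "(u * p + v * r) - (u' * p + v' * r) = q * k" by (elim dvdE)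
  then have "(u - u') * p + (v - v') * r + (- k) * q = 0" by (simp add: algebra_simps)
  moreover have "\<bar>u - u'\<bar> \<le> \<lfloor>a\<rfloor>" "\<bar>v - v'\<bar> \<le> \<lfloor>b\<rfloor>" using uv(1,2) unfolding D_def by auto
  then have "\<bar>u - u'\<bar> \<le> a" "\<bar>v - v'\<bar> \<le> b" by (simp_all add: le_floor_iff)
  moreover have "u - u' \<noteq> 0 \<or> v - v' \<noteq> 0" using uv(3) by auto
  ultimately show ?thesis
    by (intro exI[of _ "u - u'"] exI[of _ "v - v'"] exI[of _ "- k"] conjI; simp only:)
qed

lemma card_int_set_le_spread:
  fixes S :: "int set"
  assumes "\<And>i j. i \<in> S \<Longrightarrow> j \<in> S \<Longrightarrow> real_of_int (j - i) \<le> n"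
  shows "finite S \<and> real (card S) \<le> \<bar>n\<bar> + 1"
proof (cases "S = {}")
  case False
  then obtain i where i: "i \<in> S" by blast
  have "S \<subseteq> {i - \<lfloor>n\<rfloor>..i + \<lfloor>n\<rfloor>}"
  proof
    fix j assume "j \<in> S"
    then have "j - i \<le> \<lfloor>n\<rfloor>" "i - j \<le> \<lfloor>n\<rfloor>" using assms i by (auto simp only: le_floor_iff)
    then show "j \<in> {i - \<lfloor>n\<rfloor>..i + \<lfloor>n\<rfloor>}" by simp
  qed
  then have fin: "finite S" by (rule finite_subset) simp
  define m where "m = Min S"
  have m: "m \<in> S" "\<And>j. j \<in> S \<Longrightarrow> m \<le> j" using fin False unfolding m_def by auto
  have n: "0 \<le> n" using assms[OF i i] by simp
  have "S \<subseteq> {m..m + \<lfloor>n\<rfloor>}"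
  proof
    fix j assume j: "j \<in> S"
    then have "j - m \<le> \<lfloor>n\<rfloor>" using assms m(1) by (auto simp only: le_floor_iff)
    then show "j \<in> {m..m + \<lfloor>n\<rfloor>}" using m(2)[OF j] by simp
  qed
  then have "card S \<le> card {m..m + \<lfloor>n\<rfloor>}" by (intro card_mono) auto
  also have "\<dots> = nat (\<lfloor>n\<rfloor> + 1)" by simp
  finally have "real (card S) \<le> real (nat (\<lfloor>n\<rfloor> + 1))" by simp
  also have "\<dots> \<le> n + 1" using n by simp
  finally show ?thesis using fin n by simp
qed simp


lemma mean_value_within:
  fixes f f' :: "real \<Rightarrow> real"
  assumes "convex J" "\<And>t. t \<in> J \<Longrightarrow> (f has_real_derivative f' t) (at t within J)" "x \<in> J" "y \<in> J" "x \<le> y"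
  shows "\<exists>z\<in>J. x \<le> z \<and> z \<le> y \<and> f y - f x = f' z * (y - x)"
proof -
  have sub: "{x..y} \<subseteq> J"
    using assms closed_segment_subset[of x J y] by (simp add: closed_segment_eq_real_ivl)
  have "\<exists>z\<in>{x..y}. f y - f x = (\<lambda>h. f' z * h) (y - x)"
  proof (rule mvt_very_simple[OF assms(5)])
    fix t assume "x \<le> t" "t \<le> y"
    then show "(f has_derivative (\<lambda>h. f' t * h)) (at t within {x..y})"
      using assms(2)[of t] sub unfolding has_field_derivative_def
      by (meson atLeastAtMost_iff has_derivative_subset subsetD)
  qed
  then show ?thesis using sub by auto
qed

text \<open>The two pieces are distinguished by the sign of the derivative: on each of them \<open>f\<close> moves by at
  least \<open>w d\<^sup>2 / 2\<close> over a distance \<open>d\<close>.\<close>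

lemma convex_sublevel_cover:
  fixes f f1 f2 :: "real \<Rightarrow> real"
  assumes J: "convex J" "Z \<subseteq> J"
    and f: "\<And>t. t \<in> J \<Longrightarrow> (f has_real_derivative f1 t) (at t within J)"
    and f1: "\<And>t. t \<in> J \<Longrightarrow> (f1 has_real_derivative f2 t) (at t within J)"
    and w: "0 < w" "\<And>t. t \<in> J \<Longrightarrow> w \<le> f2 t" and small: "\<And>t. t \<in> Z \<Longrightarrow> \<bar>f t\<bar> \<le> l"
  shows "\<exists>P. Z \<subseteq> P True \<union> P False \<and>
     (\<forall>e. \<forall>x\<in>P e. \<forall>y\<in>P e. \<bar>x - y\<bar> \<le> 2 * sqrt (l / w))"
proof -
  have incr: "f1 y - f1 x \<ge> w * (y - x)" if xy: "x \<in> J" "y \<in> J" "x \<le> y" for x y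
  proof -
    obtain z where z: "z \<in> J" "f1 y - f1 x = f2 z * (y - x)"
      using mean_value_within[OF J(1) f1 xy] by blast
    then show ?thesis using w(2)[of z] xy(3) by (simp add: mult_right_mono)
  qed
  have quad: "((\<lambda>t. f t - w * (t - p)\<^sup>2 / 2) has_real_derivative f1 t - w * (t - p)) (at t within J)"
    if "t \<in> J" for t p
    using f[OF that] by (auto intro!: derivative_eq_intros simp: power2_eq_square)
  have bound: "y - x \<le> 2 * sqrt (l / w)"
    if "x \<in> Z" "y \<in> Z" "x \<le> y" "w * (y - x)\<^sup>2 / 2 \<le> \<bar>f y - f x\<bar>" for x y
  proof -
    have "w * (y - x)\<^sup>2 / 2 \<le> 2 * l" using that(4) small[OF that(1)] small[OF that(2)] by linarith
    then have "(y - x)\<^sup>2 \<le> 4 * (l / w)" using w(1) by (simp add: field_simps)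
    then have "y - x \<le> sqrt (4 * (l / w))" by (rule real_le_rsqrt)
    then show ?thesis by (simp only: real_sqrt_mult real_sqrt_four)
  qed
  define P where "P = (\<lambda>e. {t \<in> Z. (f1 t \<ge> 0) = e})"
  have le: "y - x \<le> 2 * sqrt (l / w)" if xy: "x \<in> P e" "y \<in> P e" "x \<le> y" for x y e
  proof (rule bound)
    show Z: "x \<in> Z" "y \<in> Z" "x \<le> y" using xy unfolding P_def by auto
    then have xyJ: "x \<in> J" "y \<in> J" using J(2) by auto
    show "w * (y - x)\<^sup>2 / 2 \<le> \<bar>f y - f x\<bar>"
    proof (cases e)
      case True
      obtain z where z: "z \<in> J" "x \<le> z"
        "(f y - w * (y - x)\<^sup>2 / 2) - (f x - w * (x - x)\<^sup>2 / 2) = (f1 z - w * (z - x)) * (y - x)"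
        using mean_value_within[OF J(1) quad[of _ x] xyJ xy(3)] by blast
      have "0 \<le> f1 z - w * (z - x)" using incr[OF xyJ(1) z(1,2)] xy(1) True unfolding P_def by simp
      then have "0 \<le> (f1 z - w * (z - x)) * (y - x)" using xy(3) by simp
      then have "w * (y - x)\<^sup>2 / 2 \<le> f y - f x" using z(3) by simp
      then show ?thesis by linarith
    next
      case False
      obtain z where z: "z \<in> J" "z \<le> y"
        "(f y - w * (y - y)\<^sup>2 / 2) - (f x - w * (x - y)\<^sup>2 / 2) = (f1 z - w * (z - y)) * (y - x)"
        using mean_value_within[OF J(1) quad[of _ y] xyJ xy(3)] by blast
      have "f1 z - w * (z - y) \<le> 0"
        using incr[OF z(1) xyJ(2) z(2)] xy(2) False unfolding P_def by (simp add: algebra_simps)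
      then have "(f1 z - w * (z - y)) * (y - x) \<le> 0" using xy(3) by (simp add: mult_nonpos_nonneg)
      then have "w * (y - x)\<^sup>2 / 2 \<le> f x - f y" using z(3) by (simp add: power2_commute)
      then show ?thesis by linarith
    qed
  qed
  have "\<bar>x - y\<bar> \<le> 2 * sqrt (l / w)" if "x \<in> P e" "y \<in> P e" for x y e
    using le[OF that] le[OF that(2) that(1)] by linarith
  moreover have "Z \<subseteq> P True \<union> P False" unfolding P_def by auto
  ultimately show ?thesis by blast
qed

lemma curved_sublevel_cover:
  fixes f f1 f2 :: "real \<Rightarrow> real"
  assumes J: "convex J" "Z \<subseteq> J"
    and f: "\<And>t. t \<in> J \<Longrightarrow> (f has_real_derivative f1 t) (at t within J)"
    and f1: "\<And>t. t \<in> J \<Longrightarrow> (f1 has_real_derivative f2 t) (at t within J)"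
    and f2: "continuous_on J f2"
    and w: "0 < w" "\<And>t. t \<in> J \<Longrightarrow> w \<le> \<bar>f2 t\<bar>" and small: "\<And>t. t \<in> Z \<Longrightarrow> \<bar>f t\<bar> \<le> l"
  shows "\<exists>P. Z \<subseteq> P True \<union> P False \<and>
     (\<forall>e. \<forall>x\<in>P e. \<forall>y\<in>P e. \<bar>x - y\<bar> \<le> 2 * sqrt (l / w))"
proof (cases "\<forall>t\<in>J. w \<le> f2 t")
  case True
  then show ?thesis using convex_sublevel_cover[OF J f f1 w(1) _ small] by blast
next
  case False
  then obtain t0 where t0: "t0 \<in> J" "\<not> w \<le> f2 t0" by blast
  have neg: "w \<le> - f2 t" if "t \<in> J" for t
  proof (rule ccontr)
    assume "\<not> ?thesis"
    then have pos: "0 \<le> f2 t" using w(2)[OF that] w(1) by linarith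
    have "connected (f2 ` J)"
      using f2 convex_connected[OF J(1)] by (rule connected_continuous_image)
    then have "{f2 t0..f2 t} \<subseteq> f2 ` J"
      using t0(1) that by (intro connected_contains_Icc) auto
    moreover have "f2 t0 \<le> 0" using t0(2) w(1) w(2)[OF t0(1)] by linarith
    ultimately have "0 \<in> f2 ` J" using pos by (auto dest: subsetD)
    then show False using w by force
  qed
  show ?thesis
    by (rule convex_sublevel_cover[OF J, of "\<lambda>t. - f t" "\<lambda>t. - f1 t" "\<lambda>t. - f2 t"])
       (use f f1 w(1) neg small in \<open>auto intro!: DERIV_minus\<close>)
qed

lemma sqrt_ratio_le:
  fixes H q :: real
  assumes "1 \<le> H" "1 \<le> q"
  shows "sqrt (H / q) \<le> H"
proof -
  have "H / q \<le> H / 1" using assms by (intro divide_left_mono) auto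
  also have "\<dots> \<le> H\<^sup>2" using assms by (simp add: power2_eq_square)
  finally show ?thesis using assms(1) by (simp add: real_le_lsqrt)
qed

text \<open>A bounded piece of a planar curve on which both coordinates are strictly monotone and the
  curvature does not vanish, with uniform bounds.\<close>

locale curve_piece =
  fixes I :: "real set" and X Y X1 Y1 X2 Y2 :: "real \<Rightarrow> real" and a b :: real
  assumes a: "0 < a" "a \<le> 1" and b: "1 \<le> b" and I: "convex I" "bounded I"
    and X: "\<And>t. t \<in> I \<Longrightarrow> (X has_real_derivative X1 t) (at t within I)"
    and Y: "\<And>t. t \<in> I \<Longrightarrow> (Y has_real_derivative Y1 t) (at t within I)"
    and X1: "\<And>t. t \<in> I \<Longrightarrow> (X1 has_real_derivative X2 t) (at t within I)"
    and Y1: "\<And>t. t \<in> I \<Longrightarrow> (Y1 has_real_derivative Y2 t) (at t within I)"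
    and X2: "continuous_on I X2" and Y2: "continuous_on I Y2"
    and bX: "\<And>t. t \<in> I \<Longrightarrow> a \<le> \<bar>X1 t\<bar> \<and> \<bar>X1 t\<bar> \<le> b \<and> \<bar>X2 t\<bar> \<le> b"
    and bY: "\<And>t. t \<in> I \<Longrightarrow> a \<le> \<bar>Y1 t\<bar> \<and> \<bar>Y1 t\<bar> \<le> b \<and> \<bar>Y2 t\<bar> \<le> b"
    and curved: "\<And>t. t \<in> I \<Longrightarrow> a \<le> \<bar>X1 t * Y2 t - Y1 t * X2 t\<bar>"
begin

text \<open>A bad point \<open>t\<close> of the curve, the rational point \<open>(p / q, r / q)\<close> responsible for it, and a line
  through this rational point whose coefficients are small for the same \<open>u\<close>.\<close>

definition item where
  "item Q \<epsilon> t q p r u A B C \<longleftrightarrow>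
     1 \<le> q \<and> q \<le> \<epsilon> * Q \<and> 1 \<le> u \<and> u \<le> Q \<and>
     \<bar>q * X t - p\<bar> < \<epsilon> / u \<and> \<bar>q * Y t - r\<bar> < \<epsilon> * u / Q \<and>
     (A \<noteq> 0 \<or> B \<noteq> 0) \<and> \<bar>A\<bar> \<le> sqrt (q / Q) * u \<and> \<bar>B\<bar> \<le> sqrt (q * Q) / u \<and>
     A * p + B * r + C * q = 0"
  for q p r A B C :: int and Q \<epsilon> t u :: real

text \<open>The relevant length scale of a line is the reciprocal of \<open>q\<close> times its slope along the curve; the term
  with \<open>c1\<close> keeps the slope from varying by more than a fraction of itself over a cell of length
  \<open>scale k j\<close> when the curve is nearly tangent to the line. The constant \<open>c\<close> is chosen so small that
  cells are short enough for this, \<open>M\<close> bounds the ratio of coefficients within a class, and \<open>K\<close> is the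
  constant in the relative width of the final cover.\<close>

definition c1 where "c1 = a / (8 * b)"
definition c where "c = c1\<^sup>2 / (256 * b)"
definition M where "M = 5 * b / a"
definition K where "K = 6 * M / c + 4 * sqrt (M * b * c1\<^sup>2 / (a * c\<^sup>2))"

definition slope where
  "slope q A B t = max \<bar>A * X1 t + B * Y1 t\<bar> (c1 * sqrt (max \<bar>A\<bar> \<bar>B\<bar> / q))"
  for q A B :: int

definition in_class where
  "in_class ty k j q A B t \<longleftrightarrow> (ty \<longleftrightarrow> \<bar>B\<bar> \<le> \<bar>A\<bar>) \<and> 2 ^ k \<le> q \<and> q < 2 * 2 ^ k \<and>
     2 powr j \<le> slope q A B t \<and> slope q A B t < 2 * 2 powr j"
  for q A B j :: int and k :: nat

definition scale :: "nat \<Rightarrow> int \<Rightarrow> real" where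
  "scale k j = c / (2 ^ k * 2 powr j)"

text \<open>For a rational point with \<open>q\<close> about \<open>2 ^ k\<close>, the product of \<open>q\<close> and of \<open>f\<close> at a bad point is at most a
  constant times \<open>\<mu> Q \<epsilon> k\<close>.\<close>

definition \<mu> :: "real \<Rightarrow> real \<Rightarrow> nat \<Rightarrow> real" where
  "\<mu> Q \<epsilon> k = \<epsilon> * sqrt (2 ^ k / Q)"

lemma constants: "0 < c1" "c1 \<le> 1 / 8" "0 < c" "c \<le> 1 / 1000" "1 \<le> M" "0 < K"
proof -
  show c1: "0 < c1" using a b by (simp add: c1_def)
  show c1': "c1 \<le> 1 / 8" using a b by (simp add: c1_def field_simps)
  show c: "0 < c" using c1 b by (simp add: c_def)
  have "c1\<^sup>2 \<le> (1 / 8)\<^sup>2" using c1 c1' by (intro power_mono) auto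
  then have "c \<le> (1 / 64) / (256 * 1)" unfolding c_def using b by (intro frac_le) (auto simp: power2_eq_square)
  then show "c \<le> 1 / 1000" by simp
  show M: "1 \<le> M" using a b by (simp add: M_def field_simps)
  show "0 < K" unfolding K_def using M c c1 a b by (intro add_pos_nonneg) auto
qed

lemma in_class_q:
  assumes "in_class ty k j q A B t"
  shows "(2::real) ^ k \<le> real_of_int q" "real_of_int q < (2::real) * 2 ^ k"
  using assms of_int_le_iff[of "2 ^ k" q, where ?'a = real] of_int_less_iff[of q "2 * 2 ^ k", where ?'a = real]
  unfolding in_class_def by auto

lemma scale_pos: "0 < scale k j"
  using constants(3) by (simp add: scale_def)

lemma item_products:
  fixes q p r A B C :: int
  assumes "item Q \<epsilon> t q p r u A B C" "0 < \<epsilon>" "1 \<le> Q"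
  shows "\<bar>A\<bar> * \<bar>q * X t - p\<bar> \<le> \<epsilon> * sqrt (q / Q)" "\<bar>B\<bar> * \<bar>q * Y t - r\<bar> \<le> \<epsilon> * sqrt (q / Q)"
proof -
  have i: "1 \<le> q" "1 \<le> u" "\<bar>q * X t - p\<bar> < \<epsilon> / u" "\<bar>q * Y t - r\<bar> < \<epsilon> * u / Q"
    "\<bar>A\<bar> \<le> sqrt (q / Q) * u" "\<bar>B\<bar> \<le> sqrt (q * Q) / u"
    using assms(1) unfolding item_def by auto
  have "\<bar>A\<bar> * \<bar>q * X t - p\<bar> \<le> (sqrt (q / Q) * u) * (\<epsilon> / u)"
    using i assms by (intro mult_mono) auto
  then show "\<bar>A\<bar> * \<bar>q * X t - p\<bar> \<le> \<epsilon> * sqrt (q / Q)" using i by (simp add: mult.commute)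
  have "\<bar>B\<bar> * \<bar>q * Y t - r\<bar> \<le> (sqrt (q * Q) / u) * (\<epsilon> * u / Q)"
    using i assms by (intro mult_mono) auto
  also have "\<dots> = \<epsilon> * (sqrt q * (sqrt Q / Q))" using i by (simp add: real_sqrt_mult)
  also have "sqrt Q / Q = 1 / sqrt Q" using assms(3) by (simp add: real_div_sqrt field_simps)
  finally show "\<bar>B\<bar> * \<bar>q * Y t - r\<bar> \<le> \<epsilon> * sqrt (q / Q)" by (simp add: real_sqrt_divide)
qed

text \<open>This measures how far a line \<open>(A', B', C')\<close> is from containing the rational point of the item in
  terms of its value at the bad point, as long as its coefficients are dominated by those of the item.\<close>

lemma line_at_item:
  fixes q p r A B C A' B' C' :: int and m :: real
  assumes it: "item Q \<epsilon> t q p r u A B C" "0 < \<epsilon>" "1 \<le> Q"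
    and le: "\<bar>A'\<bar> \<le> m * \<bar>A\<bar>" "\<bar>B'\<bar> \<le> m * \<bar>B\<bar>" and m: "0 \<le> m"
  shows "\<bar>q * (A' * X t + B' * Y t + C') - of_int (A' * p + B' * r + C' * q)\<bar> \<le> 2 * m * \<epsilon> * sqrt (q / Q)"
proof -
  have "\<bar>A'\<bar> * \<bar>q * X t - p\<bar> \<le> m * \<bar>A\<bar> * \<bar>q * X t - p\<bar>" using le by (intro mult_right_mono) auto
  also have "\<dots> \<le> m * (\<epsilon> * sqrt (q / Q))"
    using item_products(1)[OF it] m by (simp add: mult.assoc mult_left_mono)
  finally have 1: "\<bar>A' * (q * X t - p)\<bar> \<le> m * \<epsilon> * sqrt (q / Q)" by (simp add: abs_mult)
  have "\<bar>B'\<bar> * \<bar>q * Y t - r\<bar> \<le> m * \<bar>B\<bar> * \<bar>q * Y t - r\<bar>" using le by (intro mult_right_mono) auto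
  also have "\<dots> \<le> m * (\<epsilon> * sqrt (q / Q))"
    using item_products(2)[OF it] m by (simp add: mult.assoc mult_left_mono)
  finally have 2: "\<bar>B' * (q * Y t - r)\<bar> \<le> m * \<epsilon> * sqrt (q / Q)" by (simp add: abs_mult)
  have "q * (A' * X t + B' * Y t + C') - of_int (A' * p + B' * r + C' * q)
      = A' * (q * X t - p) + B' * (q * Y t - r)" by (simp add: algebra_simps)
  then show ?thesis using 1 2 by linarith
qed

context
  fixes J :: "real set" and k :: nat and j :: int
  assumes J: "convex J" "J \<subseteq> I" "\<And>x y. x \<in> J \<Longrightarrow> y \<in> J \<Longrightarrow> \<bar>x - y\<bar> \<le> scale k j"
begin

abbreviation "e \<equiv> 2 powr real_of_int j"

lemma line_derivs:
  assumes "t \<in> J"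
  shows "((\<lambda>t. A * X t + B * Y t + C) has_real_derivative A * X1 t + B * Y1 t) (at t within J)"
    "((\<lambda>t. A * X1 t + B * Y1 t) has_real_derivative A * X2 t + B * Y2 t) (at t within J)"
proof -
  have t: "t \<in> I" using assms J(2) by blast
  note s = has_field_derivative_subset[OF _ J(2)]
  show "((\<lambda>t. A * X t + B * Y t + C) has_real_derivative A * X1 t + B * Y1 t) (at t within J)"
    using s[OF X[OF t]] s[OF Y[OF t]] by (auto intro!: derivative_eq_intros)
  show "((\<lambda>t. A * X1 t + B * Y1 t) has_real_derivative A * X2 t + B * Y2 t) (at t within J)"
    using s[OF X1[OF t]] s[OF Y1[OF t]] by (auto intro!: derivative_eq_intros)
qed

text \<open>Over a cell, the derivative changes by at most the bound for the second derivative times the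
  length; the definition of \<open>slope\<close> bounds the coefficients by a multiple of \<open>q slope\<^sup>2\<close>.\<close>

lemma in_class_variation:
  fixes q A B :: int and C :: real
  assumes cl: "in_class ty k j q A B t" and t: "t \<in> J" "t' \<in> J"
  shows "\<bar>(A * X1 t' + B * Y1 t') - (A * X1 t + B * Y1 t)\<bar> \<le> e / 16"
    "\<bar>(A * X t' + B * Y t' + C) - (A * X t + B * Y t + C)\<bar> \<le> 3 * c / 2 ^ k"
proof -
  define H :: real where "H = max \<bar>A\<bar> \<bar>B\<bar>"
  note qr = in_class_q[OF cl]
  have qpos: "0 < real_of_int q" using qr(1) zero_less_power[of "2::real" k] by linarith
  have sl: "\<bar>A * X1 t + B * Y1 t\<bar> < 2 * e" "c1 * sqrt (H / q) < 2 * e"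
    using cl unfolding in_class_def slope_def H_def by auto
  have H0: "0 \<le> H" unfolding H_def by simp
  have "(c1 * sqrt (H / q))\<^sup>2 \<le> (2 * e)\<^sup>2"
    using sl(2) constants H0 qpos by (intro power_mono) auto
  then have "c1\<^sup>2 * (H / q) \<le> 4 * e\<^sup>2" using H0 qpos by (simp add: power_mult_distrib)
  then have "c1\<^sup>2 * H \<le> 4 * e\<^sup>2 * q" using qpos by (simp add: field_simps)
  also have "\<dots> \<le> 4 * e\<^sup>2 * (2 * 2 ^ k)" using qr(2) by (intro mult_left_mono) auto
  finally have H: "c1\<^sup>2 * H \<le> 8 * e\<^sup>2 * 2 ^ k" by simp
  have "2 * b * H * scale k j = (c1\<^sup>2 * H) / (128 * 2 ^ k * e)"
    using b by (simp add: scale_def c_def field_simps)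
  also have "\<dots> \<le> (8 * e\<^sup>2 * 2 ^ k) / (128 * 2 ^ k * e)" using H by (intro divide_right_mono) auto
  also have "\<dots> = e / 16" by (simp add: power2_eq_square)
  finally have HR: "2 * b * H * scale k j \<le> e / 16" .
  have step: "\<bar>g y - g x\<bar> \<le> m * scale k j"
    if g: "\<And>t. t \<in> J \<Longrightarrow> (g has_real_derivative g' t) (at t within J)"
      and m: "\<And>t. t \<in> J \<Longrightarrow> \<bar>g' t\<bar> \<le> m" and xy: "x \<in> J" "y \<in> J" for g g' m x y
  proof -
    have m0: "0 \<le> m" using m[OF xy(1)] by linarith
    have *: "\<bar>g y - g x\<bar> \<le> m * scale k j" if uv: "x \<le> y" "x \<in> J" "y \<in> J" for x y
    proof -
      obtain z where z: "z \<in> J" "g y - g x = g' z * (y - x)"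
        using mean_value_within[OF J(1) g uv(2,3,1)] by blast
      have "\<bar>g y - g x\<bar> = \<bar>g' z\<bar> * \<bar>y - x\<bar>" using z(2) by (simp add: abs_mult)
      also have "\<dots> \<le> m * scale k j"
        using m[OF z(1)] J(3)[OF uv(3,2)] m0 by (intro mult_mono) auto
      finally show ?thesis .
    qed
    show ?thesis using *[OF _ xy] *[OF _ xy(2,1)] by (cases "x \<le> y") (auto simp: abs_minus_commute)
  qed
  have comb: "\<bar>A * v + B * w\<bar> \<le> 2 * b * H" if "\<bar>v\<bar> \<le> b" "\<bar>w\<bar> \<le> b" for v w :: real
  proof -
    have "\<bar>real_of_int A\<bar> \<le> H" "\<bar>real_of_int B\<bar> \<le> H" unfolding H_def by auto
    then have "\<bar>A * v\<bar> \<le> H * b" "\<bar>B * w\<bar> \<le> H * b"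
      unfolding abs_mult by (intro mult_mono that H0 abs_ge_zero; simp)+
    then have "\<bar>A * v + B * w\<bar> \<le> H * b + H * b" by linarith
    then show ?thesis by (simp add: mult.commute)
  qed
  have var1: "\<bar>(A * X1 y + B * Y1 y) - (A * X1 x + B * Y1 x)\<bar> \<le> e / 16" if "x \<in> J" "y \<in> J" for x y
  proof -
    have "\<bar>(A * X1 y + B * Y1 y) - (A * X1 x + B * Y1 x)\<bar> \<le> 2 * b * H * scale k j"
      by (rule step[OF line_derivs(2) _ that], assumption, rule comb) (use bX bY J(2) in auto)
    then show ?thesis using HR by linarith
  qed
  then show "\<bar>(A * X1 t' + B * Y1 t') - (A * X1 t + B * Y1 t)\<bar> \<le> e / 16" using t by blast
  have "\<bar>A * X1 s + B * Y1 s\<bar> \<le> 3 * e" if "s \<in> J" for s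
    using var1[OF t(1) that] sl(1) by linarith
  then have "\<bar>(A * X t' + B * Y t' + C) - (A * X t + B * Y t + C)\<bar> \<le> (3 * e) * scale k j"
    by (intro step[OF line_derivs(1) _ t]) 
  then show "\<bar>(A * X t' + B * Y t' + C) - (A * X t + B * Y t + C)\<bar> \<le> 3 * c / 2 ^ k"
    by (simp add: scale_def)
qed


text \<open>The line of one item takes a value of less than \<open>1 / q'\<close> at the other bad point, hence the integer
  \<open>A p' + B r' + C q'\<close> has absolute value less than 1. So it is zero, and the line contains the other
  rational point. This makes the value of the line at the other bad point comparable with that of its own line.\<close>

lemma line_passes_through:
  fixes q p r A B C q' p' r' A' B' C' :: int
  assumes \<epsilon>: "0 < \<epsilon>" "\<epsilon> \<le> 1 / (8 * M)" and Q: "1 \<le> Q"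
    and it: "item Q \<epsilon> t q p r u A B C" "in_class ty k j q A B t" "t \<in> J"
    and it': "item Q \<epsilon> t' q' p' r' u' A' B' C'" "in_class ty k j q' A' B' t'" "t' \<in> J"
    and le: "\<bar>A\<bar> \<le> M * \<bar>A'\<bar>" "\<bar>B\<bar> \<le> M * \<bar>B'\<bar>"
  shows "\<bar>A * X t' + B * Y t' + C\<bar> \<le> 2 * M * \<mu> Q \<epsilon> k / 2 ^ k"
proof -
  have M: "1 \<le> M" using constants by simp
  have M\<epsilon>: "M * \<epsilon> \<le> 1 / 8" using \<epsilon> M by (simp add: field_simps)
  moreover have "1 * \<epsilon> \<le> M * \<epsilon>" using M \<epsilon> by (intro mult_right_mono) auto
  ultimately have \<epsilon>8: "\<epsilon> \<le> 1 / 8" "M * \<epsilon> \<le> 1 / 8" by auto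
  have sq: "sqrt (x / Q) \<le> 1" if "1 \<le> x" "x \<le> \<epsilon> * Q" for x
  proof -
    have "x \<le> 1 * Q" by (rule order_trans[OF that(2)]) (use \<epsilon>8 Q in \<open>intro mult_right_mono; simp\<close>)
    then show ?thesis using Q by (simp add: real_sqrt_le_1_iff)
  qed
  have q: "1 \<le> real_of_int q" "1 \<le> real_of_int q'" "q \<le> \<epsilon> * Q" "q' \<le> \<epsilon> * Q"
    using it(1) it'(1) unfolding item_def by auto
  note k = in_class_q(1)[OF it(2)] in_class_q[OF it'(2)]
  define f where "f = (\<lambda>t. A * X t + B * Y t + C)"
  define N where "N = A * p' + B * r' + C * q'"
  have N: "\<bar>q' * f t' - of_int N\<bar> \<le> 2 * M * \<epsilon> * sqrt (q' / Q)"
    unfolding f_def N_def using line_at_item[OF it'(1) \<epsilon>(1) Q le] M by simp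
  have "2 * M * \<epsilon> * sqrt (q' / Q) \<le> 2 * M * \<epsilon> * 1"
    using sq[OF q(2,4)] M \<epsilon>(1) by (intro mult_left_mono) auto
  then have N': "\<bar>q' * f t' - of_int N\<bar> \<le> 1 / 4" using N \<epsilon>8 by simp
  have "A * p + B * r + C * q = 0" using it(1) unfolding item_def by auto
  then have "\<bar>q * f t\<bar> \<le> 2 * \<epsilon> * sqrt (q / Q)"
    unfolding f_def using line_at_item[OF it(1) \<epsilon>(1) Q, of A 1 B C] by simp
  also have "\<dots> \<le> 2 * \<epsilon> * 1" using sq[OF q(1,3)] \<epsilon>(1) by (intro mult_left_mono) auto
  finally have ft: "\<bar>q * f t\<bar> \<le> 1 / 4" using \<epsilon>8 by simp
  have "real_of_int q' \<le> 2 * real_of_int q" using k by linarith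
  then have "\<bar>q' * f t\<bar> \<le> (2 * q) * \<bar>f t\<bar>"
    unfolding abs_mult using q by (intro mult_right_mono) auto
  also have "\<dots> \<le> 1 / 2" using ft q by (simp add: abs_mult)
  finally have 1: "\<bar>q' * f t\<bar> \<le> 1 / 2" .
  have "\<bar>f t' - f t\<bar> \<le> 3 * c / 2 ^ k"
    unfolding f_def by (rule in_class_variation(2)[OF it(2,3) it'(3)])
  then have "\<bar>q' * (f t' - f t)\<bar> \<le> (2 * 2 ^ k) * (3 * c / 2 ^ k)"
    unfolding abs_mult using k q by (intro mult_mono) auto
  also have "\<dots> = 6 * c" by simp
  finally have 2: "\<bar>q' * f t' - q' * f t\<bar> \<le> 6 / 1000" using constants(4) by (simp add: right_diff_distrib)
  have "\<bar>of_int N\<bar> < (1::real)" using N' 1 2 by linarith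
  then have "N = 0" by linarith
  then have "\<bar>q' * f t'\<bar> \<le> 2 * M * \<epsilon> * sqrt (q' / Q)" using N by simp
  then have "q' * \<bar>f t'\<bar> \<le> 2 * M * \<epsilon> * sqrt (q' / Q)" using q(2) by (simp add: abs_mult)
  then have "\<bar>f t'\<bar> \<le> 2 * M * \<epsilon> * (sqrt (q' / Q) / q')" using q(2) by (simp add: field_simps)
  also have "sqrt (q' / Q) / q' = 1 / (sqrt q' * sqrt Q)"
    using q(2) Q by (simp add: real_sqrt_divide field_simps)
  also have "\<dots> \<le> 1 / (sqrt (2 ^ k) * sqrt Q)" using k q Q by (intro divide_left_mono mult_mono mult_pos_pos) auto
  also have "\<dots> = sqrt (2 ^ k / Q) / 2 ^ k" using Q by (simp add: real_sqrt_divide field_simps)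
  finally have "\<bar>f t'\<bar> \<le> 2 * M * \<epsilon> * (sqrt (2 ^ k / Q) / 2 ^ k)" using M \<epsilon> by simp
  then show ?thesis by (simp add: f_def \<mu>_def)
qed

text \<open>The coefficients are recovered from the first and the second derivative of \<open>A x + B y + C\<close> by
  Cramer's rule, since the curvature bounds the determinant away from zero.\<close>

lemma height_le_second_derivative:
  fixes A B :: int
  assumes t: "t \<in> I"
  shows "a * max \<bar>A\<bar> \<bar>B\<bar> \<le> b * (\<bar>A * X2 t + B * Y2 t\<bar> + \<bar>A * X1 t + B * Y1 t\<bar>)"
proof -
  define W where "W = X1 t * Y2 t - Y1 t * X2 t"
  define f1 where "f1 = A * X1 t + B * Y1 t"
  define f2 where "f2 = A * X2 t + B * Y2 t"
  have W: "a \<le> \<bar>W\<bar>" using curved[OF t] by (simp add: W_def)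
  have comb: "a * \<bar>v\<bar> \<le> b * (\<bar>f2\<bar> + \<bar>f1\<bar>)"
    if "v * W = x * f2 - y * f1" "\<bar>x\<bar> \<le> b" "\<bar>y\<bar> \<le> b" for v x y
  proof -
    have "a * \<bar>v\<bar> \<le> \<bar>v * W\<bar>" unfolding abs_mult mult.commute[of a] using W by (intro mult_left_mono) auto
    also have "\<dots> \<le> \<bar>x\<bar> * \<bar>f2\<bar> + \<bar>y\<bar> * \<bar>f1\<bar>" unfolding that(1) abs_mult[symmetric] by linarith
    also have "\<dots> \<le> b * \<bar>f2\<bar> + b * \<bar>f1\<bar>" using that by (intro add_mono mult_right_mono) auto
    finally show ?thesis by (simp add: distrib_left)
  qed
  have "a * \<bar>real_of_int B\<bar> \<le> b * (\<bar>f2\<bar> + \<bar>f1\<bar>)"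
    by (rule comb[of _ "X1 t" "X2 t"]) (use bX[OF t] in \<open>auto simp: W_def f1_def f2_def algebra_simps\<close>)
  moreover have "a * \<bar>real_of_int A\<bar> \<le> b * (\<bar>f2\<bar> + \<bar>f1\<bar>)"
    by (rule comb[of _ "- Y1 t" "- Y2 t"]) (use bY[OF t] in \<open>auto simp: W_def f1_def f2_def algebra_simps\<close>)
  ultimately show ?thesis unfolding f1_def f2_def by (simp add: max_def)
qed

text \<open>A large coefficient is dominated by the slope, which is the same up to a factor within a class,
  or by the other coefficient. Therefore comparing the smaller coefficients is enough to compare both.\<close>

lemma in_class_comparable:
  fixes q A B q' A' B' :: int
  assumes cl: "in_class ty k j q A B t" "t \<in> I"
    and cl': "in_class ty k j q' A' B' t'" "t' \<in> I" "A' \<noteq> 0 \<or> B' \<noteq> 0" "1 \<le> q'"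
    and le: "(if ty then \<bar>B\<bar> else \<bar>A\<bar>) \<le> (if ty then \<bar>B'\<bar> else \<bar>A'\<bar>)"
  shows "\<bar>A\<bar> \<le> M * \<bar>A'\<bar>" "\<bar>B\<bar> \<le> M * \<bar>B'\<bar>"
proof -
  define H :: real where "H = max \<bar>A'\<bar> \<bar>B'\<bar>"
  have H1: "1 \<le> H" unfolding H_def using cl'(3) by auto
  have HA: "\<bar>real_of_int A'\<bar> \<le> H" "\<bar>real_of_int B'\<bar> \<le> H" unfolding H_def by auto
  have M: "1 \<le> M" using constants by simp
  have "sqrt (H / q') \<le> H" using H1 cl'(4) by (intro sqrt_ratio_le) auto
  then have "c1 * sqrt (H / q') \<le> 1 * H" using constants H1 cl'(4) by (intro mult_mono) auto
  also have "\<dots> \<le> 2 * b * H" using b H1 by (intro mult_right_mono) auto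
  finally have s1: "c1 * sqrt (H / q') \<le> 2 * b * H" .
  have "\<bar>A' * X1 t' + B' * Y1 t'\<bar> \<le> \<bar>real_of_int A'\<bar> * \<bar>X1 t'\<bar> + \<bar>real_of_int B'\<bar> * \<bar>Y1 t'\<bar>"
    unfolding abs_mult[symmetric] by linarith
  also have "\<dots> \<le> H * b + H * b" using bX[OF cl'(2)] bY[OF cl'(2)] HA H1 by (intro add_mono mult_mono) auto
  finally have s2: "\<bar>A' * X1 t' + B' * Y1 t'\<bar> \<le> 2 * b * H" by (simp add: algebra_simps)
  have "e \<le> slope q' A' B' t'" using cl'(1) unfolding in_class_def by blast
  also have "\<dots> \<le> 2 * b * H" unfolding slope_def using s1 s2 unfolding H_def by simp
  finally have eH: "e \<le> 2 * b * H" .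
  have f1: "\<bar>A * X1 t + B * Y1 t\<bar> \<le> 2 * e" using cl(1) unfolding in_class_def slope_def by simp
  have le_M: "\<bar>v\<bar> \<le> M * H" if "\<bar>v * x\<bar> \<le> 2 * e + b * H" "a \<le> \<bar>x\<bar>" for v x
  proof -
    have "a * \<bar>v\<bar> \<le> \<bar>v * x\<bar>" unfolding abs_mult mult.commute[of a] using that(2) by (intro mult_left_mono) auto
    also have "\<dots> \<le> 5 * b * H" using that(1) eH by simp
    finally show ?thesis using a by (simp add: M_def field_simps)
  qed
  have le_M': "\<bar>x\<bar> \<le> M * \<bar>y\<bar>" if "\<bar>x\<bar> \<le> \<bar>y\<bar>" for x y :: real
    using that mult_right_mono[OF M, of "\<bar>y\<bar>"] by simp
  have "\<bar>real_of_int A\<bar> \<le> M * \<bar>real_of_int A'\<bar> \<and> \<bar>real_of_int B\<bar> \<le> M * \<bar>real_of_int B'\<bar>"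
  proof (cases ty)
    case True
    then have HA': "H = \<bar>real_of_int A'\<bar>" using cl'(1) unfolding in_class_def H_def by auto
    have BB: "\<bar>real_of_int B\<bar> \<le> \<bar>real_of_int B'\<bar>"
      using le True of_int_le_iff[of "\<bar>B\<bar>" "\<bar>B'\<bar>", where ?'a = real] by simp
    have "\<bar>B * Y1 t\<bar> \<le> H * b"
      unfolding abs_mult using BB HA(2) bY[OF cl(2)] H1 by (intro mult_mono) auto
    then have "\<bar>A * X1 t\<bar> \<le> 2 * e + b * H" using f1 by (simp add: mult.commute)
    then show ?thesis using le_M[of A "X1 t"] bX[OF cl(2)] le_M'[OF BB] HA' by auto
  next
    case False
    then have HB': "H = \<bar>real_of_int B'\<bar>" using cl'(1) unfolding in_class_def H_def by auto
    have AA: "\<bar>real_of_int A\<bar> \<le> \<bar>real_of_int A'\<bar>"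
      using le False of_int_le_iff[of "\<bar>A\<bar>" "\<bar>A'\<bar>", where ?'a = real] by simp
    have "\<bar>A * X1 t\<bar> \<le> H * b"
      unfolding abs_mult using AA HA(1) bX[OF cl(2)] H1 by (intro mult_mono) auto
    then have "\<bar>B * Y1 t\<bar> \<le> 2 * e + b * H" using f1 by (simp add: mult.commute)
    then show ?thesis using le_M[of B "Y1 t"] bY[OF cl(2)] le_M'[OF AA] HB' by auto
  qed
  then show "\<bar>A\<bar> \<le> M * \<bar>A'\<bar>" "\<bar>B\<bar> \<le> M * \<bar>B'\<bar>" by auto
qed

text \<open>If the slope is dominated by the first derivative, then this derivative is bounded below on the
  whole cell. Otherwise the line is nearly tangent to the curve, and the second derivative is bounded
  below.\<close>

lemma thin_line_cover:
  fixes q A B C :: int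
  assumes cl: "in_class ty k j q A B s" "s \<in> J" and q: "1 \<le> q" and nz: "A \<noteq> 0 \<or> B \<noteq> 0"
    and Z: "Z \<subseteq> J" and m: "0 \<le> m" "m \<le> 1"
    and small: "\<And>t. t \<in> Z \<Longrightarrow> \<bar>A * X t + B * Y t + C\<bar> \<le> 2 * M * m / 2 ^ k"
  shows "\<exists>P. Z \<subseteq> P True \<union> P False \<and>
     (\<forall>i. \<forall>x\<in>P i. \<forall>y\<in>P i. \<bar>x - y\<bar> \<le> K * sqrt m * scale k j)"
proof -
  define f where "f = (\<lambda>t. A * X t + B * Y t + C)"
  define f1 where "f1 = (\<lambda>t. A * X1 t + B * Y1 t)"
  define f2 where "f2 = (\<lambda>t. A * X2 t + B * Y2 t)"
  define l where "l = 2 * M * m / 2 ^ k"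
  define H :: real where "H = max \<bar>A\<bar> \<bar>B\<bar>"
  have H1: "1 \<le> H" unfolding H_def using nz by auto
  have var: "\<bar>f1 t - f1 s\<bar> \<le> e / 16" if "t \<in> J" for t
    unfolding f1_def by (rule in_class_variation(1)[OF cl that])
  have c: "0 < c" and M: "1 \<le> M" and c1: "0 < c1" using constants by auto
  have m': "m \<le> sqrt m" using m by (simp add: real_le_rsqrt power2_eq_square mult_left_le)
  have K1: "6 * M / c * m * scale k j \<le> K * sqrt m * scale k j"
    unfolding K_def using m m' M c scale_pos[of k j] a b
    by (intro mult_right_mono mult_mono) (auto intro: less_imp_le)
  have K2: "4 * sqrt (M * b * c1\<^sup>2 / (a * c\<^sup>2)) * sqrt m * scale k j \<le> K * sqrt m * scale k j"
    unfolding K_def using m M c scale_pos[of k j] a b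
    by (intro mult_right_mono) (auto intro: less_imp_le)
  have D1: "(f has_real_derivative f1 t) (at t within J)" if "t \<in> J" for t
    unfolding f_def f1_def by (rule line_derivs(1)[OF that])
  have D2: "(f1 has_real_derivative f2 t) (at t within J)" if "t \<in> J" for t
    unfolding f1_def f2_def by (rule line_derivs(2)[OF that])
  show ?thesis
  proof (cases "e \<le> \<bar>f1 s\<bar>")
    case True
    have "\<bar>x - y\<bar> \<le> K * sqrt m * scale k j" if xy: "x \<in> Z" "y \<in> Z" "x \<le> y" for x y
    proof -
      obtain z where z: "z \<in> J" "f y - f x = f1 z * (y - x)"
        using mean_value_within[OF J(1) D1, of x y] xy Z by auto
      have "e * 15 / 16 \<le> \<bar>f1 z\<bar>" using True var[OF z(1)] by linarith
      then have "e * 15 / 16 * (y - x) \<le> \<bar>f y - f x\<bar>"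
        using xy(3) unfolding z(2) abs_mult by (intro mult_mono) auto
      also have "\<dots> \<le> 2 * l" using small[OF xy(1)] small[OF xy(2)] unfolding f_def l_def by linarith
      finally have "e * 15 / 16 * (y - x) \<le> 2 * l" .
      then have "15 * (e * (y - x)) \<le> 32 * l" by (simp add: algebra_simps)
      moreover have "0 \<le> l" using m M by (simp add: l_def)
      ultimately have "e * (y - x) \<le> 3 * l" by linarith
      then have "y - x \<le> 3 * l / e" by (simp add: field_simps)
      also have "\<dots> = 6 * M / c * m * scale k j" using c by (simp add: l_def scale_def field_simps)
      finally show ?thesis using K1 xy(3) by linarith
    qed
    then have "\<bar>x - y\<bar> \<le> K * sqrt m * scale k j" if "x \<in> Z" "y \<in> Z" for x y
      using that by (metis abs_minus_commute linear)
    then show ?thesis by (intro exI[of _ "\<lambda>_. Z"]) auto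
  next
    case False
    note qr = in_class_q(1)[OF cl(1)]
    have es: "e \<le> c1 * sqrt (H / q)"
      using cl(1) False unfolding in_class_def slope_def H_def f1_def by auto
    have "e\<^sup>2 \<le> (c1 * sqrt (H / q))\<^sup>2" using es by (intro power_mono) auto
    also have "\<dots> = c1\<^sup>2 * H / q" using H1 q by (simp add: power_mult_distrib)
    finally have "e\<^sup>2 * q \<le> c1\<^sup>2 * H" using q by (simp add: field_simps)
    moreover have "e\<^sup>2 * 2 ^ k \<le> e\<^sup>2 * q" using qr by (intro mult_left_mono) auto
    ultimately have "e\<^sup>2 * 2 ^ k \<le> c1\<^sup>2 * H" by linarith
    then have HH: "e\<^sup>2 * 2 ^ k / c1\<^sup>2 \<le> H" using c1 by (simp add: field_simps)
    define w where "w = a / (2 * b) * (e\<^sup>2 * 2 ^ k / c1\<^sup>2)"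
    have wpos: "0 < w" unfolding w_def using a b c1 by simp
    have wH: "w \<le> a / (2 * b) * H" unfolding w_def using HH a b by (intro mult_left_mono) auto
    have "sqrt (H / q) \<le> H" using H1 q by (intro sqrt_ratio_le) auto
    then have "e \<le> c1 * H" using es c1 mult_left_mono[of "sqrt (H / q)" H c1] by linarith
    then have eH: "2 * e \<le> a * H / (4 * b)" by (simp add: c1_def)
    have f2: "w \<le> \<bar>f2 t\<bar>" if t: "t \<in> J" for t
    proof -
      have "\<bar>f1 t\<bar> \<le> 2 * e" using False var[OF t] by linarith
      then have f1t: "\<bar>f1 t\<bar> \<le> a * H / (4 * b)" using eH by linarith
      have "a * H \<le> b * (\<bar>f2 t\<bar> + \<bar>f1 t\<bar>)"
        using height_le_second_derivative[of t A B] t J(2) unfolding f1_def f2_def H_def by auto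
      also have "\<dots> \<le> b * (\<bar>f2 t\<bar> + a * H / (4 * b))" using f1t b by (intro mult_left_mono) auto
      also have "\<dots> = b * \<bar>f2 t\<bar> + a * H / 4" using b by (simp add: field_simps)
      finally have "3 / 4 * (a * H) \<le> b * \<bar>f2 t\<bar>" by simp
      moreover have "0 \<le> a * H" using a H1 by simp
      ultimately have "1 / 2 * (a * H) \<le> b * \<bar>f2 t\<bar>" by linarith
      then have "a / (2 * b) * H \<le> \<bar>f2 t\<bar>" using b by (simp add: field_simps)
      then show ?thesis using wH by linarith
    qed
    have f2c: "continuous_on J f2"
      unfolding f2_def by (intro continuous_intros continuous_on_subset[OF X2 J(2)] continuous_on_subset[OF Y2 J(2)])
    obtain P where P: "Z \<subseteq> P True \<union> P False"
      "\<And>i x y. x \<in> P i \<Longrightarrow> y \<in> P i \<Longrightarrow> \<bar>x - y\<bar> \<le> 2 * sqrt (l / w)"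
      using curved_sublevel_cover[OF J(1) Z D1 D2 f2c wpos f2, of l] small unfolding f_def l_def by blast
    have lw: "l / w = 4 * (M * b * c1\<^sup>2 / (a * c\<^sup>2)) * m * (scale k j)\<^sup>2"
      using a b c c1 by (simp add: l_def w_def scale_def field_simps power2_eq_square)
    have "sqrt (4 * D * m * r\<^sup>2) = 2 * sqrt D * sqrt m * r" if "0 < r" for D r
      using that by (simp add: real_sqrt_mult)
    from this[OF scale_pos] have "sqrt (l / w) = 2 * sqrt (M * b * c1\<^sup>2 / (a * c\<^sup>2)) * sqrt m * scale k j"
      unfolding lw .
    then have "2 * sqrt (l / w) \<le> K * sqrt m * scale k j" using K2 by simp
    then show ?thesis using P by (meson order_trans)
  qed
qed

text \<open>The line of an item with minimal smaller coefficient contains the rational points of all items of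
  the class in the cell.\<close>

lemma class_cover:
  assumes \<epsilon>: "0 < \<epsilon>" "\<epsilon> \<le> 1 / (8 * M)" and Q: "1 \<le> Q" and Z: "Z \<subseteq> J"
    and it: "\<And>t. t \<in> Z \<Longrightarrow> \<exists>q p r u A B C. item Q \<epsilon> t q p r u A B C \<and> in_class ty k j q A B t"
  shows "\<exists>P. Z \<subseteq> P True \<union> P False \<and>
     (\<forall>i. \<forall>x\<in>P i. \<forall>y\<in>P i. \<bar>x - y\<bar> \<le> K * sqrt (\<mu> Q \<epsilon> k) * scale k j)"
proof (cases "Z = {}")
  case True
  then show ?thesis by (intro exI[of _ "\<lambda>_. {}"]) auto
next
  case False
  define R where "R = (\<lambda>n t q p r u A B C. t \<in> Z \<and> item Q \<epsilon> t q p r u A B C \<and> in_class ty k j q A B t \<and>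
     n = nat (if ty then \<bar>B\<bar> else \<bar>A\<bar>))"
  define n where "n = (LEAST n. \<exists>t q p r u A B C. R n t q p r u A B C)"
  have "\<exists>n t q p r u A B C. R n t q p r u A B C" using False it unfolding R_def by blast
  then have "\<exists>t q p r u A B C. R n t q p r u A B C" unfolding n_def by (rule LeastI_ex)
  then obtain s q p r u A B C where s: "R n s q p r u A B C" by blast
  have least: "n \<le> n'" if "R n' t q p r u A B C" for n' t q p r u A B C
    unfolding n_def using that by (intro Least_le) blast
  have sJ: "s \<in> J" and sit: "item Q \<epsilon> s q p r u A B C" and scl: "in_class ty k j q A B s"
    using s Z unfolding R_def by auto
  have small: "\<bar>A * X t + B * Y t + C\<bar> \<le> 2 * M * \<mu> Q \<epsilon> k / 2 ^ k" if t: "t \<in> Z" for t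
  proof -
    obtain q' p' r' u' A' B' C' where it': "item Q \<epsilon> t q' p' r' u' A' B' C'" "in_class ty k j q' A' B' t"
      using it[OF t] by blast
    have "R (nat (if ty then \<bar>B'\<bar> else \<bar>A'\<bar>)) t q' p' r' u' A' B' C'" using it' t unfolding R_def by auto
    from least[OF this] have "(if ty then \<bar>B\<bar> else \<bar>A\<bar>) \<le> (if ty then \<bar>B'\<bar> else \<bar>A'\<bar>)"
      using s unfolding R_def by auto
    moreover have "A' \<noteq> 0 \<or> B' \<noteq> 0" "1 \<le> q'" using it'(1) unfolding item_def by auto
    moreover have "s \<in> I" "t \<in> I" "t \<in> J" using sJ t Z J(2) by auto
    ultimately show ?thesis
      using line_passes_through[OF \<epsilon> Q sit scl sJ it' _ in_class_comparable[OF scl _ it'(2)]] by blast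
  qed
  have sit': "1 \<le> q" "A \<noteq> 0 \<or> B \<noteq> 0" "q \<le> \<epsilon> * Q" using sit unfolding item_def by auto
  have k: "2 ^ k \<le> \<epsilon> * Q" using in_class_q(1)[OF scl] sit' by linarith
  have "1 / (8 * M) \<le> 1" using constants(5) by (simp add: field_simps)
  then have \<epsilon>1: "\<epsilon> \<le> 1" using \<epsilon> by linarith
  have "\<epsilon> * Q \<le> Q" using \<epsilon>1 Q by simp
  then have "2 ^ k \<le> Q" using k by linarith
  then have "sqrt (2 ^ k / Q) \<le> 1" using k Q by (simp add: real_sqrt_le_1_iff)
  then have "\<mu> Q \<epsilon> k \<le> 1 * 1" unfolding \<mu>_def using \<epsilon> \<epsilon>1 Q by (intro mult_mono) auto
  moreover have "0 \<le> \<mu> Q \<epsilon> k" unfolding \<mu>_def using \<epsilon> Q by simp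
  ultimately show ?thesis using thin_line_cover[OF scl sJ sit'(1,2) Z _ _ small] by simp
qed

end

section \<open>Covering the bad points of a curve\<close>

definition cell :: "nat \<Rightarrow> int \<Rightarrow> int \<Rightarrow> real set" where
  "cell k j g = {g * scale k j .. (g + 1) * scale k j}"

definition class_points :: "real \<Rightarrow> real \<Rightarrow> bool \<Rightarrow> nat \<Rightarrow> int \<Rightarrow> int \<Rightarrow> real set" where
  "class_points Q \<epsilon> ty k j g =
     {t \<in> I \<inter> cell k j g. \<exists>q p r u A B C. item Q \<epsilon> t q p r u A B C \<and> in_class ty k j q A B t}"

definition width :: "real \<Rightarrow> real \<Rightarrow> nat \<Rightarrow> int \<Rightarrow> real" where
  "width Q \<epsilon> k j = K * sqrt (\<mu> Q \<epsilon> k) * scale k j"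

text \<open>The two parts of the cover of the points of a class in a cell.\<close>

definition pieces :: "real \<Rightarrow> real \<Rightarrow> bool \<Rightarrow> nat \<Rightarrow> int \<Rightarrow> int \<Rightarrow> bool \<Rightarrow> real set" where
  "pieces Q \<epsilon> ty k j g = (SOME P. class_points Q \<epsilon> ty k j g = P True \<union> P False \<and>
     (\<forall>i. \<forall>x\<in>P i. \<forall>y\<in>P i. \<bar>x - y\<bar> \<le> width Q \<epsilon> k j))"

lemma pieces:
  assumes \<epsilon>: "0 < \<epsilon>" "\<epsilon> \<le> 1 / (8 * M)" and Q: "1 \<le> Q"
  shows "class_points Q \<epsilon> ty k j g = pieces Q \<epsilon> ty k j g True \<union> pieces Q \<epsilon> ty k j g False"
    "\<And>x y. x \<in> pieces Q \<epsilon> ty k j g i \<Longrightarrow> y \<in> pieces Q \<epsilon> ty k j g i \<Longrightarrow> \<bar>x - y\<bar> \<le> width Q \<epsilon> k j"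
proof -
  have J: "convex (I \<inter> cell k j g)" unfolding cell_def using I(1) by (intro convex_Int) auto
  have d: "\<bar>x - y\<bar> \<le> scale k j" if "x \<in> I \<inter> cell k j g" "y \<in> I \<inter> cell k j g" for x y
    using that by (auto simp: cell_def algebra_simps)
  have sub: "class_points Q \<epsilon> ty k j g \<subseteq> I \<inter> cell k j g"
    and it: "\<And>t. t \<in> class_points Q \<epsilon> ty k j g \<Longrightarrow>
      \<exists>q p r u A B C. item Q \<epsilon> t q p r u A B C \<and> in_class ty k j q A B t"
    unfolding class_points_def by blast+
  obtain P where P: "class_points Q \<epsilon> ty k j g \<subseteq> P True \<union> P False"
     "\<forall>i. \<forall>x\<in>P i. \<forall>y\<in>P i. \<bar>x - y\<bar> \<le> width Q \<epsilon> k j"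
    using class_cover[OF J _ d \<epsilon> Q sub it] unfolding width_def by blast
  have "\<exists>P. class_points Q \<epsilon> ty k j g = P True \<union> P False \<and>
     (\<forall>i. \<forall>x\<in>P i. \<forall>y\<in>P i. \<bar>x - y\<bar> \<le> width Q \<epsilon> k j)"
    using P by (intro exI[of _ "\<lambda>i. class_points Q \<epsilon> ty k j g \<inter> P i"]) blast
  from someI_ex[OF this]
  show "class_points Q \<epsilon> ty k j g = pieces Q \<epsilon> ty k j g True \<union> pieces Q \<epsilon> ty k j g False"
    "\<And>x y. x \<in> pieces Q \<epsilon> ty k j g i \<Longrightarrow> y \<in> pieces Q \<epsilon> ty k j g i \<Longrightarrow> \<bar>x - y\<bar> \<le> width Q \<epsilon> k j"
    unfolding pieces_def[symmetric] by blast+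
qed

lemma bad_point_item:
  assumes "bad_point Q \<epsilon> (X t) (Y t)" "1 \<le> Q"
  shows "\<exists>q p r u A B C. item Q \<epsilon> t q p r u A B C"
proof -
  obtain q p r :: int and u where i: "1 \<le> q" "q \<le> \<epsilon> * Q" "1 \<le> u" "u \<le> Q"
    "\<bar>q * X t - p\<bar> < \<epsilon> / u" "\<bar>q * Y t - r\<bar> < \<epsilon> * u / Q"
    using assms(1) unfolding bad_point_def by blast
  have "sqrt (q / Q) * sqrt (q * Q) = q"
    using i(1) assms(2) by (simp add: real_sqrt_mult[symmetric])
  then have "sqrt (q / Q) * u * (sqrt (q * Q) / u) = q" using i(3) by simp
  then obtain A B C :: int where "A \<noteq> 0 \<or> B \<noteq> 0" "\<bar>A\<bar> \<le> sqrt (q / Q) * u" "\<bar>B\<bar> \<le> sqrt (q * Q) / u"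
      "A * p + B * r + C * q = 0"
    using small_line_through_rational_point[OF i(1), of "sqrt (q / Q) * u" "sqrt (q * Q) / u" p r] i assms(2)
    by auto
  then have "item Q \<epsilon> t q p r u A B C" using i unfolding item_def by simp
  then show ?thesis by blast
qed

lemma item_slope_bounds:
  assumes it: "item Q \<epsilon> t q p r u A B C" and t: "t \<in> I" and Q: "1 \<le> Q" and \<epsilon>: "\<epsilon> \<le> 1"
  shows "c1 / sqrt q \<le> slope q A B t" "slope q A B t \<le> 2 * b * Q\<^sup>2"
proof -
  have i: "1 \<le> q" "q \<le> \<epsilon> * Q" "1 \<le> u" "u \<le> Q" "\<bar>A\<bar> \<le> sqrt (q / Q) * u" "\<bar>B\<bar> \<le> sqrt (q * Q) / u"
    "A \<noteq> 0 \<or> B \<noteq> 0"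
    using it unfolding item_def by blast+
  define H :: real where "H = max \<bar>A\<bar> \<bar>B\<bar>"
  have H1: "1 \<le> H" unfolding H_def using i(7) by auto
  have HAB: "\<bar>real_of_int A\<bar> \<le> H" "\<bar>real_of_int B\<bar> \<le> H" unfolding H_def by auto
  have "\<epsilon> * Q \<le> Q" using \<epsilon> Q by simp
  then have qQ: "q \<le> Q" using i(2) by linarith
  have "sqrt (1 / q) \<le> sqrt (H / q)" using H1 i(1) by (intro real_sqrt_le_mono divide_right_mono) auto
  then have "c1 * sqrt (1 / q) \<le> c1 * sqrt (H / q)" using constants by simp
  also have "\<dots> \<le> slope q A B t" unfolding slope_def H_def by simp
  finally show "c1 / sqrt q \<le> slope q A B t" by (simp add: real_sqrt_divide)
  have "sqrt (q / Q) * u \<le> 1 * Q" using i qQ Q by (intro mult_mono) auto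
  moreover have "sqrt (q * Q) / u \<le> sqrt (Q * Q) / 1"
    using i qQ Q by (intro frac_le real_sqrt_le_mono mult_right_mono) auto
  ultimately have "\<bar>real_of_int A\<bar> \<le> Q" "\<bar>real_of_int B\<bar> \<le> Q" using i Q by auto
  then have "H \<le> Q" unfolding H_def by auto
  also have "Q \<le> Q\<^sup>2" using Q by (simp add: power2_eq_square)
  finally have HQ: "H \<le> Q\<^sup>2" .
  have "sqrt (H / q) \<le> H" using H1 i(1) by (intro sqrt_ratio_le) auto
  then have "c1 * sqrt (H / q) \<le> 1 * H" using constants H1 i(1) by (intro mult_mono) auto
  also have "\<dots> \<le> 2 * b * H" using b H1 by (intro mult_right_mono) auto
  finally have s1: "c1 * sqrt (H / q) \<le> 2 * b * H" .
  have "\<bar>A * X1 t + B * Y1 t\<bar> \<le> \<bar>real_of_int A\<bar> * \<bar>X1 t\<bar> + \<bar>real_of_int B\<bar> * \<bar>Y1 t\<bar>"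
    unfolding abs_mult[symmetric] by linarith
  also have "\<dots> \<le> H * b + H * b" using bX[OF t] bY[OF t] HAB H1 by (intro add_mono mult_mono) auto
  finally have s2: "\<bar>A * X1 t + B * Y1 t\<bar> \<le> 2 * b * H" by (simp add: algebra_simps)
  have "slope q A B t \<le> 2 * b * H" unfolding slope_def using s1 s2 unfolding H_def by simp
  also have "\<dots> \<le> 2 * b * Q\<^sup>2" using HQ b by (intro mult_left_mono) auto
  finally show "slope q A B t \<le> 2 * b * Q\<^sup>2" .
qed

lemma item_in_class:
  assumes it: "item Q \<epsilon> t q p r u A B C" and t: "t \<in> I" and Q: "1 \<le> Q" and \<epsilon>: "\<epsilon> \<le> 1"
  shows "\<exists>ty k j g. t \<in> class_points Q \<epsilon> ty k j g"
proof -
  have q: "1 \<le> q" using it unfolding item_def by auto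
  have "\<exists>k. 2 ^ k \<le> nat q \<and> nat q < 2 ^ (k + 1)"
    by (rule ex_power_ivl1) (use q in auto)
  then obtain k where k: "2 ^ k \<le> nat q" "nat q < 2 ^ (k + 1)" by blast
  have "0 < c1 / sqrt q" using constants q by simp
  then have s: "0 < slope q A B t" using item_slope_bounds(1)[OF it t Q \<epsilon>] by linarith
  define j where "j = \<lfloor>log 2 (slope q A B t)\<rfloor>"
  have "2 powr j \<le> 2 powr log 2 (slope q A B t)" unfolding j_def by (intro powr_mono) auto
  then have j1: "2 powr j \<le> slope q A B t" using s by simp
  have "2 powr log 2 (slope q A B t) < 2 powr (j + 1)" unfolding j_def by (intro powr_less_mono) linarith+
  then have j2: "slope q A B t < 2 * 2 powr j" using s by (simp add: powr_add)
  have "int (2 ^ k) \<le> int (nat q)" "int (nat q) < int (2 ^ (k + 1))" using k by (auto simp only: of_nat_le_iff of_nat_less_iff)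
  then have cl: "in_class (\<bar>B\<bar> \<le> \<bar>A\<bar>) k j q A B t" unfolding in_class_def using j1 j2 q by auto
  define g where "g = \<lfloor>t / scale k j\<rfloor>"
  have "g \<le> t / scale k j" "t / scale k j \<le> g + 1" unfolding g_def by linarith+
  then have "t \<in> cell k j g" using scale_pos[of k j] by (simp add: cell_def field_simps)
  then show ?thesis using it cl t unfolding class_points_def by blast
qed

lemma class_points_bounds:
  assumes "class_points Q \<epsilon> ty k j g \<noteq> {}" and Q: "1 \<le> Q" and \<epsilon>: "0 < \<epsilon>" "\<epsilon> \<le> 1"
  shows "2 ^ k \<le> \<epsilon> * Q" "2 powr j \<le> 2 * b * Q\<^sup>2" "c1 / (4 * sqrt (2 ^ k)) \<le> 2 powr j"
proof -
  obtain t q p r u A B C where t: "t \<in> I" and it: "item Q \<epsilon> t q p r u A B C" and cl: "in_class ty k j q A B t"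
    using assms(1) unfolding class_points_def by blast
  note k = in_class_q[OF cl]
  have q: "1 \<le> real_of_int q" "q \<le> \<epsilon> * Q" using it unfolding item_def by auto
  show "2 ^ k \<le> \<epsilon> * Q" using k(1) q(2) by linarith
  note s = item_slope_bounds[OF it t Q \<epsilon>(2)]
  have e: "2 powr j \<le> slope q A B t" "slope q A B t < 2 * 2 powr j" using cl unfolding in_class_def by auto
  show "2 powr j \<le> 2 * b * Q\<^sup>2" using e s by linarith
  have "sqrt q \<le> sqrt (4 * 2 ^ k)" using k q by (intro real_sqrt_le_mono) linarith
  also have "\<dots> = 2 * sqrt (2 ^ k)" by (simp add: real_sqrt_mult)
  finally have "c1 / (2 * sqrt (2 ^ k)) \<le> c1 / sqrt q"
    using constants q by (intro divide_left_mono) auto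
  then have "c1 / (2 * sqrt (2 ^ k)) < 2 * 2 powr j" using e s by linarith
  then show "c1 / (4 * sqrt (2 ^ k)) \<le> 2 powr j" by (simp add: field_simps)
qed

text \<open>For fixed \<open>k\<close> the scales form a geometric progression in \<open>j\<close>, and cells of one scale tile the line. So
  only boundedly many cells, with scale comparable to \<open>d\<close>, meet a set of diameter \<open>d\<close>.\<close>

lemma card_scales:
  assumes \<theta>: "0 < \<theta>" "\<theta> \<le> 1" and d: "0 < d"
  shows "finite {j. \<theta> * d \<le> scale k j \<and> scale k j \<le> d / \<theta>} \<and>
     real (card {j. \<theta> * d \<le> scale k j \<and> scale k j \<le> d / \<theta>}) \<le> \<bar>log 2 (1 / \<theta>\<^sup>2)\<bar> + 1"
proof (rule card_int_set_le_spread)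
  fix i j assume ij: "i \<in> {j. \<theta> * d \<le> scale k j \<and> scale k j \<le> d / \<theta>}"
    "j \<in> {j. \<theta> * d \<le> scale k j \<and> scale k j \<le> d / \<theta>}"
  have "2 powr (j - i) = scale k i / scale k j"
    using constants(3) by (simp add: scale_def powr_diff field_simps)
  also have "\<dots> \<le> (d / \<theta>) / (\<theta> * d)" using ij \<theta> d by (intro frac_le) auto
  also have "\<dots> = 1 / \<theta>\<^sup>2" using d by (simp add: power2_eq_square)
  finally have "log 2 (2 powr (j - i)) \<le> log 2 (1 / \<theta>\<^sup>2)" using \<theta> by (subst log_le_cancel_iff) auto
  then show "real_of_int (j - i) \<le> log 2 (1 / \<theta>\<^sup>2)" by simp
qed

lemma card_cells:
  assumes \<theta>: "0 < \<theta>" and d: "0 < d" "\<theta> * d \<le> scale k j" and B: "\<And>x y. x \<in> B \<Longrightarrow> y \<in> B \<Longrightarrow> \<bar>x - y\<bar> \<le> d"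
  shows "finite {g. cell k j g \<inter> B \<noteq> {}} \<and> real (card {g. cell k j g \<inter> B \<noteq> {}}) \<le> \<bar>1 + 1 / \<theta>\<bar> + 1"
proof (rule card_int_set_le_spread)
  fix g h assume "g \<in> {g. cell k j g \<inter> B \<noteq> {}}" "h \<in> {g. cell k j g \<inter> B \<noteq> {}}"
  then obtain x y where xy: "x \<in> cell k j g" "x \<in> B" "y \<in> cell k j h" "y \<in> B" by blast
  have "h * scale k j - (g + 1) * scale k j \<le> y - x" using xy unfolding cell_def by auto
  also have "\<dots> \<le> d" using B[OF xy(2,4)] by linarith
  also have "\<dots> \<le> scale k j / \<theta>" using d \<theta> by (simp add: field_simps)
  finally have "(h - g - 1) * scale k j \<le> 1 / \<theta> * scale k j" by (simp add: algebra_simps)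
  then have "real_of_int (h - g - 1) \<le> 1 / \<theta>" using scale_pos[of k j] by (simp only: mult_le_cancel_right_pos)
  then show "real_of_int (h - g) \<le> 1 + 1 / \<theta>" by simp
qed

end

lemma finite_powers_of_two_le: "finite {k::nat. 2 ^ k \<le> (x::real)}"
proof (rule finite_subset)
  show "{k::nat. 2 ^ k \<le> x} \<subseteq> {..nat \<lceil>x\<rceil>}"
  proof
    fix k :: nat assume "k \<in> {k. 2 ^ k \<le> x}"
    then have "2 ^ k \<le> x" by simp
    moreover have "real k < 2 ^ k" by (rule of_nat_less_two_power)
    ultimately have "real k \<le> x" by linarith
    then show "k \<in> {..nat \<lceil>x\<rceil>}" by (simp add: le_nat_iff) linarith
  qed
qed simp

context curve_piece
begin

text \<open>An index consists of the type of the class, the choice of one of the two pieces, the exponents of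
  \<open>q\<close> and of the slope, and the cell.\<close>

definition indices :: "real \<Rightarrow> real \<Rightarrow> ((bool \<times> bool) \<times> nat \<times> int \<times> int) set" where
  "indices Q \<epsilon> = {((ty, i), k, j, g). class_points Q \<epsilon> ty k j g \<noteq> {}}"

definition member_of :: "real \<Rightarrow> real \<Rightarrow> (bool \<times> bool) \<times> nat \<times> int \<times> int \<Rightarrow> real set \<times> real \<times> real" where
  "member_of Q \<epsilon> = (\<lambda>((ty, i), k, j, g). (pieces Q \<epsilon> ty k j g i, width Q \<epsilon> k j, scale k j))"

definition family :: "real \<Rightarrow> real \<Rightarrow> (real set \<times> real \<times> real) set" where
  "family Q \<epsilon> = member_of Q \<epsilon> ` indices Q \<epsilon>"

lemma finite_indices:
  assumes Q: "1 \<le> Q" and \<epsilon>: "0 < \<epsilon>" "\<epsilon> \<le> 1"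
  shows "finite (indices Q \<epsilon>)"
proof -
  obtain D where D: "\<And>x y. x \<in> I \<Longrightarrow> y \<in> I \<Longrightarrow> \<bar>x - y\<bar> \<le> D"
    using I(2) unfolding bounded_two_points dist_real_def by blast
  define d where "d = max D 1"
  have d: "0 < d" "\<And>x y. x \<in> I \<Longrightarrow> y \<in> I \<Longrightarrow> \<bar>x - y\<bar> \<le> d"
    unfolding d_def using D by fastforce+
  define Ks where "Ks = {k::nat. 2 ^ k \<le> \<epsilon> * Q}"
  have Ks: "finite Ks" unfolding Ks_def by (rule finite_powers_of_two_le)
  define Js where "Js = (\<lambda>k::nat. {j::int. c1 / (4 * sqrt (2 ^ k)) \<le> 2 powr j \<and> 2 powr j \<le> 2 * b * Q\<^sup>2})"
  have Js: "finite (Js k)" for k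
  proof (rule conjunct1[OF card_int_set_le_spread])
    let ?m = "c1 / (4 * sqrt (2 ^ k))"
    have m: "0 < ?m" using constants by simp
    fix i j assume ij: "i \<in> Js k" "j \<in> Js k"
    have "2 powr (j - i) = 2 powr j / 2 powr i" by (simp add: powr_diff)
    also have "\<dots> \<le> (2 * b * Q\<^sup>2) / ?m" using ij m b unfolding Js_def by (intro frac_le) auto
    finally have "log 2 (2 powr (j - i)) \<le> log 2 ((2 * b * Q\<^sup>2) / ?m)"
      using divide_pos_pos[OF _ m, of "2 * b * Q\<^sup>2"] b Q by (subst log_le_cancel_iff) auto
    then show "real_of_int (j - i) \<le> log 2 ((2 * b * Q\<^sup>2) / ?m)" by simp
  qed
  define Gs where "Gs = (\<lambda>k j. {g. cell k j g \<inter> I \<noteq> {}})"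
  have Gs: "finite (Gs k j)" for k j
    unfolding Gs_def
    using card_cells[of "scale k j / d" d k j I] d scale_pos[of k j] by auto
  have "indices Q \<epsilon> \<subseteq> UNIV \<times> (SIGMA k:Ks. SIGMA j:Js k. Gs k j)"
  proof (intro subsetI)
    fix x assume "x \<in> indices Q \<epsilon>"
    moreover obtain ty i k j g where x: "x = ((ty, i), k, j, g)" by (metis prod.exhaust)
    ultimately have ne: "class_points Q \<epsilon> ty k j g \<noteq> {}" unfolding indices_def by simp
    then have "cell k j g \<inter> I \<noteq> {}" unfolding class_points_def by blast
    then show "x \<in> UNIV \<times> (SIGMA k:Ks. SIGMA j:Js k. Gs k j)"
      using class_points_bounds[OF ne Q \<epsilon>] unfolding x Ks_def Js_def Gs_def by simp
  qed
  moreover have "finite (UNIV \<times> (SIGMA k:Ks. SIGMA j:Js k. Gs k j) :: ((bool \<times> bool) \<times> nat \<times> int \<times> int) set)"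
    using Ks Js Gs by (intro finite_cartesian_product finite_SigmaI) auto
  ultimately show ?thesis by (rule finite_subset)
qed

lemma live_weight_family_le:
  fixes S :: "real set"
  assumes "1 \<le> Q" "0 < \<epsilon>" "\<epsilon> \<le> 1"
  shows "live_weight p (family Q \<epsilon>) B S \<le>
    (\<Sum>((ty, i), k, j, g) \<in> {((ty, i), k, j, g) \<in> indices Q \<epsilon>. pieces Q \<epsilon> ty k j g i \<inter> B \<noteq> {} \<and> scale k j \<in> S}.
       width Q \<epsilon> k j powr p)"
proof -
  let ?A = "{((ty, i), k, j, g) \<in> indices Q \<epsilon>. pieces Q \<epsilon> ty k j g i \<inter> B \<noteq> {} \<and> scale k j \<in> S}"
  have "{(E, s, R) \<in> family Q \<epsilon>. E \<inter> B \<noteq> {} \<and> R \<in> S} = member_of Q \<epsilon> ` ?A"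
  proof (intro equalityI subsetI)
    fix z assume z: "z \<in> {(E, s, R) \<in> family Q \<epsilon>. E \<inter> B \<noteq> {} \<and> R \<in> S}"
    then have "z \<in> member_of Q \<epsilon> ` indices Q \<epsilon>" by (cases z) (simp add: family_def)
    then obtain y where "y \<in> indices Q \<epsilon>" "z = member_of Q \<epsilon> y" by blast
    moreover obtain ty i k j g where "y = ((ty, i), k, j, g)" by (metis prod.exhaust)
    ultimately show "z \<in> member_of Q \<epsilon> ` ?A" using z by (intro image_eqI[of _ _ y]) (auto simp: member_of_def)
  next
    fix z assume "z \<in> member_of Q \<epsilon> ` ?A"
    then obtain y where y: "y \<in> ?A" "z = member_of Q \<epsilon> y" by blast
    moreover obtain ty i k j g where "y = ((ty, i), k, j, g)" by (metis prod.exhaust)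
    moreover from y have "z \<in> family Q \<epsilon>" unfolding family_def by blast
    ultimately show "z \<in> {(E, s, R) \<in> family Q \<epsilon>. E \<inter> B \<noteq> {} \<and> R \<in> S}"
      by (simp add: member_of_def)
  qed
  then have "live_weight p (family Q \<epsilon>) B S = sum (\<lambda>(E, s, R). s powr p) (member_of Q \<epsilon> ` ?A)"
    unfolding live_weight_def by (simp add: case_prod_beta)
  also have "\<dots> \<le> sum ((\<lambda>(E, s, R). s powr p) \<circ> member_of Q \<epsilon>) ?A"
    by (rule sum_image_le) (auto simp: case_prod_beta intro!: rev_finite_subset[OF finite_indices[OF assms]])
  also have "\<dots> = (\<Sum>((ty, i), k, j, g) \<in> ?A. width Q \<epsilon> k j powr p)"
    by (rule sum.cong) (auto simp: member_of_def)
  finally show ?thesis .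
qed

definition cell_count :: "real \<Rightarrow> real" where
  "cell_count \<theta> = (\<bar>log 2 (1 / \<theta>\<^sup>2)\<bar> + 1) * (\<bar>1 + 1 / \<theta>\<bar> + 1)"

lemma \<mu>_nonneg: "0 \<le> Q \<Longrightarrow> 0 \<le> \<epsilon> \<Longrightarrow> 0 \<le> \<mu> Q \<epsilon> k"
  by (simp add: \<mu>_def)

text \<open>For each \<open>k\<close> there are boundedly many relevant cells, and each of them contributes pieces of diameter
  at most \<open>K sqrt (\<mu> Q \<epsilon> k) d / \<theta>\<close>.\<close>

lemma weight_bound:
  assumes \<epsilon>: "0 < \<epsilon>" "\<epsilon> \<le> 1 / (8 * M)" and Q: "1 \<le> Q" and p: "0 < p"
    and \<theta>: "0 < \<theta>" "\<theta> \<le> 1" and d: "0 < d" and B: "\<And>x y. x \<in> B \<Longrightarrow> y \<in> B \<Longrightarrow> \<bar>x - y\<bar> \<le> d"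
    and Ks: "finite Ks"
      "\<And>ty k j g. class_points Q \<epsilon> ty k j g \<noteq> {} \<Longrightarrow> \<theta> * d \<le> scale k j \<Longrightarrow> k \<in> Ks"
  shows "live_weight p (family Q \<epsilon>) B {\<theta> * d..d / \<theta>} \<le>
    4 * cell_count \<theta> * (K / \<theta>) powr p * d powr p * (\<Sum>k\<in>Ks. sqrt (\<mu> Q \<epsilon> k) powr p)"
proof -
  have "1 / (8 * M) \<le> 1" using constants(5) by (simp add: field_simps)
  then have \<epsilon>1: "\<epsilon> \<le> 1" using \<epsilon> by linarith
  have K: "0 < K" using constants by simp
  let ?A = "{((ty, i), k, j, g) \<in> indices Q \<epsilon>. pieces Q \<epsilon> ty k j g i \<inter> B \<noteq> {} \<and> scale k j \<in> {\<theta> * d..d / \<theta>}}"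
  define Js where "Js = (\<lambda>k. {j. \<theta> * d \<le> scale k j \<and> scale k j \<le> d / \<theta>})"
  define Gs where "Gs = (\<lambda>k j. {g. cell k j g \<inter> B \<noteq> {}})"
  have Js: "finite (Js k)" "real (card (Js k)) \<le> \<bar>log 2 (1 / \<theta>\<^sup>2)\<bar> + 1" for k
    unfolding Js_def using card_scales[OF \<theta> d] by auto
  have Gs: "finite (Gs k j)" "real (card (Gs k j)) \<le> \<bar>1 + 1 / \<theta>\<bar> + 1" if "j \<in> Js k" for k j
    using card_cells[OF \<theta>(1) d _ B] that unfolding Gs_def Js_def by auto
  let ?D = "UNIV \<times> (SIGMA k:Ks. SIGMA j:Js k. Gs k j) :: ((bool \<times> bool) \<times> nat \<times> int \<times> int) set"
  have D: "finite ?D" using Ks(1) Js Gs by (intro finite_cartesian_product finite_SigmaI) auto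
  have sub: "?A \<subseteq> ?D"
  proof
    fix x assume "x \<in> ?A"
    moreover obtain ty i k j g where "x = ((ty, i), k, j, g)" by (metis prod.exhaust)
    ultimately have x: "x = ((ty, i), k, j, g)" "class_points Q \<epsilon> ty k j g \<noteq> {}"
      "pieces Q \<epsilon> ty k j g i \<inter> B \<noteq> {}" "\<theta> * d \<le> scale k j" "scale k j \<le> d / \<theta>"
      unfolding indices_def by simp_all
    have "pieces Q \<epsilon> ty k j g i \<subseteq> class_points Q \<epsilon> ty k j g"
      using pieces(1)[OF \<epsilon> Q, of ty k j g] by (cases i) auto
    then have "cell k j g \<inter> B \<noteq> {}" using x(3) unfolding class_points_def by blast
    then show "x \<in> ?D" using x Ks(2)[OF x(2,4)] unfolding Js_def Gs_def by simp
  qed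
  define W where "W = (\<lambda>k. (K * sqrt (\<mu> Q \<epsilon> k) * (d / \<theta>)) powr p)"
  have W: "width Q \<epsilon> k j powr p \<le> W k" if "j \<in> Js k" for k j
    unfolding W_def width_def using that K \<mu>_nonneg[of Q \<epsilon> k] Q \<epsilon> p scale_pos[of k j]
    by (intro powr_mono2 mult_left_mono) (auto simp: Js_def intro: less_imp_le)
  have W0: "0 \<le> W k" for k unfolding W_def by simp
  have inner: "(\<Sum>(j, g) \<in> (SIGMA j:Js k. Gs k j). width Q \<epsilon> k j powr p) \<le> cell_count \<theta> * W k" for k
  proof -
    have "(\<Sum>(j, g) \<in> (SIGMA j:Js k. Gs k j). width Q \<epsilon> k j powr p) =
        (\<Sum>j\<in>Js k. \<Sum>g\<in>Gs k j. width Q \<epsilon> k j powr p)"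
      using Js Gs by (subst sum.Sigma) auto
    also have "\<dots> \<le> (\<Sum>j\<in>Js k. (\<bar>1 + 1 / \<theta>\<bar> + 1) * W k)"
      using W Gs W0 by (intro sum_mono) (auto intro!: mult_mono)
    also have "\<dots> = card (Js k) * ((\<bar>1 + 1 / \<theta>\<bar> + 1) * W k)" by simp
    also have "\<dots> \<le> (\<bar>log 2 (1 / \<theta>\<^sup>2)\<bar> + 1) * ((\<bar>1 + 1 / \<theta>\<bar> + 1) * W k)"
      using Js W0 by (intro mult_right_mono) auto
    finally show ?thesis by (simp add: cell_count_def mult.assoc)
  qed
  have four: "(\<Sum>x\<in>(UNIV :: (bool \<times> bool) set) \<times> T. f (snd x)) = 4 * sum f T"
    for T and f :: "nat \<times> int \<times> int \<Rightarrow> real"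
  proof -
    have "(\<Sum>x\<in>(UNIV :: (bool \<times> bool) set) \<times> T. f (snd x)) = (\<Sum>(ti, x)\<in>(UNIV :: (bool \<times> bool) set) \<times> T. f x)"
      by (simp add: case_prod_beta)
    also have "\<dots> = (\<Sum>ti\<in>(UNIV :: (bool \<times> bool) set). \<Sum>x\<in>T. f x)"
      by (rule sum.cartesian_product[symmetric])
    also have "\<dots> = 4 * sum f T"
      by (simp add: card_cartesian_product flip: UNIV_Times_UNIV)
    finally show ?thesis .
  qed
  have "live_weight p (family Q \<epsilon>) B {\<theta> * d..d / \<theta>} \<le> (\<Sum>((ty, i), k, j, g) \<in> ?A. width Q \<epsilon> k j powr p)"
    by (rule live_weight_family_le[OF Q \<epsilon>(1) \<epsilon>1])
  also have "\<dots> \<le> (\<Sum>((ty, i), k, j, g) \<in> ?D. width Q \<epsilon> k j powr p)"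
    by (rule sum_mono2[OF D sub]) auto
  also have "\<dots> = (\<Sum>x\<in>?D. (\<lambda>(k, j, g). width Q \<epsilon> k j powr p) (snd x))"
    by (simp add: case_prod_beta)
  also have "\<dots> = 4 * (\<Sum>(k, j, g) \<in> (SIGMA k:Ks. SIGMA j:Js k. Gs k j). width Q \<epsilon> k j powr p)"
    by (rule four)
  also have "(\<Sum>(k, j, g) \<in> (SIGMA k:Ks. SIGMA j:Js k. Gs k j). width Q \<epsilon> k j powr p)
      = (\<Sum>k\<in>Ks. \<Sum>(j, g) \<in> (SIGMA j:Js k. Gs k j). width Q \<epsilon> k j powr p)"
    using Ks(1) Js Gs by (subst sum.Sigma) (auto simp: case_prod_beta)
  also have "4 * \<dots> \<le> 4 * (\<Sum>k\<in>Ks. cell_count \<theta> * W k)"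
    using inner by (intro mult_left_mono sum_mono) auto
  also have "\<dots> = 4 * cell_count \<theta> * (\<Sum>k\<in>Ks. W k)" by (simp add: sum_distrib_left mult.assoc)
  also have "(\<Sum>k\<in>Ks. W k) = (\<Sum>k\<in>Ks. (K / \<theta>) powr p * d powr p * sqrt (\<mu> Q \<epsilon> k) powr p)"
  proof (rule sum.cong[OF refl])
    fix k
    have "W k = ((K / \<theta>) * d * sqrt (\<mu> Q \<epsilon> k)) powr p" by (simp add: W_def mult_ac)
    also have "(x * y * z) powr p = x powr p * y powr p * z powr p"
      if "0 \<le> x" "0 \<le> y" "0 \<le> z" for x y z :: real
      using that by (simp add: powr_mult)
    note this[of "K / \<theta>" d "sqrt (\<mu> Q \<epsilon> k)"]
    finally show "W k = (K / \<theta>) powr p * d powr p * sqrt (\<mu> Q \<epsilon> k) powr p"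
      using K \<theta> d \<mu>_nonneg[of Q \<epsilon> k] Q \<epsilon> by simp
  qed
  finally show ?thesis by (simp add: sum_distrib_left mult_ac)
qed

text \<open>With \<open>n\<close> the largest \<open>k\<close> of the sum, \<open>(\<mu> Q \<epsilon> k)\<^sup>2 \<le> \<epsilon> ^ 3 / 2 ^ (n - k)\<close>, so that the sum is
  geometric.\<close>

lemma sum_\<mu>_le:
  assumes \<epsilon>: "0 < \<epsilon>" and Q: "1 \<le> Q" and p: "0 < p"
  shows "(\<Sum>k | 2 ^ k \<le> \<epsilon> * Q. sqrt (\<mu> Q \<epsilon> k) powr p) \<le> \<epsilon> powr (3 * p / 4) / (1 - 2 powr (- p / 4))"
proof (cases "{k::nat. 2 ^ k \<le> \<epsilon> * Q} = {}")
  case True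
  have "2 powr (- p / 4) < 2 powr 0" using p by (intro powr_less_mono) auto
  then show ?thesis using True by simp
next
  case False
  define Ks where "Ks = {k::nat. 2 ^ k \<le> \<epsilon> * Q}"
  define x :: real where "x = 2 powr (- p / 4)"
  have "x < 2 powr 0" unfolding x_def using p by (intro powr_less_mono) auto
  then have x: "0 < x" "x < 1" by (auto simp: x_def)
  have Ks: "finite Ks" unfolding Ks_def by (rule finite_powers_of_two_le)
  define n where "n = Max Ks"
  have n: "2 ^ n \<le> \<epsilon> * Q" "\<And>k. k \<in> Ks \<Longrightarrow> k \<le> n"
    using Max_in[OF Ks] Ks False unfolding n_def Ks_def by auto
  have each: "sqrt (\<mu> Q \<epsilon> k) powr p \<le> \<epsilon> powr (3 * p / 4) * x ^ (n - k)" if "k \<le> n" for k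
  proof -
    have m0: "0 \<le> \<mu> Q \<epsilon> k" using \<mu>_nonneg Q \<epsilon> by simp
    have "(\<mu> Q \<epsilon> k)\<^sup>2 = \<epsilon>\<^sup>2 * (2 ^ k / Q)" using Q by (simp add: \<mu>_def power_mult_distrib)
    also have "2 ^ k / Q \<le> \<epsilon> * (1 / 2 ^ (n - k))"
    proof -
      have "2 ^ k * 2 ^ (n - k) \<le> \<epsilon> * Q" using n(1) that by (simp flip: power_add)
      then show ?thesis using Q by (simp add: field_simps)
    qed
    finally have m3: "(\<mu> Q \<epsilon> k)\<^sup>2 \<le> \<epsilon> ^ 3 * (1 / 2 ^ (n - k))"
      using \<epsilon> by (simp add: mult_left_mono power2_eq_square power3_eq_cube)
    have pow4: "y powr p = (y ^ 4) powr (p / 4)" if "0 < y" for y :: real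
    proof -
      have "y ^ 4 = y powr 4" using that by simp
      then show ?thesis by (simp add: powr_powr del: powr_numeral)
    qed
    have "sqrt (\<mu> Q \<epsilon> k) ^ 4 = (\<mu> Q \<epsilon> k)\<^sup>2"
      using m0 by (simp add: power4_eq_xxxx power2_eq_square)
    then have "sqrt (\<mu> Q \<epsilon> k) powr p = ((\<mu> Q \<epsilon> k)\<^sup>2) powr (p / 4)"
      using m0 pow4[of "sqrt (\<mu> Q \<epsilon> k)"] by (cases "\<mu> Q \<epsilon> k = 0") auto
    also have "\<dots> \<le> (\<epsilon> ^ 3 * (1 / 2 ^ (n - k))) powr (p / 4)"
      using m3 p by (intro powr_mono2) auto
    also have "\<dots> = (\<epsilon> ^ 3) powr (p / 4) * (1 / 2 ^ (n - k)) powr (p / 4)"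
      using \<epsilon> by (simp add: powr_mult powr_divide)
    also have "\<epsilon> ^ 3 = \<epsilon> powr 3" using \<epsilon> by simp
    also have "(\<epsilon> powr 3) powr (p / 4) = \<epsilon> powr (3 * p / 4)"
      by (simp add: powr_powr del: powr_numeral)
    also have "(1 / 2 ^ (n - k)) powr (p / 4) = x ^ (n - k)"
    proof -
      have "x ^ (n - k) = x powr real (n - k)" using x by (simp add: powr_realpow)
      also have "\<dots> = 2 powr (- p / 4 * real (n - k))" unfolding x_def by (simp add: powr_powr)
      also have "\<dots> = (2 powr (- real (n - k))) powr (p / 4)" by (simp add: powr_powr mult_ac)
      also have "2 powr (- real (n - k)) = 1 / 2 ^ (n - k)"
        by (simp add: powr_minus powr_realpow divide_inverse)
      finally show ?thesis by simp
    qed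
    finally show ?thesis .
  qed
  have "(\<Sum>k\<in>Ks. sqrt (\<mu> Q \<epsilon> k) powr p) \<le> (\<Sum>k\<le>n. sqrt (\<mu> Q \<epsilon> k) powr p)"
    using n(2) by (intro sum_mono2) auto
  also have "\<dots> \<le> (\<Sum>k\<le>n. \<epsilon> powr (3 * p / 4) * x ^ (n - k))" using each by (intro sum_mono) auto
  also have "\<dots> = \<epsilon> powr (3 * p / 4) * (\<Sum>k\<le>n. x ^ (n - k))" by (simp add: sum_distrib_left)
  also have "(\<Sum>k\<le>n. x ^ (n - k)) = (\<Sum>k\<le>n. x ^ k)"
    by (rule sum.reindex_bij_witness[of _ "\<lambda>k. n - k" "\<lambda>k. n - k"]) auto
  also have "\<dots> = (\<Sum>k<Suc n. x ^ k)" by (simp add: lessThan_Suc_atMost)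
  also have "\<dots> = (1 - x ^ Suc n) / (1 - x)" using x by (subst sum_gp_strict) auto
  also have "\<epsilon> powr (3 * p / 4) * \<dots> \<le> \<epsilon> powr (3 * p / 4) * (1 / (1 - x))"
    using x by (intro mult_left_mono divide_right_mono) auto
  finally show ?thesis unfolding Ks_def x_def by simp
qed

lemma scale_le:
  assumes "class_points Q \<epsilon> ty k j g \<noteq> {}" and Q: "1 \<le> Q" and \<epsilon>: "0 < \<epsilon>" "\<epsilon> \<le> 1"
  shows "scale k j \<le> 4 * c / (c1 * sqrt (2 ^ k))"
proof -
  have s: "0 < sqrt (2 ^ k)" "sqrt (2 ^ k) * sqrt (2 ^ k) = (2 ^ k :: real)" by auto
  have "scale k j \<le> c / (2 ^ k * (c1 / (4 * sqrt (2 ^ k))))"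
    unfolding scale_def using class_points_bounds(3)[OF assms] constants
    by (intro divide_left_mono mult_left_mono) auto
  also have "\<dots> = 4 * c / (c1 * sqrt (2 ^ k))"
    using constants s by (simp add: field_simps)
  finally show ?thesis .
qed

text \<open>The constant \<open>\<epsilon>\<close> makes the weight small at each scale, uniformly in \<open>Q\<close>. Scales above \<open>\<rho>0\<close> only
  arise from boundedly many \<open>k\<close>, and for fixed \<open>k\<close> the widths tend to zero as \<open>Q\<close> grows.\<close>

theorem tame_families_exist:
  assumes p: "0 < p" and \<theta>: "0 < \<theta>" "\<theta> \<le> 1" and \<eta>: "0 < \<eta>"
  shows "\<exists>\<epsilon>>0. \<epsilon> \<le> 1 \<and> (\<forall>\<rho>0>0. \<forall>\<eta>0>0. \<forall>Q0. \<exists>Q F. Q \<ge> Q0 \<and> Q \<ge> 1 \<and> finite F \<and>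
    (\<forall>(E, s, R)\<in>F. 0 < s \<and> 0 < R \<and> (\<forall>x\<in>E. \<forall>y\<in>E. \<bar>x - y\<bar> \<le> s)) \<and>
    {t \<in> I. bad_point Q \<epsilon> (X t) (Y t)} \<subseteq> \<Union>(fst ` F) \<and>
    (\<forall>d>0. \<forall>B. (\<forall>x\<in>B. \<forall>y\<in>B. \<bar>x - y\<bar> \<le> d) \<longrightarrow> live_weight p F B {\<theta> * d..d / \<theta>} \<le> \<eta> * d powr p) \<and>
    live_weight p F UNIV {\<rho>0..} \<le> \<eta>0)"
proof -
  define x :: real where "x = 2 powr (- p / 4)"
  have "x < 2 powr 0" unfolding x_def using p by (intro powr_less_mono) auto
  then have x: "0 < x" "x < 1" by (auto simp: x_def)
  have K: "0 < K" and M: "1 \<le> M" and c: "0 < c" "0 < c1" using constants by auto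
  define C where "C = (\<lambda>\<theta>. 4 * cell_count \<theta> * (K / \<theta>) powr p)"
  have Cpos: "0 < C \<theta>" if "0 < \<theta>" for \<theta>
    using that K unfolding C_def cell_count_def by (intro mult_pos_pos) (auto intro: add_nonneg_pos)
  define \<epsilon> where "\<epsilon> = min (1 / (8 * M)) ((\<eta> * (1 - x) / C \<theta>) powr (4 / (3 * p)))"
  have pos: "0 < \<eta> * (1 - x) / C \<theta>" using \<eta> x Cpos[OF \<theta>(1)] by simp
  have \<epsilon>: "0 < \<epsilon>" "\<epsilon> \<le> 1 / (8 * M)" unfolding \<epsilon>_def using M pos by auto
  have "1 / (8 * M) \<le> 1" using M by (simp add: field_simps)
  then have \<epsilon>1: "\<epsilon> \<le> 1" using \<epsilon> by linarith
  have "\<epsilon> powr (3 * p / 4) \<le> ((\<eta> * (1 - x) / C \<theta>) powr (4 / (3 * p))) powr (3 * p / 4)"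
    using \<epsilon>(1) p unfolding \<epsilon>_def by (intro powr_mono2) auto
  also have "(y powr (4 / (3 * p))) powr (3 * p / 4) = y" if "0 < y" for y
    using that p by (simp add: powr_powr)
  note this[OF pos]
  finally have "C \<theta> * \<epsilon> powr (3 * p / 4) \<le> \<eta> * (1 - x)" using Cpos[OF \<theta>(1)] by (simp add: field_simps)
  then have \<epsilon>\<eta>: "C \<theta> * (\<epsilon> powr (3 * p / 4) / (1 - x)) \<le> \<eta>" using x by (simp add: field_simps)
  show ?thesis
  proof (rule exI[of _ \<epsilon>], intro conjI allI impI)
    show "0 < \<epsilon>" by (rule \<epsilon>(1))
    show "\<epsilon> \<le> 1" by (rule \<epsilon>1)
  next
    fix \<rho>0 \<eta>0 Q0 :: real assume \<rho>0: "0 < \<rho>0" and \<eta>0: "0 < \<eta>0"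
    obtain D where D: "\<And>x y. x \<in> I \<Longrightarrow> y \<in> I \<Longrightarrow> \<bar>x - y\<bar> \<le> D"
      using I(2) unfolding bounded_two_points dist_real_def by blast
    \<comment> \<open>All cells are shorter than \<open>R1\<close>, and shorter than \<open>R1 / sqrt (2 ^ k)\<close> for given \<open>k\<close>.\<close>
    define R1 where "R1 = 4 * c / c1"
    define d0 where "d0 = max D R1"
    define \<theta>0 where "\<theta>0 = min 1 (\<rho>0 / d0)"
    have R1: "0 < R1" unfolding R1_def using c by simp
    have d0: "0 < d0" "R1 \<le> d0" "\<And>x y. x \<in> I \<Longrightarrow> y \<in> I \<Longrightarrow> \<bar>x - y\<bar> \<le> d0"
      unfolding d0_def using R1 D by fastforce+
    have \<theta>0: "0 < \<theta>0" "\<theta>0 \<le> 1" "\<theta>0 * d0 \<le> \<rho>0"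
      using \<rho>0 d0(1) unfolding \<theta>0_def by (auto simp: min_def field_simps)
    define Kf where "Kf = {k::nat. 2 ^ k \<le> (R1 / (\<theta>0 * d0))\<^sup>2}"
    have Kf: "finite Kf" unfolding Kf_def by (rule finite_powers_of_two_le)
    define \<phi> where "\<phi> = (\<lambda>Q. C \<theta>0 * d0 powr p * (\<Sum>k\<in>Kf. sqrt (\<mu> Q \<epsilon> k) powr p))"
    have "((\<lambda>Q. sqrt (\<mu> Q \<epsilon> k) powr p) \<longlongrightarrow> 0) at_top" for k
    proof (rule tendsto_zero_powrI[OF _ tendsto_const _ p])
      have "((\<lambda>Q. 2 ^ k / Q :: real) \<longlongrightarrow> 0) at_top"
        by (intro tendsto_divide_0[OF tendsto_const] filterlim_at_top_imp_at_infinity filterlim_ident)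
      then have "((\<lambda>Q. sqrt (\<epsilon> * sqrt (2 ^ k / Q))) \<longlongrightarrow> sqrt (\<epsilon> * sqrt 0)) at_top"
        by (intro tendsto_intros)
      then show "((\<lambda>Q. sqrt (\<mu> Q \<epsilon> k)) \<longlongrightarrow> 0) at_top" unfolding \<mu>_def by simp
      show "\<forall>\<^sub>F Q in at_top. 0 \<le> sqrt (\<mu> Q \<epsilon> k)"
        using eventually_ge_at_top[of 0] by eventually_elim (use \<mu>_nonneg \<epsilon> in auto)
    qed
    then have "(\<phi> \<longlongrightarrow> C \<theta>0 * d0 powr p * (\<Sum>k\<in>Kf. 0)) at_top"
      unfolding \<phi>_def by (intro tendsto_intros)
    then have "\<forall>\<^sub>F Q in at_top. \<phi> Q < \<eta>0" using \<eta>0 by (intro order_tendstoD(2)) auto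
    then have "\<forall>\<^sub>F Q in at_top. \<phi> Q < \<eta>0 \<and> Q0 \<le> Q \<and> 1 \<le> Q"
      using eventually_ge_at_top[of Q0] eventually_ge_at_top[of 1] by eventually_elim auto
    then obtain Q where Q: "\<phi> Q < \<eta>0" "Q0 \<le> Q" "1 \<le> Q"
      using eventually_happens[of _ "at_top :: real filter"] by auto
    define F where "F = family Q \<epsilon>"
    have F: "0 < s \<and> 0 < R \<and> (\<forall>x\<in>E. \<forall>y\<in>E. \<bar>x - y\<bar> \<le> s)" "R \<le> R1" "E \<subseteq> I" if "(E, s, R) \<in> F" for E s R
    proof -
      obtain ty i k j g where i: "class_points Q \<epsilon> ty k j g \<noteq> {}" "E = pieces Q \<epsilon> ty k j g i"
        "s = width Q \<epsilon> k j" "R = scale k j"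
      proof -
        obtain y where "y \<in> indices Q \<epsilon>" "(E, s, R) = member_of Q \<epsilon> y"
          using \<open>(E, s, R) \<in> F\<close> unfolding F_def family_def by blast
        moreover obtain ty i k j g where "y = ((ty, i), k, j, g)" by (metis prod.exhaust)
        ultimately show thesis using that unfolding indices_def member_of_def by simp
      qed
      have "0 < s" unfolding i width_def \<mu>_def using K \<epsilon> Q scale_pos[of k j] by simp
      then show "0 < s \<and> 0 < R \<and> (\<forall>x\<in>E. \<forall>y\<in>E. \<bar>x - y\<bar> \<le> s)"
        using pieces(2)[OF \<epsilon> Q(3)] scale_pos[of k j] unfolding i by blast
      show "E \<subseteq> I"
        using pieces(1)[OF \<epsilon> Q(3), of ty k j g] unfolding i class_points_def by (cases i) auto
      have "R \<le> 4 * c / (c1 * sqrt (2 ^ k))" unfolding i by (rule scale_le[OF i(1) Q(3) \<epsilon>(1) \<epsilon>1])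
      also have "\<dots> \<le> 4 * c / (c1 * 1)" using c by (intro divide_left_mono mult_left_mono) auto
      finally show "R \<le> R1" unfolding R1_def by simp
    qed
    have fin: "finite F" unfolding F_def family_def by (intro finite_imageI finite_indices Q \<epsilon> \<epsilon>1)
    have cov: "{t \<in> I. bad_point Q \<epsilon> (X t) (Y t)} \<subseteq> \<Union>(fst ` F)"
    proof
      fix t assume "t \<in> {t \<in> I. bad_point Q \<epsilon> (X t) (Y t)}"
      then have t: "t \<in> I" "bad_point Q \<epsilon> (X t) (Y t)" by auto
      obtain q p r u A B C where "item Q \<epsilon> t q p r u A B C" using bad_point_item[OF t(2) Q(3)] by blast
      then obtain ty k j g where tc: "t \<in> class_points Q \<epsilon> ty k j g"
        using item_in_class[OF _ t(1) Q(3) \<epsilon>1] by blast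
      then obtain i where i: "t \<in> pieces Q \<epsilon> ty k j g i" using pieces(1)[OF \<epsilon> Q(3)] by blast
      have "((ty, i), k, j, g) \<in> indices Q \<epsilon>" using tc unfolding indices_def by auto
      then have "member_of Q \<epsilon> ((ty, i), k, j, g) \<in> F" unfolding F_def family_def by blast
      then show "t \<in> \<Union>(fst ` F)" using i unfolding member_of_def by force
    qed
    have local: "live_weight p F B {\<theta> * d..d / \<theta>} \<le> \<eta> * d powr p"
      if d: "0 < d" and B: "\<forall>x\<in>B. \<forall>y\<in>B. \<bar>x - y\<bar> \<le> d" for d B
    proof -
      define Ks where "Ks = {k::nat. 2 ^ k \<le> \<epsilon> * Q}"
      have Ks: "finite Ks" unfolding Ks_def by (rule finite_powers_of_two_le)
      have "live_weight p F B {\<theta> * d..d / \<theta>} \<le> C \<theta> * d powr p * (\<Sum>k\<in>Ks. sqrt (\<mu> Q \<epsilon> k) powr p)"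
        unfolding F_def C_def
        by (rule weight_bound[OF \<epsilon> Q(3) p \<theta> d _ Ks])
           (use B class_points_bounds(1)[OF _ Q(3) \<epsilon>(1) \<epsilon>1] in \<open>auto simp: Ks_def\<close>)
      also have "\<dots> \<le> C \<theta> * d powr p * (\<epsilon> powr (3 * p / 4) / (1 - x))"
        unfolding Ks_def x_def using sum_\<mu>_le[OF \<epsilon>(1) Q(3) p] Cpos[OF \<theta>(1)] by (intro mult_left_mono) auto
      also have "\<dots> = (C \<theta> * (\<epsilon> powr (3 * p / 4) / (1 - x))) * d powr p" by (simp add: mult_ac)
      also have "\<dots> \<le> \<eta> * d powr p" using \<epsilon>\<eta> by (intro mult_right_mono) auto
      finally show ?thesis .
    qed
    have "live_weight p F UNIV {\<rho>0..} \<le> live_weight p F I {\<theta>0 * d0..d0 / \<theta>0}"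
      unfolding live_weight_def
    proof (rule sum_mono2)
      show "finite {(E, s, R) \<in> F. E \<inter> I \<noteq> {} \<and> R \<in> {\<theta>0 * d0..d0 / \<theta>0}}"
        using fin by (rule rev_finite_subset) auto
      have "d0 \<le> d0 / \<theta>0" using \<theta>0 d0 by (simp add: field_simps)
      then show "{(E, s, R) \<in> F. E \<inter> UNIV \<noteq> {} \<and> R \<in> {\<rho>0..}} \<subseteq>
          {(E, s, R) \<in> F. E \<inter> I \<noteq> {} \<and> R \<in> {\<theta>0 * d0..d0 / \<theta>0}}"
        using F(2,3) \<theta>0(3) d0(2) by fastforce
    qed auto
    also have "\<dots> \<le> C \<theta>0 * d0 powr p * (\<Sum>k\<in>Kf. sqrt (\<mu> Q \<epsilon> k) powr p)"
      unfolding F_def C_def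
    proof (rule weight_bound[OF \<epsilon> Q(3) p \<theta>0(1,2) d0(1,3) Kf])
      fix ty k j g assume k: "class_points Q \<epsilon> ty k j g \<noteq> {}" "\<theta>0 * d0 \<le> scale k j"
      have t0: "0 < \<theta>0 * d0" using \<theta>0 d0 by simp
      have "\<theta>0 * d0 \<le> 4 * c / (c1 * sqrt (2 ^ k))"
        using k(2) scale_le[OF k(1) Q(3) \<epsilon>(1) \<epsilon>1] by linarith
      also have "\<dots> = R1 / sqrt (2 ^ k)" by (simp add: R1_def)
      finally have "sqrt (2 ^ k) \<le> R1 / (\<theta>0 * d0)" using t0 by (simp add: field_simps)
      then have "(sqrt (2 ^ k))\<^sup>2 \<le> (R1 / (\<theta>0 * d0))\<^sup>2" by (intro power_mono) auto
      then show "k \<in> Kf" unfolding Kf_def by simp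
    qed
    also have "\<dots> < \<eta>0" using Q(1) unfolding \<phi>_def .
    finally have init: "live_weight p F UNIV {\<rho>0..} \<le> \<eta>0" by simp
    show "\<exists>Q F. Q0 \<le> Q \<and> 1 \<le> Q \<and> finite F \<and>
      (\<forall>(E, s, R)\<in>F. 0 < s \<and> 0 < R \<and> (\<forall>x\<in>E. \<forall>y\<in>E. \<bar>x - y\<bar> \<le> s)) \<and>
      {t \<in> I. bad_point Q \<epsilon> (X t) (Y t)} \<subseteq> \<Union>(fst ` F) \<and>
      (\<forall>d>0. \<forall>B. (\<forall>x\<in>B. \<forall>y\<in>B. \<bar>x - y\<bar> \<le> d) \<longrightarrow> live_weight p F B {\<theta> * d..d / \<theta>} \<le> \<eta> * d powr p) \<and>
      live_weight p F UNIV {\<rho>0..} \<le> \<eta>0"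
      using Q(2,3) fin F(1) cov local init by (intro exI[of _ Q] exI[of _ F] conjI) auto
  qed
qed

end

section \<open>Bounded sets of unimodular lattices\<close>

text \<open>The inverse of a matrix of determinant 1; its entries are polynomials with integer coefficients in
  the entries of the matrix.\<close>

definition adjugate3 :: "real^3^3 \<Rightarrow> real^3^3" where
  "adjugate3 A = vector
    [vector [A$2$2 * A$3$3 - A$2$3 * A$3$2, A$1$3 * A$3$2 - A$1$2 * A$3$3, A$1$2 * A$2$3 - A$1$3 * A$2$2],
     vector [A$2$3 * A$3$1 - A$2$1 * A$3$3, A$1$1 * A$3$3 - A$1$3 * A$3$1, A$1$3 * A$2$1 - A$1$1 * A$2$3],
     vector [A$2$1 * A$3$2 - A$2$2 * A$3$1, A$1$2 * A$3$1 - A$1$1 * A$3$2, A$1$1 * A$2$2 - A$1$2 * A$2$1]]"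

lemma mult_adjugate3: "A ** adjugate3 A = mat (det A)"
  by (simp add: adjugate3_def matrix_matrix_mult_def vec_eq_iff forall_3 sum_3 det_3 mat_def algebra_simps)

lemma SL3Z_mult: "\<gamma> \<in> SL3Z \<Longrightarrow> \<delta> \<in> SL3Z \<Longrightarrow> \<gamma> ** \<delta> \<in> SL3Z"
  unfolding SL3Z_def by (simp add: det_mul) (simp add: matrix_matrix_mult_def Ints_sum)

lemma adjugate3_SL3Z:
  assumes "\<gamma> \<in> SL3Z"
  shows "adjugate3 \<gamma> \<in> SL3Z"
proof -
  have d: "det \<gamma> = 1" and i: "\<And>i j. \<gamma> $ i $ j \<in> \<int>" using assms by (auto simp: SL3Z_def)
  have "det \<gamma> * det (adjugate3 \<gamma>) = 1"
    using mult_adjugate3[of \<gamma>] d by (metis det_I det_mul)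
  then have "det (adjugate3 \<gamma>) = 1" using d by simp
  moreover have "\<forall>i j. adjugate3 \<gamma> $ i $ j \<in> \<int>"
    unfolding forall_3 by (simp add: adjugate3_def i)
  ultimately show ?thesis by (simp add: SL3Z_def)
qed

lemma coset_mult_SL3Z:
  assumes "\<gamma> \<in> SL3Z"
  shows "coset (g ** \<gamma>) = coset g"
proof (intro equalityI subsetI)
  fix h assume "h \<in> coset (g ** \<gamma>)"
  then obtain \<delta> where "\<delta> \<in> SL3Z" "h = g ** (\<gamma> ** \<delta>)" by (auto simp: coset_def matrix_mul_assoc)
  then show "h \<in> coset g" unfolding coset_def using SL3Z_mult[OF assms] by blast
next
  fix h assume "h \<in> coset g"
  then obtain \<delta> where d: "\<delta> \<in> SL3Z" "h = g ** \<delta>" by (auto simp: coset_def)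
  have "det \<gamma> = 1" using assms by (simp add: SL3Z_def)
  then have "g ** \<delta> = g ** ((\<gamma> ** adjugate3 \<gamma>) ** \<delta>)" by (simp add: mult_adjugate3)
  then have "h = (g ** \<gamma>) ** (adjugate3 \<gamma> ** \<delta>)" using d by (simp add: matrix_mul_assoc)
  then show "h \<in> coset (g ** \<gamma>)"
    unfolding coset_def using SL3Z_mult[OF adjugate3_SL3Z[OF assms] d(1)] by blast
qed

lemma norm_add_orthogonal:
  fixes u x :: "'a::real_inner"
  assumes "x \<bullet> u = 0"
  shows "(norm (x + r *\<^sub>R u))\<^sup>2 = (norm x)\<^sup>2 + r\<^sup>2 * (norm u)\<^sup>2"
proof -
  have "u \<bullet> x = 0" using assms by (simp add: inner_commute)
  then show ?thesis
    unfolding power2_norm_eq_inner using assms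
    by (simp add: inner_add_left inner_add_right power2_eq_square[of r] del: dot_square_norm)
qed

lemma norm_sub_round_multiple:
  fixes u v :: "'a::real_inner"
  assumes "x \<bullet> u = 0"
  shows "(norm (x + (m - of_int (round m)) *\<^sub>R u))\<^sup>2 \<le> (norm x)\<^sup>2 + (norm u)\<^sup>2 / 4"
proof -
  have "(norm (x + (m - of_int (round m)) *\<^sub>R u))\<^sup>2 = (norm x)\<^sup>2 + (m - of_int (round m))\<^sup>2 * (norm u)\<^sup>2"
    by (rule norm_add_orthogonal[OF assms])
  moreover have "\<bar>m - of_int (round m)\<bar> \<le> 1 / 2" using of_int_round_abs_le[of m] by (simp add: abs_minus_commute)
  then have "(m - of_int (round m))\<^sup>2 \<le> (1 / 2)\<^sup>2" by (simp add: abs_le_square_iff[symmetric])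
  then have "(m - of_int (round m))\<^sup>2 * (norm u)\<^sup>2 \<le> (1 / 2)\<^sup>2 * (norm u)\<^sup>2" by (intro mult_right_mono) auto
  ultimately show ?thesis by (simp add: power2_eq_square)
qed

text \<open>Gram--Schmidt: if adding integer multiples of shorter vectors of the basis decreases no squared length
  by more than \<open>\<eta>\<close>, then the lengths of the orthogonalized vectors are comparable with those of the
  basis. Their product is the absolute value of the determinant, and the shorter ones are bounded below.\<close>

lemma norm_le_of_reduced_basis:
  fixes u v w :: "real^3"
  assumes sorted: "\<epsilon> \<le> norm u" "norm u \<le> norm v" "norm v \<le> norm w" and \<epsilon>: "0 < \<epsilon>" and \<eta>: "\<eta> \<le> \<epsilon>\<^sup>2 / 4"
    and v: "\<And>k :: int. (norm v)\<^sup>2 - \<eta> \<le> (norm (v + of_int k *\<^sub>R u))\<^sup>2"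
    and w: "\<And>k l :: int. (norm w)\<^sup>2 - \<eta> \<le> (norm (w + of_int k *\<^sub>R u + of_int l *\<^sub>R v))\<^sup>2"
    and det: "\<bar>w \<bullet> cross3 u v\<bar> = 1"
  shows "norm w \<le> 3 / \<epsilon>\<^sup>2"
proof -
  have u0: "0 < norm u" "u \<bullet> u \<noteq> 0" using sorted \<epsilon> by auto
  have sq: "\<epsilon>\<^sup>2 \<le> (norm u)\<^sup>2" "(norm u)\<^sup>2 \<le> (norm v)\<^sup>2" "(norm v)\<^sup>2 \<le> (norm w)\<^sup>2"
    using sorted \<epsilon> by (auto intro: power_mono)
  define m where "m = (v \<bullet> u) / (u \<bullet> u)"
  define v' where "v' = v - m *\<^sub>R u"
  have v'u: "v' \<bullet> u = 0" using u0 by (simp add: v'_def m_def inner_diff_left)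
  have "(norm v)\<^sup>2 - \<eta> \<le> (norm (v + of_int (- round m) *\<^sub>R u))\<^sup>2" by (rule v)
  also have "v + of_int (- round m) *\<^sub>R u = v' + (m - of_int (round m)) *\<^sub>R u"
    by (simp add: v'_def algebra_simps)
  also have "(norm \<dots>)\<^sup>2 \<le> (norm v')\<^sup>2 + (norm u)\<^sup>2 / 4" by (rule norm_sub_round_multiple[OF v'u])
  finally have v': "(norm v)\<^sup>2 / 2 \<le> (norm v')\<^sup>2" using sq \<eta> by linarith
  have "0 < (norm v)\<^sup>2" using sq \<epsilon> by (smt (verit) zero_less_power)
  then have v'0: "v' \<bullet> v' \<noteq> 0" using v' by auto
  define b where "b = (w \<bullet> v') / (v' \<bullet> v')"
  define w1 where "w1 = w - b *\<^sub>R v'"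
  define a where "a = (w1 \<bullet> u) / (u \<bullet> u)"
  define w' where "w' = w1 - a *\<^sub>R u"
  have w'u: "w' \<bullet> u = 0" using u0 by (simp add: w'_def a_def inner_diff_left)
  have w'v': "w' \<bullet> v' = 0"
    using v'0 v'u by (simp add: w'_def w1_def b_def inner_diff_left inner_commute[of u v'])
  have "(norm w)\<^sup>2 - \<eta> \<le> (norm (w + of_int (- round (a - of_int (round b) * m)) *\<^sub>R u + of_int (- round b) *\<^sub>R v))\<^sup>2"
    by (rule w)
  also have "w + of_int (- round (a - of_int (round b) * m)) *\<^sub>R u + of_int (- round b) *\<^sub>R v
     = (w' + (b - of_int (round b)) *\<^sub>R v') +
       ((a - of_int (round b) * m) - of_int (round (a - of_int (round b) * m))) *\<^sub>R u"
    by (simp add: w'_def w1_def v'_def algebra_simps)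
  also have "(norm \<dots>)\<^sup>2 \<le> (norm (w' + (b - of_int (round b)) *\<^sub>R v'))\<^sup>2 + (norm u)\<^sup>2 / 4"
    by (rule norm_sub_round_multiple) (simp add: inner_add_left w'u v'u)
  also have "\<dots> \<le> (norm w')\<^sup>2 + (norm v')\<^sup>2 / 4 + (norm u)\<^sup>2 / 4"
    using norm_sub_round_multiple[OF w'v'] by simp
  finally have w1: "(norm w)\<^sup>2 - \<eta> \<le> (norm w')\<^sup>2 + (norm v')\<^sup>2 / 4 + (norm u)\<^sup>2 / 4" .
  have "v = v' + m *\<^sub>R u" by (simp add: v'_def)
  then have "(norm v)\<^sup>2 = (norm v')\<^sup>2 + m\<^sup>2 * (norm u)\<^sup>2"
    using norm_add_orthogonal[OF v'u, of m] by simp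
  then have "(norm v')\<^sup>2 \<le> (norm v)\<^sup>2" by simp
  then have w': "(norm w)\<^sup>2 / 4 \<le> (norm w')\<^sup>2" using w1 sq \<eta> by linarith
  have "w \<bullet> cross3 u v = w' \<bullet> cross3 u v'"
    unfolding w'_def w1_def v'_def by (simp add: cross3_simps)
  then have "(w' \<bullet> cross3 u v')\<^sup>2 = 1" using det by (metis abs_1 power2_abs power_one)
  moreover have "cross3 w' (cross3 u v') = 0" by (simp add: Lagrange w'u w'v')
  then have "(norm w')\<^sup>2 * (norm (cross3 u v'))\<^sup>2 = (w' \<bullet> cross3 u v')\<^sup>2"
    using norm_cross[of w' "cross3 u v'"] by simp
  moreover have "(norm (cross3 u v'))\<^sup>2 = (norm u)\<^sup>2 * (norm v')\<^sup>2"
    using norm_cross[of u v'] v'u by (simp add: inner_commute)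
  ultimately have "(norm w')\<^sup>2 * ((norm u)\<^sup>2 * (norm v')\<^sup>2) = 1" by simp
  moreover have "\<epsilon>\<^sup>2 / 2 \<le> (norm v')\<^sup>2" using v' sq by linarith
  then have "(norm w)\<^sup>2 / 4 * (\<epsilon>\<^sup>2 * (\<epsilon>\<^sup>2 / 2)) \<le> (norm w')\<^sup>2 * ((norm u)\<^sup>2 * (norm v')\<^sup>2)"
    using w' sq by (intro mult_mono) auto
  ultimately have "(norm w)\<^sup>2 * (\<epsilon>\<^sup>2 * \<epsilon>\<^sup>2) \<le> 3\<^sup>2" by simp
  then have "(norm w * \<epsilon>\<^sup>2)\<^sup>2 \<le> 3\<^sup>2" by (simp add: power_mult_distrib power2_eq_square mult_ac)
  then have "norm w * \<epsilon>\<^sup>2 \<le> 3" by (rule power2_le_imp_le) simp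
  then show ?thesis using \<epsilon> by (simp add: field_simps)
qed

definition column_add :: "3 \<Rightarrow> 3 \<Rightarrow> 3 \<Rightarrow> int \<Rightarrow> int \<Rightarrow> real^3^3" where
  "column_add i j m k l = (\<chi> r s. if r = s then 1 else if s = i \<and> r = j then k else if s = i \<and> r = m then l else 0)"

lemma column_add:
  assumes "i \<noteq> j" "i \<noteq> m" "j \<noteq> m"
  shows "column_add i j m k l \<in> SL3Z"
    "column i (h ** column_add i j m k l) = column i h + of_int k *\<^sub>R column j h + of_int l *\<^sub>R column m h"
    "s \<noteq> i \<Longrightarrow> column s (h ** column_add i j m k l) = column s h"
proof -
  show "column_add i j m k l \<in> SL3Z"
    using exhaust_3[of i] exhaust_3[of j] exhaust_3[of m] assms
    by (auto simp: SL3Z_def column_add_def det_3 forall_3)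
  show "column i (h ** column_add i j m k l) = column i h + of_int k *\<^sub>R column j h + of_int l *\<^sub>R column m h"
    using exhaust_3[of i] exhaust_3[of j] exhaust_3[of m] assms
    by (auto simp: column_add_def column_def vec_eq_iff matrix_matrix_mult_def sum_3)
  show "column s (h ** column_add i j m k l) = column s h" if "s \<noteq> i"
    using exhaust_3[of i] exhaust_3[of j] exhaust_3[of m] exhaust_3[of s] assms that
    by (auto simp: column_add_def column_def vec_eq_iff matrix_matrix_mult_def sum_3)
qed

lemma triple_product_columns:
  fixes h :: "real^3^3"
  assumes "i \<noteq> j" "i \<noteq> m" "j \<noteq> m"
  shows "\<bar>column m h \<bullet> cross3 (column i h) (column j h)\<bar> = \<bar>det h\<bar>"
  using exhaust_3[of i] exhaust_3[of j] exhaust_3[of m] assms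
  by (auto simp: det_3 column_def cross3_def inner_vec_def sum_3 algebra_simps abs_if)

definition integer_vector :: "real^3 \<Rightarrow> bool" where
  "integer_vector v \<longleftrightarrow> (\<forall>i. v $ i \<in> \<int>)"

text \<open>A basis is reduced when the sum of its squared lengths is minimal up to \<open>\<eta>\<close>. Rounding this sum to
  multiples of \<open>\<eta>\<close> gives natural numbers, so such a basis exists.\<close>

lemma exists_reduced_basis:
  assumes g: "g \<in> SL3R" and \<epsilon>: "0 < \<epsilon>"
    and short: "\<And>v. integer_vector v \<Longrightarrow> v \<noteq> 0 \<Longrightarrow> \<epsilon> \<le> norm (g *v v)"
  shows "\<exists>\<gamma>\<in>SL3Z. \<forall>i. norm (column i (g ** \<gamma>)) \<le> 3 / \<epsilon>\<^sup>2"
proof -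
  define \<eta> where "\<eta> = \<epsilon>\<^sup>2 / 4"
  have \<eta>: "0 < \<eta>" using \<epsilon> by (simp add: \<eta>_def)
  define S where "S = (\<lambda>\<gamma> :: real^3^3. \<Sum>i\<in>UNIV. (norm (column i (g ** \<gamma>)))\<^sup>2)"
  have S0: "0 \<le> S \<gamma>" for \<gamma> unfolding S_def by (intro sum_nonneg) auto
  have "mat 1 \<in> SL3Z" by (simp add: SL3Z_def) (simp add: mat_def)
  then obtain \<gamma> where \<gamma>: "\<gamma> \<in> SL3Z"
    "\<And>\<delta>. \<delta> \<in> SL3Z \<Longrightarrow> nat \<lfloor>S \<gamma> / \<eta>\<rfloor> \<le> nat \<lfloor>S \<delta> / \<eta>\<rfloor>"
    using ex_has_least_nat[of "\<lambda>\<gamma>. \<gamma> \<in> SL3Z" "mat 1" "\<lambda>\<gamma>. nat \<lfloor>S \<gamma> / \<eta>\<rfloor>"] by blast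
  have min: "S \<gamma> - \<eta> \<le> S \<delta>" if "\<delta> \<in> SL3Z" for \<delta>
  proof -
    have "0 \<le> \<lfloor>S \<delta> / \<eta>\<rfloor>" using S0 \<eta> by simp
    then have "\<lfloor>S \<gamma> / \<eta>\<rfloor> \<le> \<lfloor>S \<delta> / \<eta>\<rfloor>" using \<gamma>(2)[OF that] by (simp only: nat_le_iff int_nat_eq if_True)
    then have "S \<gamma> / \<eta> - 1 \<le> S \<delta> / \<eta>" by linarith
    then have "(S \<gamma> / \<eta> - 1) * \<eta> \<le> S \<delta> / \<eta> * \<eta>" using \<eta> by (intro mult_right_mono) auto
    then show ?thesis using \<eta> by (simp add: left_diff_distrib)
  qed
  define h where "h = g ** \<gamma>"
  define c where "c = (\<lambda>i. column i h)"
  have det: "det h = 1" using g \<gamma>(1) unfolding h_def by (simp add: det_mul SL3R_def SL3Z_def)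
  have large: "\<epsilon> \<le> norm (c i)" for i
  proof -
    have "c i = g *v column i \<gamma>"
      by (simp add: c_def h_def column_def vec_eq_iff matrix_matrix_mult_def matrix_vector_mult_def)
    moreover have "integer_vector (column i \<gamma>)" using \<gamma>(1) by (simp add: integer_vector_def column_def SL3Z_def)
    moreover have "column i \<gamma> \<noteq> 0"
    proof
      assume "column i \<gamma> = 0"
      then have "det \<gamma> = 0" by (rule det_zero_column)
      then show False using \<gamma>(1) by (simp add: SL3Z_def)
    qed
    ultimately show ?thesis using short by simp
  qed
  have red: "(norm (c i))\<^sup>2 - \<eta> \<le> (norm (c i + of_int k *\<^sub>R c j + of_int l *\<^sub>R c m))\<^sup>2"
    if ijm: "i \<noteq> j" "i \<noteq> m" "j \<noteq> m" for i j m k l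
  proof -
    note ca = column_add[OF ijm, where k = k and l = l]
    have "S \<gamma> - \<eta> \<le> S (\<gamma> ** column_add i j m k l)"
      by (rule min) (use SL3Z_mult \<gamma>(1) ca(1) in blast)
    moreover have "S \<gamma> = (norm (c i))\<^sup>2 + (\<Sum>s\<in>UNIV - {i}. (norm (c s))\<^sup>2)"
      unfolding S_def c_def h_def by (rule sum.remove) auto
    moreover have "S (\<gamma> ** column_add i j m k l) =
        (norm (column i (h ** column_add i j m k l)))\<^sup>2 + (\<Sum>s\<in>UNIV - {i}. (norm (column s (h ** column_add i j m k l)))\<^sup>2)"
      unfolding S_def h_def matrix_mul_assoc by (rule sum.remove) auto
    moreover have "(\<Sum>s\<in>UNIV - {i}. (norm (column s (h ** column_add i j m k l)))\<^sup>2) = (\<Sum>s\<in>UNIV - {i}. (norm (c s))\<^sup>2)"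
      by (rule sum.cong) (auto simp: ca(3) c_def)
    ultimately show ?thesis unfolding ca(2) c_def by simp
  qed
  have bound: "norm (c m) \<le> 3 / \<epsilon>\<^sup>2"
    if ijm: "i \<noteq> j" "i \<noteq> m" "j \<noteq> m" and "norm (c i) \<le> norm (c j)" "norm (c j) \<le> norm (c m)" for i j m
  proof (rule norm_le_of_reduced_basis[OF large that(4,5) \<epsilon>])
    show "\<eta> \<le> \<epsilon>\<^sup>2 / 4" by (simp add: \<eta>_def)
    show "(norm (c j))\<^sup>2 - \<eta> \<le> (norm (c j + of_int k *\<^sub>R c i))\<^sup>2" for k
      using red[of j i m k 0] ijm by auto
    show "(norm (c m))\<^sup>2 - \<eta> \<le> (norm (c m + of_int k *\<^sub>R c i + of_int l *\<^sub>R c j))\<^sup>2" for k l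
      using red[of m i j k l] ijm by auto
    show "\<bar>c m \<bullet> cross3 (c i) (c j)\<bar> = 1"
      using triple_product_columns[OF ijm, of h] det by (simp add: c_def)
  qed
  have "Max (range (\<lambda>i. norm (c i))) \<in> range (\<lambda>i. norm (c i))" by (rule Max_in) auto
  then obtain m where "Max (range (\<lambda>i. norm (c i))) = norm (c m)" by (elim rangeE)
  then have m: "norm (c i) \<le> norm (c m)" for i
    using Max_ge[of "range (\<lambda>i. norm (c i))" "norm (c i)"] by simp
  have "\<exists>i j :: 3. i \<noteq> j \<and> i \<noteq> m \<and> j \<noteq> m"
    using exhaust_3[of m]
  proof (elim disjE)
    assume m: "m = 1"
    show ?thesis unfolding m by (rule exI[of _ 2], rule exI[of _ 3]) simp
  next
    assume m: "m = 2"
    show ?thesis unfolding m by (rule exI[of _ 1], rule exI[of _ 3]) simp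
  next
    assume m: "m = 3"
    show ?thesis unfolding m by (rule exI[of _ 1], rule exI[of _ 2]) simp
  qed
  then obtain i j where "i \<noteq> j" "i \<noteq> m" "j \<noteq> m" by blast
  then have "norm (c m) \<le> 3 / \<epsilon>\<^sup>2"
    using bound[of i j m] bound[of j i m] m by (metis linear)
  then have "\<forall>i. norm (column i (g ** \<gamma>)) \<le> 3 / \<epsilon>\<^sup>2" using m order_trans unfolding c_def h_def by blast
  then show ?thesis using \<gamma>(1) by blast
qed

text \<open>One half of Mahler's criterion: the reduced bases of unimodular lattices without vectors shorter than
  \<open>\<epsilon>\<close> lie in one compact set of matrices.\<close>

lemma mahler_compactness:
  assumes \<epsilon>: "0 < \<epsilon>"
  shows "\<exists>K. compactin X3_topology K \<and>
    (\<forall>g\<in>SL3R. (\<forall>v. integer_vector v \<longrightarrow> v \<noteq> 0 \<longrightarrow> \<epsilon> \<le> norm (g *v v)) \<longrightarrow> coset g \<in> K)"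
proof -
  define K0 where "K0 = {h :: real^3^3. det h = 1 \<and> (\<forall>i. norm (column i h) \<le> 3 / \<epsilon>\<^sup>2)}"
  have "closed K0"
    unfolding K0_def
    by (intro closed_Collect_conj closed_Collect_all closed_Collect_eq closed_Collect_le continuous_intros)
       (auto simp: det_3 column_def intro!: continuous_intros)
  moreover have "bounded K0"
  proof (rule boundedI)
    fix h assume h: "h \<in> K0"
    have "norm (h $ r $ s) \<le> 3 / \<epsilon>\<^sup>2" for r s
    proof -
      have "norm (column s h $ r) \<le> norm (column s h)" by (rule Finite_Cartesian_Product.norm_nth_le)
      then show ?thesis using h unfolding K0_def by (simp add: column_def) (meson order_trans)
    qed
    then have "norm (h $ r) \<le> (\<Sum>s\<in>(UNIV :: 3 set). 3 / \<epsilon>\<^sup>2)" for r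
      unfolding norm_vec_def[of "h $ r"] by (intro order_trans[OF L2_set_le_sum] sum_mono) auto
    then have "norm h \<le> (\<Sum>r\<in>(UNIV :: 3 set). \<Sum>s\<in>(UNIV :: 3 set). 3 / \<epsilon>\<^sup>2)"
      unfolding norm_vec_def[of h] by (intro order_trans[OF L2_set_le_sum] sum_mono) auto
    then show "norm h \<le> (\<Sum>r\<in>(UNIV :: 3 set). \<Sum>s\<in>(UNIV :: 3 set). 3 / \<epsilon>\<^sup>2)" .
  qed
  ultimately have "compact K0" by (simp add: compact_eq_bounded_closed)
  moreover have "K0 \<subseteq> SL3R" by (auto simp: K0_def SL3R_def)
  ultimately have "compactin (top_of_set SL3R) K0" by (simp add: compactin_subtopology)
  then have "compactin X3_topology (coset ` K0)"
    using image_compactin quotient_imp_continuous_map[OF quotient_map_coset] by blast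
  moreover have "coset g \<in> coset ` K0"
    if g: "g \<in> SL3R" and "\<forall>v. integer_vector v \<longrightarrow> v \<noteq> 0 \<longrightarrow> \<epsilon> \<le> norm (g *v v)" for g
  proof -
    obtain \<gamma> where \<gamma>: "\<gamma> \<in> SL3Z" "\<forall>i. norm (column i (g ** \<gamma>)) \<le> 3 / \<epsilon>\<^sup>2"
      using exists_reduced_basis[OF g \<epsilon>] \<open>\<forall>v. integer_vector v \<longrightarrow> v \<noteq> 0 \<longrightarrow> \<epsilon> \<le> norm (g *v v)\<close> by blast
    have "g ** \<gamma> \<in> K0" using g \<gamma> by (simp add: K0_def det_mul SL3R_def SL3Z_def)
    then show ?thesis using coset_mult_SL3Z[OF \<gamma>(1), of g] by blast
  qed
  ultimately show ?thesis by blast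
qed

definition unipotent :: "real \<Rightarrow> real \<Rightarrow> real^3^3" where
  "unipotent x y = vector [vector [1, 0, x], vector [0, 1, y], vector [0, 0, 1]]"

lemma torus_pt_unipotent: "torus_pt v = coset (unipotent (fst v) (snd v))"
  by (simp add: torus_pt_def unipotent_def)

text \<open>A vector shorter than \<open>\<epsilon>\<close> with last coordinate \<open>q = 0\<close> would have all coordinates less than 1 in
  absolute value and so vanish; for \<open>q \<noteq> 0\<close> it exhibits the point as bad.\<close>

lemma no_short_vector:
  assumes \<epsilon>: "0 < \<epsilon>" "\<epsilon> \<le> 1" and st: "0 \<le> s" "0 \<le> t"
    and good: "\<not> bad_point (exp (s + t)) \<epsilon> x y"
    and v: "integer_vector v" "v \<noteq> 0"
  shows "\<epsilon> \<le> norm ((diag3 s t ** unipotent x y) *v v)"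
proof (rule ccontr)
  assume "\<not> ?thesis"
  then have small: "norm ((diag3 s t ** unipotent x y) *v v) < \<epsilon>" by simp
  have comp: "\<bar>((diag3 s t ** unipotent x y) *v v) $ i\<bar> < \<epsilon>" for i
    using component_le_norm_cart[of "(diag3 s t ** unipotent x y) *v v" i] small by linarith
  obtain A B q :: int where ABq: "v $ 1 = A" "v $ 2 = B" "v $ 3 = q"
    using v(1) unfolding integer_vector_def by (metis Ints_cases)
  have c1: "\<bar>exp s * (A + q * x)\<bar> < \<epsilon>" and c2: "\<bar>exp t * (B + q * y)\<bar> < \<epsilon>" and c3: "\<bar>exp (- (s + t)) * q\<bar> < \<epsilon>"
    using comp[of 1] comp[of 2] comp[of 3]
    by (auto simp: diag3_def unipotent_def matrix_vector_mult_def matrix_matrix_mult_def sum_3 ABq algebra_simps)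
  have d1: "\<bar>A + q * x\<bar> < \<epsilon> / exp s"
    using c1 by (simp only: abs_mult abs_exp_cancel pos_less_divide_eq[OF exp_gt_zero] mult.commute)
  have "\<bar>B + q * y\<bar> < \<epsilon> / exp t"
    using c2 by (simp only: abs_mult abs_exp_cancel pos_less_divide_eq[OF exp_gt_zero] mult.commute)
  then have d2: "\<bar>B + q * y\<bar> < \<epsilon> * exp s / exp (s + t)" by (simp add: exp_add)
  have "\<bar>q\<bar> / exp (s + t) < \<epsilon>"
    using c3 by (simp add: abs_mult exp_minus[of "s + t"] divide_inverse mult.commute del: minus_add_distrib)
  then have d3: "\<bar>q\<bar> < \<epsilon> * exp (s + t)" by (simp add: pos_divide_less_eq)
  have u: "1 \<le> exp s" "exp s \<le> exp (s + t)" "1 \<le> exp t" using st by auto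
  show False
  proof (cases "q = 0")
    case True
    have "\<epsilon> / exp s \<le> 1" "\<epsilon> * exp s / exp (s + t) \<le> 1"
      using \<epsilon> u by (auto simp: exp_add field_simps intro: order_trans)
    moreover have "q * x = 0" "q * y = 0" using True by auto
    ultimately have "\<bar>real_of_int A\<bar> < 1" "\<bar>real_of_int B\<bar> < 1" using d1 d2 by linarith+
    then have "A = 0" "B = 0" by auto
    then have "v = 0" using True ABq by (simp add: vec_eq_iff forall_3)
    then show False using v(2) by simp
  next
    case False
    have "bad_point (exp (s + t)) \<epsilon> x y"
      unfolding bad_point_def
    proof (rule exI[of _ "\<bar>q\<bar>"], rule exI[of _ "- sgn q * A"], rule exI[of _ "- sgn q * B"],
        rule exI[of _ "exp s"], intro conjI)
      have neg: "\<bar>- (A + q * x)\<bar> = \<bar>A + q * x\<bar>" "\<bar>- (B + q * y)\<bar> = \<bar>B + q * y\<bar>" by (simp_all only: abs_minus_cancel)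
      show "\<bar>of_int \<bar>q\<bar> * x - of_int (- sgn q * A)\<bar> < \<epsilon> / exp s"
        using d1 neg(1) False by (cases "q > 0") (auto simp: sgn_if algebra_simps)
      show "\<bar>of_int \<bar>q\<bar> * y - of_int (- sgn q * B)\<bar> < \<epsilon> * exp s / exp (s + t)"
        using d2 neg(2) False by (cases "q > 0") (auto simp: sgn_if algebra_simps)
    qed (use False d3 u in auto)
    then show False using good by simp
  qed
qed

lemma not_fiberwise_divergent:
  assumes \<epsilon>: "0 < \<epsilon>" "\<epsilon> \<le> 1" and good: "\<And>Q0. \<exists>Q\<ge>Q0. 1 \<le> Q \<and> \<not> bad_point Q \<epsilon> (fst v) (snd v)"
  shows "\<not> fiberwise_divergent (torus_pt v)"
proof
  assume fd: "fiberwise_divergent (torus_pt v)"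
  obtain K where K: "compactin X3_topology K"
    "\<And>g. g \<in> SL3R \<Longrightarrow> (\<And>v. integer_vector v \<Longrightarrow> v \<noteq> 0 \<Longrightarrow> \<epsilon> \<le> norm (g *v v)) \<Longrightarrow> coset g \<in> K"
    using mahler_compactness[OF \<epsilon>(1)] by blast
  obtain T0 where T0: "0 < T0" "\<And>T. T > T0 \<Longrightarrow> \<not> (\<lambda>a. left_translate a (torus_pt v)) ` L_plus T \<subseteq> K"
    using fd K(1) unfolding fiberwise_divergent_def by blast
  obtain Q where Q: "exp (T0 + 1) \<le> Q" "1 \<le> Q" "\<not> bad_point Q \<epsilon> (fst v) (snd v)"
    using good by blast
  define T where "T = ln Q"
  have QT: "Q = exp T" using Q(2) by (simp add: T_def)
  have "T0 + 1 \<le> T" using Q(1) unfolding QT by simp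
  then have "T > T0" by simp
  moreover have "(\<lambda>a. left_translate a (torus_pt v)) ` L_plus T \<subseteq> K"
  proof
    fix z assume "z \<in> (\<lambda>a. left_translate a (torus_pt v)) ` L_plus T"
    then obtain s t where st: "0 \<le> s" "0 \<le> t" "s + t = T" "z = left_translate (diag3 s t) (torus_pt v)"
      unfolding L_plus_def by blast
    have z: "z = coset (diag3 s t ** unipotent (fst v) (snd v))"
      unfolding st(4) torus_pt_unipotent left_translate_coset ..
    have "exp s * exp t * exp (- (s + t)) = 1" by (simp flip: exp_add)
    then have "det (diag3 s t) = 1" by (simp add: diag3_def det_3)
    moreover have "det (unipotent (fst v) (snd v)) = 1" by (simp add: unipotent_def det_3)
    ultimately have "diag3 s t ** unipotent (fst v) (snd v) \<in> SL3R"
      by (simp add: SL3R_def det_mul)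
    then show "z \<in> K"
      unfolding z using K(2) no_short_vector[OF \<epsilon> st(1,2)] Q(3) unfolding QT st(3)[symmetric] by blast
  qed
  ultimately show False using T0(2) by blast
qed

section \<open>Curves in the torus\<close>

lemma torus_pt_eq_imp:
  assumes "torus_pt v = torus_pt w"
  shows "fst v - fst w \<in> \<int>" "snd v - snd w \<in> \<int>"
proof -
  have "mat 1 \<in> SL3Z" by (simp add: SL3Z_def) (simp add: mat_def)
  then have "unipotent (fst v) (snd v) \<in> torus_pt v"
    unfolding torus_pt_unipotent coset_def by (intro image_eqI[of _ _ "mat 1"]) auto
  then obtain \<delta> where \<delta>: "\<delta> \<in> SL3Z" "unipotent (fst v) (snd v) = unipotent (fst w) (snd w) ** \<delta>"
    unfolding assms unfolding torus_pt_unipotent coset_def by blast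
  have "unipotent (fst v) (snd v) $ i $ 3 = (unipotent (fst w) (snd w) ** \<delta>) $ i $ 3" for i
    using \<delta>(2) by simp
  from this[of 1] this[of 2] this[of 3]
  have "\<delta> $ 1 $ 3 = fst v - fst w" "\<delta> $ 2 $ 3 = snd v - snd w"
    by (simp_all add: unipotent_def matrix_matrix_mult_def sum_3)
  then show "fst v - fst w \<in> \<int>" "snd v - snd w \<in> \<int>"
    using \<delta>(1) unfolding SL3Z_def by (metis (mono_tags, lifting) mem_Collect_eq)+
qed

lemma continuous_torus_pt: "continuous_map euclidean X3_topology torus_pt"
proof -
  have "(\<lambda>v. unipotent (fst v) (snd v)) = (\<lambda>v. unipotent 0 0 + fst v *\<^sub>R (unipotent 1 0 - unipotent 0 0) +
      snd v *\<^sub>R (unipotent 0 1 - unipotent 0 0))"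
    by (rule ext) (simp add: unipotent_def vec_eq_iff forall_3)
  then have "continuous_on UNIV (\<lambda>v. unipotent (fst v) (snd v))" by (simp only:) (intro continuous_intros)
  moreover have "unipotent x y \<in> SL3R" for x y by (simp add: SL3R_def unipotent_def det_3)
  ultimately have "continuous_map euclidean (top_of_set SL3R) (\<lambda>v. unipotent (fst v) (snd v))"
    by (auto simp: continuous_map_in_subtopology)
  from continuous_map_compose[OF this quotient_imp_continuous_map[OF quotient_map_coset]]
  show ?thesis by (simp add: torus_pt_unipotent[abs_def] o_def)
qed

text \<open>Two parametrizations near a common point differ by a change of the parameter and a
  translation by an integer vector, which is locally constant. So they have the same chords, and both
  the curvature and bi-Lipschitz bounds for the change of the parameter can be read off from the chords.\<close>

lemma param_transition:
  assumes p: "C1_param C J \<gamma>" and p2: "C1_param C J2 \<gamma>2"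
    and t: "t0 \<in> J" "t2 \<in> J2" "torus_pt (\<gamma> t0) = torus_pt (\<gamma>2 t2)"
  shows "\<exists>r h. 0 < r \<and> ball t0 r \<subseteq> J \<and> continuous_on (ball t0 r) h \<and> h ` ball t0 r \<subseteq> J2 \<and> h t0 = t2 \<and>
     inj_on h (ball t0 r) \<and> (\<forall>t\<in>ball t0 r. torus_pt (\<gamma>2 (h t)) = torus_pt (\<gamma> t)) \<and>
     (\<forall>s\<in>ball t0 r. \<forall>t\<in>ball t0 r. \<gamma>2 (h s) - \<gamma>2 (h t) = \<gamma> s - \<gamma> t)"
proof -
  define \<Phi> where "\<Phi> = torus_pt \<circ> \<gamma>"
  define \<Phi>2 where "\<Phi>2 = torus_pt \<circ> \<gamma>2"
  have J: "open J" "open J2" using p p2 by (auto simp: C1_param_def)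
  have emb: "embedding_map (top_of_set J) X3_topology \<Phi>" "embedding_map (top_of_set J2) X3_topology \<Phi>2"
    using p p2 by (auto simp: C1_param_def \<Phi>_def \<Phi>2_def)
  have op: "openin (subtopology X3_topology C) (\<Phi> ` J)" "openin (subtopology X3_topology C) (\<Phi>2 ` J2)"
    using p p2 by (auto simp: C1_param_def \<Phi>_def \<Phi>2_def)
  obtain g where g: "homeomorphic_maps (top_of_set J2) (subtopology X3_topology (\<Phi>2 ` J2)) \<Phi>2 g"
    using emb(2) unfolding embedding_map_def homeomorphic_map_maps by auto
  have gc: "continuous_map (subtopology X3_topology (\<Phi>2 ` J2)) (top_of_set J2) g"
    and g1: "\<And>x. x \<in> J2 \<Longrightarrow> g (\<Phi>2 x) = x"
    using g unfolding homeomorphic_maps_def by auto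
  obtain g' where "homeomorphic_maps (top_of_set J) (subtopology X3_topology (\<Phi> ` J)) \<Phi> g'"
    using emb(1) unfolding embedding_map_def homeomorphic_map_maps by auto
  then have "\<And>x. x \<in> J \<Longrightarrow> g' (\<Phi> x) = x" unfolding homeomorphic_maps_def by auto
  then have inj: "inj_on \<Phi> J" by (rule inj_on_inverseI)
  have contX: "continuous_map (top_of_set J) X3_topology \<Phi>"
    using emb(1) unfolding embedding_map_def
    by (meson continuous_map_in_subtopology homeomorphic_imp_continuous_map)
  moreover have "\<Phi> ` J \<subseteq> C" using openin_subset[OF op(1)] by (simp add: topspace_subtopology)
  ultimately have "continuous_map (top_of_set J) (subtopology X3_topology C) \<Phi>"
    by (auto simp: continuous_map_in_subtopology)
  then have "openin (top_of_set J) {t \<in> topspace (top_of_set J). \<Phi> t \<in> \<Phi>2 ` J2}"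
    using op(2) by (rule openin_continuous_map_preimage)
  then have V0: "open {t \<in> J. \<Phi> t \<in> \<Phi>2 ` J2}" using J(1) by (simp add: openin_open_eq)
  define V0 where "V0 = {t \<in> J. \<Phi> t \<in> \<Phi>2 ` J2}"
  define h where "h = g \<circ> \<Phi>"
  have "continuous_map (top_of_set V0) (subtopology X3_topology (\<Phi>2 ` J2)) \<Phi>"
    using continuous_map_from_subtopology_mono[OF contX, of V0] 
    by (auto simp: continuous_map_in_subtopology V0_def)
  then have "continuous_map (top_of_set V0) (top_of_set J2) h"
    unfolding h_def by (rule continuous_map_compose[OF _ gc])
  then have hc: "continuous_on V0 h" and hJ: "h ` V0 \<subseteq> J2" by auto
  have \<Phi>h: "\<Phi>2 (h t) = \<Phi> t" if "t \<in> V0" for t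
    using that g1 unfolding V0_def h_def by auto
  have t0: "t0 \<in> V0" using t unfolding V0_def \<Phi>_def \<Phi>2_def by auto
  have ht0: "h t0 = t2" using g1[OF t(2)] t(3) unfolding h_def \<Phi>_def \<Phi>2_def by simp
  have \<gamma>c: "continuous_on J \<gamma>" "continuous_on J2 \<gamma>2"
    using p p2 unfolding C1_param_def by (auto dest: C1_differentiable_imp_continuous_on)
  define D where "D = (\<lambda>t. \<gamma> t - \<gamma>2 (h t))"
  have "continuous_on V0 D"
    unfolding D_def using continuous_on_compose2[OF \<gamma>c(2) hc hJ] continuous_on_subset[OF \<gamma>c(1), of V0]
    by (intro continuous_intros) (auto simp: V0_def)
  then have "isCont D t0" using V0 t0 unfolding V0_def by (simp add: continuous_on_eq_continuous_at)
  then obtain d where d: "0 < d" "\<And>t. dist t t0 < d \<Longrightarrow> dist (D t) (D t0) < 1"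
    unfolding continuous_at_eps_delta by (meson zero_less_one)
  obtain r0 where r0: "0 < r0" "ball t0 r0 \<subseteq> V0" using V0 t0 openE unfolding V0_def by blast
  define r where "r = min d r0"
  have r: "0 < r" "ball t0 r \<subseteq> V0" using d r0 by (auto simp: r_def)
  have D: "D t = D t0" if "t \<in> ball t0 r" for t
  proof -
    have V: "t \<in> V0" using that r by blast
    have "dist (D t) (D t0) < 1" using d(2)[of t] that by (simp add: r_def dist_commute)
    then have less: "norm (fst (D t) - fst (D t0)) < 1" "norm (snd (D t) - snd (D t0)) < 1"
      using dist_fst_le[of "D t" "D t0"] dist_snd_le[of "D t" "D t0"] by (auto simp: dist_norm)
    have I: "fst (D s) \<in> \<int>" "snd (D s) \<in> \<int>" if "s \<in> V0" for s
      using torus_pt_eq_imp[of "\<gamma> s" "\<gamma>2 (h s)"] \<Phi>h[OF that] unfolding D_def \<Phi>_def \<Phi>2_def by auto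
    have "fst (D t) - fst (D t0) = 0" "snd (D t) - snd (D t0) = 0"
      using less Ints_diff[OF I(1)[OF V] I(1)[OF t0]] Ints_diff[OF I(2)[OF V] I(2)[OF t0]]
        Ints_nonzero_abs_less1 unfolding real_norm_def by blast+
    then show ?thesis by (simp add: prod_eq_iff)
  qed
  have "inj_on h V0"
  proof (rule inj_onI)
    fix s t assume "s \<in> V0" "t \<in> V0" "h s = h t"
    then have "\<Phi> s = \<Phi> t" using \<Phi>h by metis
    then show "s = t" using inj \<open>s \<in> V0\<close> \<open>t \<in> V0\<close> unfolding V0_def inj_on_def by blast
  qed
  then have c6: "inj_on h (ball t0 r)" using r(2) inj_on_subset by blast
  have gen: "y = x - z" if "x - y = z" for x y z :: "real \<times> real" using that by auto
  have "\<gamma>2 (h t) = \<gamma> t - D t0" if "t \<in> ball t0 r" for t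
    by (rule gen) (use D[OF that] in \<open>simp add: D_def\<close>)
  then have c8: "\<forall>s\<in>ball t0 r. \<forall>t\<in>ball t0 r. \<gamma>2 (h s) - \<gamma>2 (h t) = \<gamma> s - \<gamma> t" by simp
  have c7: "\<forall>t\<in>ball t0 r. torus_pt (\<gamma>2 (h t)) = torus_pt (\<gamma> t)"
    using \<Phi>h r(2) unfolding \<Phi>_def \<Phi>2_def by (auto simp del: mem_ball)
  have c2: "ball t0 r \<subseteq> J" using r(2) unfolding V0_def by blast
  have c4: "h ` ball t0 r \<subseteq> J2" using hJ r(2) by blast
  show ?thesis
    by (rule exI[of _ r], rule exI[of _ h])
       (intro conjI r(1) c2 continuous_on_subset[OF hc r(2)] c4 ht0 c6 c7 c8)
qed

definition wedge :: "real \<times> real \<Rightarrow> real \<times> real \<Rightarrow> real" where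
  "wedge v w = fst v * snd w - snd v * fst w"

lemma wedge_scaleR [simp]: "wedge (c *\<^sub>R v) w = c * wedge v w" "wedge v (c *\<^sub>R w) = c * wedge v w"
  by (simp_all add: wedge_def algebra_simps)

lemma tendsto_wedge [tendsto_intros]:
  assumes "(f \<longlongrightarrow> a) F" "(g \<longlongrightarrow> b) F"
  shows "((\<lambda>x. wedge (f x) (g x)) \<longlongrightarrow> wedge a b) F"
  unfolding wedge_def by (intro tendsto_intros assms)

text \<open>The curvature is determined by the chords through a point: their limit direction is the
  tangent direction, and their distance from the tangent line is of second order.\<close>

definition chord_defect :: "(real \<Rightarrow> real \<times> real) \<Rightarrow> real \<Rightarrow> real \<times> real \<Rightarrow> real \<Rightarrow> real" where
  "chord_defect \<gamma> t v s = 2 * \<bar>wedge v (\<gamma> s - \<gamma> t)\<bar> / (norm v * (norm (\<gamma> s - \<gamma> t))\<^sup>2)"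


lemma has_vector_derivative_components:
  fixes \<gamma> :: "real \<Rightarrow> real \<times> real"
  assumes "(\<gamma> has_vector_derivative v) (at t within S)"
  shows "((\<lambda>s. fst (\<gamma> s)) has_real_derivative fst v) (at t within S)"
    "((\<lambda>s. snd (\<gamma> s)) has_real_derivative snd v) (at t within S)"
  using has_derivative_fst[OF assms[unfolded has_vector_derivative_def]]
    has_derivative_snd[OF assms[unfolded has_vector_derivative_def]]
  by (simp_all add: has_field_derivative_def mult_commute_abs)

lemma chord_quotient_tendsto:
  fixes \<gamma> :: "real \<Rightarrow> real \<times> real"
  assumes "(\<gamma> has_vector_derivative v) (at t)"
  shows "((\<lambda>s. (\<gamma> s - \<gamma> t) /\<^sub>R (s - t)) \<longlongrightarrow> v) (at t)"
proof -
  have "((\<lambda>s. ((fst (\<gamma> s) - fst (\<gamma> t)) / (s - t), (snd (\<gamma> s) - snd (\<gamma> t)) / (s - t))) \<longlongrightarrow> (fst v, snd v)) (at t)"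
    using has_vector_derivative_components[OF assms] unfolding has_field_derivative_iff
    by (rule tendsto_Pair)
  moreover have "(\<lambda>s. ((fst (\<gamma> s) - fst (\<gamma> t)) / (s - t), (snd (\<gamma> s) - snd (\<gamma> t)) / (s - t)))
     = (\<lambda>s. (\<gamma> s - \<gamma> t) /\<^sub>R (s - t))"
    by (rule ext) (simp add: prod_eq_iff divide_inverse mult.commute)
  ultimately show ?thesis by simp
qed

lemma chord_direction_tendsto:
  fixes \<gamma> :: "real \<Rightarrow> real \<times> real"
  assumes "(\<gamma> has_vector_derivative v) (at t)" "v \<noteq> 0"
  shows "((\<lambda>s. \<bar>wedge w (\<gamma> s - \<gamma> t)\<bar> / norm (\<gamma> s - \<gamma> t)) \<longlongrightarrow> \<bar>wedge w v\<bar> / norm v) (at t)"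
proof -
  let ?q = "\<lambda>s. (\<gamma> s - \<gamma> t) /\<^sub>R (s - t)"
  have "((\<lambda>s. \<bar>wedge w (?q s)\<bar> / norm (?q s)) \<longlongrightarrow> \<bar>wedge w v\<bar> / norm v) (at t)"
    using assms by (intro tendsto_intros chord_quotient_tendsto) auto
  moreover have "\<forall>\<^sub>F s in at t. \<bar>wedge w (?q s)\<bar> / norm (?q s) = \<bar>wedge w (\<gamma> s - \<gamma> t)\<bar> / norm (\<gamma> s - \<gamma> t)"
    using eventually_neq_at_within[of t] by eventually_elim (simp add: abs_mult)
  ultimately show ?thesis by (rule Lim_transform_eventually)
qed

lemma chord_defect_tendsto:
  fixes \<gamma> \<gamma>1 :: "real \<Rightarrow> real \<times> real"
  assumes J: "open J" "t \<in> J" and \<gamma>: "\<And>s. s \<in> J \<Longrightarrow> (\<gamma> has_vector_derivative \<gamma>1 s) (at s)"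
    and \<gamma>1: "(\<gamma>1 has_vector_derivative a) (at t)" and v: "\<gamma>1 t \<noteq> 0"
  shows "(chord_defect \<gamma> t (\<gamma>1 t) \<longlongrightarrow> \<bar>wedge (\<gamma>1 t) a\<bar> / norm (\<gamma>1 t) ^ 3) (at t)"
proof -
  define v where "v = \<gamma>1 t"
  define \<phi> where "\<phi> = (\<lambda>s. wedge v (\<gamma> s - \<gamma> t))"
  have nb: "\<forall>\<^sub>F s in at t. s \<in> J" using J by (rule eventually_at_in_open')
  have d\<phi>: "(\<phi> has_real_derivative wedge v (\<gamma>1 s)) (at s)" if "s \<in> J" for s
    unfolding \<phi>_def wedge_def using has_vector_derivative_components[OF \<gamma>[OF that]]
    by (auto intro!: derivative_eq_intros)
  have lim1: "((\<lambda>s. \<phi> s / (s - t)\<^sup>2) \<longlongrightarrow> wedge v a / 2) (at t)"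
  proof (rule lhopital)
    have "(\<phi> \<longlongrightarrow> \<phi> t) (at t)"
      using d\<phi>[OF J(2)] DERIV_isCont isCont_def by blast
    then show "(\<phi> \<longlongrightarrow> 0) (at t)" by (simp add: \<phi>_def wedge_def)
    have "((\<lambda>s. (s - t)\<^sup>2) \<longlongrightarrow> (t - t)\<^sup>2) (at t)" by (intro tendsto_intros)
    then show "((\<lambda>s. (s - t)\<^sup>2) \<longlongrightarrow> 0) (at t)" by simp
    show "\<forall>\<^sub>F s in at t. (s - t)\<^sup>2 \<noteq> 0" "\<forall>\<^sub>F s in at t. 2 * (s - t) \<noteq> 0"
      using eventually_neq_at_within[of t] by (eventually_elim, simp)+
    show "\<forall>\<^sub>F s in at t. (\<phi> has_real_derivative wedge v (\<gamma>1 s)) (at s)"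
      using nb by eventually_elim (rule d\<phi>)
    show "\<forall>\<^sub>F s in at t. ((\<lambda>s. (s - t)\<^sup>2) has_real_derivative 2 * (s - t)) (at s)"
      by (intro always_eventually allI) (auto intro!: derivative_eq_intros)
    have gen: "inverse x * y / 2 = y / (2 * x)" for x y :: real
      by (cases "x = 0") (auto simp: field_simps)
    have wv: "wedge v (\<gamma>1 s - \<gamma>1 t) = wedge v (\<gamma>1 s)" for s
      by (simp add: v_def wedge_def algebra_simps)
    have "((\<lambda>s. wedge v ((\<gamma>1 s - \<gamma>1 t) /\<^sub>R (s - t)) / 2) \<longlongrightarrow> wedge v a / 2) (at t)"
      by (intro tendsto_intros chord_quotient_tendsto[OF \<gamma>1]) simp
    moreover have "\<forall>\<^sub>F s in at t. wedge v ((\<gamma>1 s - \<gamma>1 t) /\<^sub>R (s - t)) / 2 = wedge v (\<gamma>1 s) / (2 * (s - t))"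
      unfolding wedge_scaleR wv by (intro always_eventually allI gen)
    ultimately show "((\<lambda>s. wedge v (\<gamma>1 s) / (2 * (s - t))) \<longlongrightarrow> wedge v a / 2) (at t)"
      by (rule Lim_transform_eventually)
  qed
  have lim2: "((\<lambda>s. (\<gamma> s - \<gamma> t) /\<^sub>R (s - t)) \<longlongrightarrow> v) (at t)"
    unfolding v_def by (rule chord_quotient_tendsto[OF \<gamma>[OF J(2)]])
  have "((\<lambda>s. 2 * \<bar>\<phi> s / (s - t)\<^sup>2\<bar> / (norm v * (norm ((\<gamma> s - \<gamma> t) /\<^sub>R (s - t)))\<^sup>2)) \<longlongrightarrow>
     2 * \<bar>wedge v a / 2\<bar> / (norm v * (norm v)\<^sup>2)) (at t)"
    using v unfolding v_def[symmetric]
    by (intro tendsto_divide[OF tendsto_mult[OF tendsto_const tendsto_rabs[OF lim1]]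
      tendsto_mult[OF tendsto_const tendsto_power[OF tendsto_norm[OF lim2]]]]) simp
  moreover have "\<forall>\<^sub>F s in at t. 2 * \<bar>\<phi> s / (s - t)\<^sup>2\<bar> / (norm v * (norm ((\<gamma> s - \<gamma> t) /\<^sub>R (s - t)))\<^sup>2) = chord_defect \<gamma> t v s"
    using eventually_neq_at_within[of t]
  proof eventually_elim
    case (elim s)
    have "(norm ((\<gamma> s - \<gamma> t) /\<^sub>R (s - t)))\<^sup>2 = (norm (\<gamma> s - \<gamma> t))\<^sup>2 / (s - t)\<^sup>2"
      by (simp only: norm_scaleR power_mult_distrib power2_abs) (simp add: power_divide inverse_eq_divide)
    then show ?case using elim unfolding chord_defect_def \<phi>_def by (simp add: abs_mult)
  qed
  ultimately have "(chord_defect \<gamma> t v \<longlongrightarrow> 2 * \<bar>wedge v a / 2\<bar> / (norm v * (norm v)\<^sup>2)) (at t)"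
    by (rule Lim_transform_eventually)
  then show ?thesis unfolding v_def by (simp add: power3_eq_cube power2_eq_square mult.assoc)
qed

lemma C2_param_derivatives:
  assumes "C2_param C J \<gamma>" "t \<in> J"
  shows "(\<gamma> has_vector_derivative vector_derivative \<gamma> (at t)) (at t)"
    "((\<lambda>s. vector_derivative \<gamma> (at s)) has_vector_derivative vector_derivative (\<lambda>s. vector_derivative \<gamma> (at s)) (at t)) (at t)"
    "vector_derivative \<gamma> (at t) \<noteq> 0"
  using assms unfolding C2_param_def C1_param_def C1_differentiable_on_eq
  by (auto simp: vector_derivative_works)

lemma wedge_zero_imp_parallel:
  assumes "wedge w v = 0" "v \<noteq> 0"
  shows "\<exists>c. w = c *\<^sub>R v"
proof (cases "fst v = 0")
  case True
  then have "snd v \<noteq> 0" using assms(2) by (auto simp: prod_eq_iff)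
  then show ?thesis using assms(1) True
    by (intro exI[of _ "snd w / snd v"]) (auto simp: prod_eq_iff wedge_def)
next
  case False
  then show ?thesis using assms(1)
    by (intro exI[of _ "fst w / fst v"]) (auto simp: prod_eq_iff wedge_def field_simps)
qed

text \<open>The tangent directions agree as limits of the same chords, and then the curvatures agree as limits
  of the same chord defects.\<close>

lemma param_curvature_unique:
  assumes p: "C2_param C J \<gamma>" and p2: "C2_param C J2 \<gamma>2"
    and t: "t0 \<in> J" "t2 \<in> J2" "torus_pt (\<gamma> t0) = torus_pt (\<gamma>2 t2)"
  shows "param_curvature \<gamma> t0 = param_curvature \<gamma>2 t2"
proof -
  have C1: "C1_param C J \<gamma>" "C1_param C J2 \<gamma>2" using p p2 unfolding C2_param_def by auto
  obtain r h where r: "0 < r" "ball t0 r \<subseteq> J" "continuous_on (ball t0 r) h" "h t0 = t2" "inj_on h (ball t0 r)"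
    and eq: "\<And>s t. s \<in> ball t0 r \<Longrightarrow> t \<in> ball t0 r \<Longrightarrow> \<gamma>2 (h s) - \<gamma>2 (h t) = \<gamma> s - \<gamma> t"
    using param_transition[OF C1 t] by metis
  define v where "v = vector_derivative \<gamma> (at t0)"
  define w where "w = vector_derivative \<gamma>2 (at t2)"
  have v: "v \<noteq> 0" "w \<noteq> 0"
    using C2_param_derivatives(3)[OF p t(1)] C2_param_derivatives(3)[OF p2 t(2)] by (auto simp: v_def w_def)
  have near: "\<forall>\<^sub>F s in at t0. s \<in> ball t0 r" using r(1) by (intro eventually_at_in_open') auto
  have "isCont h t0" using r(1,3) by (simp add: continuous_on_eq_continuous_at)
  then have "(h \<longlongrightarrow> t2) (at t0)" using r(4) by (simp add: isCont_def)
  moreover have "\<forall>\<^sub>F s in at t0. h s \<in> UNIV \<and> h s \<noteq> t2"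
    using near eventually_neq_at_within[of t0]
  proof eventually_elim
    case (elim s)
    then show ?case using r(1,4,5) by (metis UNIV_I centre_in_ball inj_onD)
  qed
  ultimately have h: "filterlim h (at t2) (at t0)" by (simp add: filterlim_at)
  have chord: "\<forall>\<^sub>F s in at t0. \<gamma>2 (h s) - \<gamma>2 t2 = \<gamma> s - \<gamma> t0"
    using near by eventually_elim (use eq r(1,4) in force)
  have "((\<lambda>s. \<bar>wedge w (\<gamma>2 (h s) - \<gamma>2 t2)\<bar> / norm (\<gamma>2 (h s) - \<gamma>2 t2)) \<longlongrightarrow> \<bar>wedge w w\<bar> / norm w) (at t0)"
    using filterlim_compose[OF chord_direction_tendsto[OF C2_param_derivatives(1,3)[OF p2 t(2)]] h]
    unfolding w_def .
  then have "((\<lambda>s. \<bar>wedge w (\<gamma> s - \<gamma> t0)\<bar> / norm (\<gamma> s - \<gamma> t0)) \<longlongrightarrow> \<bar>wedge w w\<bar> / norm w) (at t0)"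
    by (rule Lim_transform_eventually) (use chord in eventually_elim, simp)
  moreover have "((\<lambda>s. \<bar>wedge w (\<gamma> s - \<gamma> t0)\<bar> / norm (\<gamma> s - \<gamma> t0)) \<longlongrightarrow> \<bar>wedge w v\<bar> / norm v) (at t0)"
    unfolding v_def by (rule chord_direction_tendsto[OF C2_param_derivatives(1,3)[OF p t(1)]])
  ultimately have "\<bar>wedge w w\<bar> / norm w = \<bar>wedge w v\<bar> / norm v" by (intro LIM_unique)
  moreover have "wedge w w = 0" by (simp add: wedge_def)
  ultimately have "wedge w v = 0" using v by simp
  then obtain c where c: "w = c *\<^sub>R v" using wedge_zero_imp_parallel v(1) by blast
  have "c \<noteq> 0" using v(2) c by auto
  have "(chord_defect \<gamma>2 t2 w \<longlongrightarrow> param_curvature \<gamma>2 t2) (at t2)"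
    using chord_defect_tendsto[OF _ t(2) C2_param_derivatives(1)[OF p2] C2_param_derivatives(2,3)[OF p2 t(2)]] p2
    unfolding w_def param_curvature_def Let_def wedge_def by (simp add: C2_param_def C1_param_def)
  from filterlim_compose[OF this h]
  have "((\<lambda>s. chord_defect \<gamma> t0 v s) \<longlongrightarrow> param_curvature \<gamma>2 t2) (at t0)"
  proof (rule Lim_transform_eventually)
    show "\<forall>\<^sub>F s in at t0. chord_defect \<gamma>2 t2 w (h s) = chord_defect \<gamma> t0 v s"
      using chord by eventually_elim (use \<open>c \<noteq> 0\<close> in \<open>simp add: chord_defect_def c abs_mult\<close>)
  qed
  moreover have "(chord_defect \<gamma> t0 v \<longlongrightarrow> param_curvature \<gamma> t0) (at t0)"
    using chord_defect_tendsto[OF _ t(1) C2_param_derivatives(1)[OF p] C2_param_derivatives(2,3)[OF p t(1)]] p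
    unfolding v_def param_curvature_def Let_def wedge_def by (simp add: C2_param_def C1_param_def)
  ultimately show ?thesis by (metis LIM_unique)
qed

lemma curvature_eq:
  assumes "C2_param C J \<gamma>" "t \<in> J"
  shows "curvature C (torus_pt (\<gamma> t)) = param_curvature \<gamma> t"
  unfolding curvature_def
proof (rule the_equality)
  show "\<exists>J' \<gamma>' t'. C2_param C J' \<gamma>' \<and> t' \<in> J' \<and> torus_pt (\<gamma>' t') = torus_pt (\<gamma> t) \<and> param_curvature \<gamma> t = param_curvature \<gamma>' t'"
    using assms by blast
  show "k = param_curvature \<gamma> t"
    if "\<exists>J' \<gamma>' t'. C2_param C J' \<gamma>' \<and> t' \<in> J' \<and> torus_pt (\<gamma>' t') = torus_pt (\<gamma> t) \<and> k = param_curvature \<gamma>' t'" for k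
    using that param_curvature_unique[OF assms(1) _ assms(2)] by metis
qed

text \<open>Near \<open>t\<close> the map differs from its linearization by a map with Lipschitz constant \<open>m\<close>, half of the
  speed at \<open>t\<close>.\<close>

lemma locally_bilipschitz:
  fixes \<gamma> :: "real \<Rightarrow> 'a::euclidean_space"
  assumes J: "open J" "t \<in> J" and \<gamma>: "\<gamma> C1_differentiable_on J" and v: "vector_derivative \<gamma> (at t) \<noteq> 0"
  shows "\<exists>r L. 0 < r \<and> 1 \<le> L \<and> ball t r \<subseteq> J \<and>
    (\<forall>x\<in>ball t r. \<forall>y\<in>ball t r. \<bar>x - y\<bar> \<le> L * norm (\<gamma> x - \<gamma> y) \<and> norm (\<gamma> x - \<gamma> y) \<le> L * \<bar>x - y\<bar>)"
proof -
  define D where "D = (\<lambda>s. vector_derivative \<gamma> (at s))"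
  have D: "(\<gamma> has_vector_derivative D s) (at s)" if "s \<in> J" for s
    using \<gamma> that unfolding C1_differentiable_on_eq D_def by (auto simp: vector_derivative_works)
  have "continuous_on J D" using \<gamma> unfolding C1_differentiable_on_eq D_def by blast
  then have "isCont D t" using J by (simp add: continuous_on_eq_continuous_at)
  moreover define m where "m = norm (D t) / 2"
  have m: "0 < m" using v by (simp add: m_def D_def)
  ultimately obtain d where d: "0 < d" "\<And>s. dist s t < d \<Longrightarrow> dist (D s) (D t) < m"
    unfolding continuous_at_eps_delta by blast
  obtain r0 where r0: "0 < r0" "ball t r0 \<subseteq> J" using J openE by blast
  define r where "r = min d r0"
  have r: "0 < r" "ball t r \<subseteq> J" using d(1) r0 by (auto simp: r_def)
  have main: "norm ((\<gamma> x - x *\<^sub>R D t) - (\<gamma> y - y *\<^sub>R D t)) \<le> m * norm (x - y)" if "x \<in> ball t r" "y \<in> ball t r" for x y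
  proof (rule differentiable_bound[where f' = "\<lambda>s h. h *\<^sub>R (D s - D t)"])
    show "((\<lambda>x. \<gamma> x - x *\<^sub>R D t) has_derivative (\<lambda>h. h *\<^sub>R (D s - D t))) (at s within ball t r)"
      if "s \<in> ball t r" for s
    proof -
      have "(\<gamma> has_vector_derivative D s) (at s within ball t r)"
        using D[of s] that r(2) has_vector_derivative_at_within by blast
      then have "((\<lambda>x. \<gamma> x - x *\<^sub>R D t) has_vector_derivative D s - D t) (at s within ball t r)"
        by (auto intro!: derivative_eq_intros)
      then show ?thesis by (simp only: has_vector_derivative_def)
    qed
    show "onorm (\<lambda>h. h *\<^sub>R (D s - D t)) \<le> m" if "s \<in> ball t r" for s
    proof (rule onorm_le)
      have "dist s t < d" using that by (simp add: r_def dist_commute)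
      then have "norm (D s - D t) \<le> m" using d(2)[of s] by (simp add: dist_norm)
      then show "norm (h *\<^sub>R (D s - D t)) \<le> m * norm h" for h
        by (simp add: mult.commute[of m] mult_left_mono)
    qed
  qed (use that in auto)
  define L where "L = max 1 (max (1 / m) (3 * m))"
  have L: "1 \<le> L" "1 / m \<le> L" "3 * m \<le> L" by (auto simp: L_def)
  have "\<bar>x - y\<bar> \<le> L * norm (\<gamma> x - \<gamma> y) \<and> norm (\<gamma> x - \<gamma> y) \<le> L * \<bar>x - y\<bar>"
    if xy: "x \<in> ball t r" "y \<in> ball t r" for x y
  proof -
    have eq: "(\<gamma> x - x *\<^sub>R D t) - (\<gamma> y - y *\<^sub>R D t) = (\<gamma> x - \<gamma> y) - (x - y) *\<^sub>R D t"
      by (simp add: algebra_simps)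
    have n: "norm ((x - y) *\<^sub>R D t) = 2 * m * \<bar>x - y\<bar>" by (simp add: m_def)
    have b: "norm ((\<gamma> x - \<gamma> y) - (x - y) *\<^sub>R D t) \<le> m * \<bar>x - y\<bar>"
      using main[OF xy] unfolding eq by simp
    have "2 * m * \<bar>x - y\<bar> \<le> norm (\<gamma> x - \<gamma> y) + m * \<bar>x - y\<bar>"
      using norm_triangle_sub[of "(x - y) *\<^sub>R D t" "\<gamma> x - \<gamma> y"]
        norm_minus_commute[of "(x - y) *\<^sub>R D t" "\<gamma> x - \<gamma> y"] b n by linarith
    then have "m * \<bar>x - y\<bar> \<le> norm (\<gamma> x - \<gamma> y)" by simp
    then have "\<bar>x - y\<bar> \<le> 1 / m * norm (\<gamma> x - \<gamma> y)" using m by (simp add: field_simps)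
    also have "\<dots> \<le> L * norm (\<gamma> x - \<gamma> y)" using L by (intro mult_right_mono) auto
    finally have 1: "\<bar>x - y\<bar> \<le> L * norm (\<gamma> x - \<gamma> y)" .
    have "norm (\<gamma> x - \<gamma> y) \<le> 3 * m * \<bar>x - y\<bar>"
      using norm_triangle_sub[of "\<gamma> x - \<gamma> y" "(x - y) *\<^sub>R D t"] b n by linarith
    also have "\<dots> \<le> L * \<bar>x - y\<bar>" using L by (intro mult_right_mono) auto
    finally show ?thesis using 1 by blast
  qed
  then show ?thesis using r L(1) by blast
qed

section \<open>Winning on a curve\<close>

lemma live_weight_pullback:
  fixes h :: "'a \<Rightarrow> 'b"
  assumes fin: "finite F" and pos: "0 < L" "\<And>E s R. (E, s, R) \<in> F \<Longrightarrow> 0 < s"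
  shows "live_weight p ((\<lambda>(E, s, R). (V \<inter> h -` E, L * s, R)) ` F) B K
    \<le> L powr p * live_weight p F (h ` (B \<inter> V)) K"
proof -
  let ?g = "\<lambda>(E, s, R). (V \<inter> h -` E, L * s, R)"
  let ?A = "{(E, s, R) \<in> F. E \<inter> h ` (B \<inter> V) \<noteq> {} \<and> R \<in> K}"
  have finA: "finite ?A" using fin by (rule rev_finite_subset) auto
  have "{(E, s, R) \<in> ?g ` F. E \<inter> B \<noteq> {} \<and> R \<in> K} \<subseteq> ?g ` ?A"
    by force
  then have "live_weight p (?g ` F) B K \<le> sum (\<lambda>(E, s, R). s powr p) (?g ` ?A)"
    unfolding live_weight_def using finA by (intro sum_mono2) auto
  also have "\<dots> \<le> sum ((\<lambda>(E, s, R). s powr p) \<circ> ?g) ?A"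
    using finA by (rule sum_image_le) auto
  also have "\<dots> = (\<Sum>(E, s, R) \<in> ?A. L powr p * s powr p)"
    using pos by (intro sum.cong) (auto simp: powr_mult)
  also have "\<dots> = L powr p * live_weight p F (h ` (B \<inter> V)) K"
    unfolding live_weight_def by (simp add: sum_distrib_left case_prod_beta)
  finally show ?thesis .
qed

text \<open>The game is played in the parameter of a chart, while the covers live in the parameter of the curve.
  The change \<open>h\<close> between them is bi-Lipschitz, which costs the factors \<open>L\<close> in \<open>\<theta>\<close> and \<open>\<eta>\<close>.\<close>

lemma (in curve_piece) alice_wins_pullback:
  fixes h :: "real \<Rightarrow> real"
  assumes \<beta>: "0 < \<beta>" "\<beta> < 1" and L: "1 \<le> L" and hV: "h ` V \<subseteq> I"
    and bil: "\<And>x y. x \<in> V \<Longrightarrow> y \<in> V \<Longrightarrow> \<bar>x - y\<bar> \<le> L * \<bar>h x - h y\<bar> \<and> \<bar>h x - h y\<bar> \<le> L * \<bar>x - y\<bar>"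
  shows "alice_wins (range (\<lambda>c. {c})) \<beta> V
    {t \<in> V. \<exists>\<epsilon>. 0 < \<epsilon> \<and> \<epsilon> \<le> 1 \<and> (\<forall>Q0. \<exists>Q\<ge>Q0. 1 \<le> Q \<and> \<not> bad_point Q \<epsilon> (X (h t)) (Y (h t)))}"
proof -
  \<comment> \<open>the exponent with \<open>\<beta> powr p = 3 / 4\<close>\<close>
  define p where "p = ln (3 / 4) / ln \<beta>"
  have ln\<beta>: "ln \<beta> < 0" using \<beta> by simp
  have p: "0 < p" unfolding p_def using ln\<beta> by (intro divide_neg_neg) auto
  have "\<beta> powr p = exp (ln (3 / 4))" using \<beta> ln\<beta> by (simp add: powr_def p_def)
  then have \<beta>p: "\<beta> powr p = 3 / 4" by simp
  define \<theta> where "\<theta> = \<beta> / (2 * L)"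
  have \<theta>: "0 < \<theta>" "\<theta> \<le> 1" using \<beta> L by (auto simp: \<theta>_def field_simps)
  define \<eta> where "\<eta> = 1 / (4 * L powr p * (2 * L) powr p)"
  have \<eta>: "0 < \<eta>" using L by (simp add: \<eta>_def)
  obtain \<epsilon> where \<epsilon>: "0 < \<epsilon>" "\<epsilon> \<le> 1" and fam: "\<And>\<rho>0 \<eta>0 Q0. 0 < \<rho>0 \<Longrightarrow> 0 < \<eta>0 \<Longrightarrow>
    \<exists>Q F. Q \<ge> Q0 \<and> Q \<ge> 1 \<and> finite F \<and>
    (\<forall>(E, s, R)\<in>F. 0 < s \<and> 0 < R \<and> (\<forall>x\<in>E. \<forall>y\<in>E. \<bar>x - y\<bar> \<le> s)) \<and>
    {t \<in> I. bad_point Q \<epsilon> (X t) (Y t)} \<subseteq> \<Union>(fst ` F) \<and>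
    (\<forall>d>0. \<forall>B. (\<forall>x\<in>B. \<forall>y\<in>B. \<bar>x - y\<bar> \<le> d) \<longrightarrow> live_weight p F B {\<theta> * d..d / \<theta>} \<le> \<eta> * d powr p) \<and>
    live_weight p F UNIV {\<rho>0..} \<le> \<eta>0"
    using tame_families_exist[OF p \<theta> \<eta>]
    by - (elim exE conjE, rule that,
       (assumption | (drule spec, drule mp, assumption, drule spec, drule mp, assumption, erule spec))+)
  define G where "G = (\<lambda>N::nat. {t \<in> V. \<exists>Q\<ge>real N. 1 \<le> Q \<and> \<not> bad_point Q \<epsilon> (X (h t)) (Y (h t))})"
  have "alice_wins (range (\<lambda>c. {c})) \<beta> V (\<Inter>N. G N)"
  proof (rule potential_game[OF \<beta> p \<beta>p])
    fix N :: nat and c \<rho> :: real assume \<rho>: "0 < \<rho>" "cball c \<rho> \<subseteq> V"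
    define \<eta>0 where "\<eta>0 = \<rho> powr p / 2 / L powr p"
    have \<eta>0: "0 < \<eta>0" using \<rho> L by (simp add: \<eta>0_def)
    obtain Q F where Q: "real N \<le> Q" "1 \<le> Q" and fin: "finite F"
      and F': "\<forall>(E, s, R)\<in>F. 0 < s \<and> 0 < R \<and> (\<forall>x\<in>E. \<forall>y\<in>E. \<bar>x - y\<bar> \<le> s)"
      and cov: "{t \<in> I. bad_point Q \<epsilon> (X t) (Y t)} \<subseteq> \<Union>(fst ` F)"
      and loc: "\<forall>d>0. \<forall>B. (\<forall>x\<in>B. \<forall>y\<in>B. \<bar>x - y\<bar> \<le> d) \<longrightarrow>
        live_weight p F B {\<theta> * d..d / \<theta>} \<le> \<eta> * d powr p"
      and init: "live_weight p F UNIV {\<rho>..} \<le> \<eta>0"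
      using fam[OF \<rho>(1) \<eta>0, of "real N"] by - (elim exE conjE, rule that; assumption)
    have F: "0 < s \<and> 0 < R \<and> (\<forall>x\<in>E. \<forall>y\<in>E. \<bar>x - y\<bar> \<le> s)" if "(E, s, R) \<in> F" for E s R
      using F' that by auto
    define F' where "F' = (\<lambda>(E, s, R). (V \<inter> h -` E, L * s, R)) ` F"
    have pull: "live_weight p F' B K \<le> L powr p * live_weight p F (h ` (B \<inter> V)) K" for B K
      unfolding F'_def using F L by (intro live_weight_pullback fin) auto
    have "tame_family \<beta> p c \<rho> F'"
      unfolding tame_family_def
    proof (intro conjI allI impI)
      show "finite F'" unfolding F'_def using fin by blast
      show "\<forall>(E, s, R)\<in>F'. 0 < s \<and> 0 < R \<and> (\<forall>x\<in>E. \<forall>y\<in>E. \<bar>x - y\<bar> \<le> s)"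
      proof (intro ballI, unfold case_prod_beta, intro conjI ballI)
        fix z assume "z \<in> F'"
        then obtain E s R where z: "(E, s, R) \<in> F" "z = (V \<inter> h -` E, L * s, R)" unfolding F'_def by auto
        show "0 < fst (snd z)" "0 < snd (snd z)" using F[OF z(1)] L unfolding z(2) by auto
        fix x y assume "x \<in> fst z" "y \<in> fst z"
        then have xy: "x \<in> V" "y \<in> V" "h x \<in> E" "h y \<in> E" unfolding z(2) by auto
        have "\<bar>x - y\<bar> \<le> L * \<bar>h x - h y\<bar>" using bil xy by blast
        also have "\<dots> \<le> L * s" using F[OF z(1)] xy L by (intro mult_left_mono) auto
        finally show "\<bar>x - y\<bar> \<le> fst (snd z)" unfolding z(2) by simp
      qed
      have "live_weight p F' (cball c \<rho>) {\<rho>..} \<le> L powr p * live_weight p F (h ` (cball c \<rho> \<inter> V)) {\<rho>..}"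
        by (rule pull)
      also have "\<dots> \<le> L powr p * \<eta>0"
        using live_weight_mono[OF fin, of "h ` (cball c \<rho> \<inter> V)" UNIV "{\<rho>..}" "{\<rho>..}" p] init
        by (intro mult_left_mono) auto
      also have "\<dots> = \<rho> powr p / 2" using L by (simp add: \<eta>0_def)
      finally show "live_weight p F' (cball c \<rho>) {\<rho>..} \<le> \<rho> powr p / 2" .
      fix c' \<rho>' :: real assume \<rho>': "0 < \<rho>'" "\<rho>' \<le> \<rho>" "cball c' \<rho>' \<subseteq> cball c \<rho>"
      define d where "d = 2 * L * \<rho>'"
      have d: "0 < d" using L \<rho>' by (simp add: d_def)
      have diam: "\<forall>x\<in>h ` (cball c' \<rho>' \<inter> V). \<forall>y\<in>h ` (cball c' \<rho>' \<inter> V). \<bar>x - y\<bar> \<le> d"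
      proof (intro ballI)
        fix x y assume "x \<in> h ` (cball c' \<rho>' \<inter> V)" "y \<in> h ` (cball c' \<rho>' \<inter> V)"
        then obtain u v where uv: "u \<in> cball c' \<rho>'" "u \<in> V" "x = h u" "v \<in> cball c' \<rho>'" "v \<in> V" "y = h v" by blast
        have "\<bar>x - y\<bar> \<le> L * \<bar>u - v\<bar>" unfolding uv using bil[OF uv(2,5)] by blast
        also have "\<dots> \<le> L * (2 * \<rho>')" using uv(1,4) L by (intro mult_left_mono) (auto simp: dist_real_def)
        finally show "\<bar>x - y\<bar> \<le> d" by (simp add: d_def mult_ac)
      qed
      have "\<theta> * d = \<beta> * \<rho>'" using L by (simp add: \<theta>_def d_def)
      moreover have "\<rho>' \<le> d / \<theta>"
      proof -
        have "\<rho>' * \<theta> \<le> \<rho>' * 1" using \<theta> \<rho>' by (intro mult_left_mono) auto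
        also have "\<dots> \<le> d" using L \<rho>' by (simp add: d_def)
        finally show ?thesis using \<theta> by (simp add: field_simps)
      qed
      ultimately have sub: "{\<beta> * \<rho>'..<\<rho>'} \<subseteq> {\<theta> * d..d / \<theta>}" by auto
      have "live_weight p F' (cball c' \<rho>') {\<beta> * \<rho>'..<\<rho>'}
         \<le> L powr p * live_weight p F (h ` (cball c' \<rho>' \<inter> V)) {\<beta> * \<rho>'..<\<rho>'}"
        by (rule pull)
      also have "\<dots> \<le> L powr p * (\<eta> * d powr p)"
      proof (rule mult_left_mono)
        have "live_weight p F (h ` (cball c' \<rho>' \<inter> V)) {\<beta> * \<rho>'..<\<rho>'}
           \<le> live_weight p F (h ` (cball c' \<rho>' \<inter> V)) {\<theta> * d..d / \<theta>}"
          by (rule live_weight_mono[OF fin subset_refl sub])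
        also have "\<dots> \<le> \<eta> * d powr p" using loc d diam by blast
        finally show "live_weight p F (h ` (cball c' \<rho>' \<inter> V)) {\<beta> * \<rho>'..<\<rho>'} \<le> \<eta> * d powr p" .
      qed simp
      also have "\<dots> = \<rho>' powr p / 4"
        using L \<rho>' by (simp add: \<eta>_def d_def powr_mult)
      finally show "live_weight p F' (cball c' \<rho>') {\<beta> * \<rho>'..<\<rho>'} \<le> \<rho>' powr p / 4" .
    qed
    moreover have "V - \<Union>(fst ` F') \<subseteq> G N"
    proof
      fix t assume t: "t \<in> V - \<Union>(fst ` F')"
      have "h t \<notin> \<Union>(fst ` F)"
      proof
        assume "h t \<in> \<Union>(fst ` F)"
        then obtain E s R where "(E, s, R) \<in> F" "h t \<in> E" by auto
        then have "(V \<inter> h -` E, L * s, R) \<in> F'" "t \<in> V \<inter> h -` E" using t unfolding F'_def by force+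
        then show False using t by force
      qed
      moreover have "h t \<in> I" using hV t by blast
      ultimately have "\<not> bad_point Q \<epsilon> (X (h t)) (Y (h t))" using cov by blast
      then show "t \<in> G N" using Q t unfolding G_def by blast
    qed
    ultimately show "\<exists>F. tame_family \<beta> p c \<rho> F \<and> V - \<Union>(fst ` F) \<subseteq> G N" by blast
  qed
  then show ?thesis
  proof (rule alice_wins_mono[OF _ subset_refl])
    show "V \<inter> (\<Inter>N. G N) \<subseteq> {t \<in> V. \<exists>\<epsilon>. 0 < \<epsilon> \<and> \<epsilon> \<le> 1 \<and> (\<forall>Q0. \<exists>Q\<ge>Q0. 1 \<le> Q \<and> \<not> bad_point Q \<epsilon> (X (h t)) (Y (h t)))}"
    proof
      fix t assume t: "t \<in> V \<inter> (\<Inter>N. G N)"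
      have "\<exists>Q\<ge>Q0. 1 \<le> Q \<and> \<not> bad_point Q \<epsilon> (X (h t)) (Y (h t))" for Q0
      proof -
        obtain N :: nat where "Q0 \<le> real N" using real_arch_simple by blast
        moreover have "t \<in> G N" using t by blast
        ultimately show ?thesis unfolding G_def by (blast intro: order_trans)
      qed
      then show "t \<in> {t \<in> V. \<exists>\<epsilon>. 0 < \<epsilon> \<and> \<epsilon> \<le> 1 \<and> (\<forall>Q0. \<exists>Q\<ge>Q0. 1 \<le> Q \<and> \<not> bad_point Q \<epsilon> (X (h t)) (Y (h t)))}"
        using t \<epsilon> by blast
    qed
  qed
qed

lemma eventually_near_value:
  fixes f :: "real \<Rightarrow> real"
  assumes "open J" "t \<in> J" "continuous_on J f"
  shows "f t \<noteq> 0 \<Longrightarrow> \<forall>\<^sub>F s in nhds t. \<bar>f t\<bar> / 2 \<le> \<bar>f s\<bar>" "\<forall>\<^sub>F s in nhds t. \<bar>f s\<bar> \<le> \<bar>f t\<bar> + 1"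
proof -
  have "isCont (\<lambda>s. \<bar>f s\<bar>) t" using assms by (simp add: continuous_on_eq_continuous_at)
  then have lim: "((\<lambda>s. \<bar>f s\<bar>) \<longlongrightarrow> \<bar>f t\<bar>) (nhds t)"
    unfolding isCont_def by (simp add: tendsto_nhds_iff)
  show "\<forall>\<^sub>F s in nhds t. \<bar>f t\<bar> / 2 \<le> \<bar>f s\<bar>" if "f t \<noteq> 0"
    using order_tendstoD(1)[OF lim, of "\<bar>f t\<bar> / 2"] that by (auto elim: eventually_mono)
  show "\<forall>\<^sub>F s in nhds t. \<bar>f s\<bar> \<le> \<bar>f t\<bar> + 1"
    using order_tendstoD(2)[OF lim, of "\<bar>f t\<bar> + 1"] by (auto elim: eventually_mono)
qed

lemma C2_param_continuous:
  assumes p: "C2_param C J \<gamma>"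
  shows "continuous_on J (\<lambda>t. vector_derivative \<gamma> (at t))"
    "continuous_on J (\<lambda>t. vector_derivative (\<lambda>s. vector_derivative \<gamma> (at s)) (at t))"
  using p unfolding C2_param_def C1_param_def C1_differentiable_on_eq by auto

lemma curve_piece_exists:
  fixes \<gamma> :: "real \<Rightarrow> real \<times> real"
  defines "\<gamma>1 \<equiv> \<lambda>t. vector_derivative \<gamma> (at t)"
  defines "\<gamma>2 \<equiv> \<lambda>t. vector_derivative \<gamma>1 (at t)"
  assumes p: "C2_param C J \<gamma>" and t: "t \<in> J"
    and nz: "fst (\<gamma>1 t) \<noteq> 0" "snd (\<gamma>1 t) \<noteq> 0" "wedge (\<gamma>1 t) (\<gamma>2 t) \<noteq> 0"
  shows "\<exists>r a b. 0 < r \<and> cball t r \<subseteq> J \<and>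
    curve_piece (cball t r) (\<lambda>s. fst (\<gamma> s)) (\<lambda>s. snd (\<gamma> s)) (\<lambda>s. fst (\<gamma>1 s)) (\<lambda>s. snd (\<gamma>1 s))
      (\<lambda>s. fst (\<gamma>2 s)) (\<lambda>s. snd (\<gamma>2 s)) a b"
proof -
  have J: "open J" using p by (simp add: C2_param_def C1_param_def)
  have c: "continuous_on J \<gamma>1" "continuous_on J \<gamma>2"
    using C2_param_continuous[OF p] by (simp_all add: \<gamma>1_def \<gamma>2_def)
  note cs = continuous_on_fst[OF c(1)] continuous_on_snd[OF c(1)] continuous_on_fst[OF c(2)] continuous_on_snd[OF c(2)]
  have cw: "continuous_on J (\<lambda>s. wedge (\<gamma>1 s) (\<gamma>2 s))"
    unfolding wedge_def by (intro continuous_intros c)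
  define a where "a = min 1 (min (\<bar>fst (\<gamma>1 t)\<bar> / 2) (min (\<bar>snd (\<gamma>1 t)\<bar> / 2) (\<bar>wedge (\<gamma>1 t) (\<gamma>2 t)\<bar> / 2)))"
  define b where "b = 1 + \<bar>fst (\<gamma>1 t)\<bar> + \<bar>snd (\<gamma>1 t)\<bar> + \<bar>fst (\<gamma>2 t)\<bar> + \<bar>snd (\<gamma>2 t)\<bar>"
  define P where "P = (\<lambda>s. s \<in> J \<and> a \<le> \<bar>fst (\<gamma>1 s)\<bar> \<and> a \<le> \<bar>snd (\<gamma>1 s)\<bar> \<and> a \<le> \<bar>wedge (\<gamma>1 s) (\<gamma>2 s)\<bar> \<and>
     \<bar>fst (\<gamma>1 s)\<bar> \<le> b \<and> \<bar>snd (\<gamma>1 s)\<bar> \<le> b \<and> \<bar>fst (\<gamma>2 s)\<bar> \<le> b \<and> \<bar>snd (\<gamma>2 s)\<bar> \<le> b)"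
  have "\<forall>\<^sub>F s in nhds t. P s"
    using eventually_nhds_in_open[OF J t]
      eventually_near_value(1)[OF J t cs(1) nz(1)] eventually_near_value(1)[OF J t cs(2) nz(2)]
      eventually_near_value(1)[OF J t cw nz(3)]
      eventually_near_value(2)[OF J t cs(1)] eventually_near_value(2)[OF J t cs(2)]
      eventually_near_value(2)[OF J t cs(3)] eventually_near_value(2)[OF J t cs(4)]
  proof eventually_elim
    case (elim s)
    have "a \<le> \<bar>fst (\<gamma>1 t)\<bar> / 2" "a \<le> \<bar>snd (\<gamma>1 t)\<bar> / 2" "a \<le> \<bar>wedge (\<gamma>1 t) (\<gamma>2 t)\<bar> / 2"
      unfolding a_def by linarith+
    moreover have "\<bar>fst (\<gamma>1 t)\<bar> + 1 \<le> b" "\<bar>snd (\<gamma>1 t)\<bar> + 1 \<le> b" "\<bar>fst (\<gamma>2 t)\<bar> + 1 \<le> b" "\<bar>snd (\<gamma>2 t)\<bar> + 1 \<le> b"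
      unfolding b_def by linarith+
    ultimately show ?case unfolding P_def using elim by (meson order_trans)
  qed
  then obtain d where d: "0 < d" "\<And>s. dist s t < d \<Longrightarrow> P s" unfolding eventually_nhds_metric by blast
  define r where "r = d / 2"
  have r: "0 < r" "\<And>s. s \<in> cball t r \<Longrightarrow> P s" using d by (auto simp: r_def dist_commute)
  then have sub: "cball t r \<subseteq> J" unfolding P_def by blast
  have D: "(\<gamma> has_vector_derivative \<gamma>1 s) (at s within cball t r)"
    "(\<gamma>1 has_vector_derivative \<gamma>2 s) (at s within cball t r)" if "s \<in> cball t r" for s
    unfolding \<gamma>1_def \<gamma>2_def
    by (rule has_vector_derivative_at_within, rule C2_param_derivatives[OF p], use that sub in blast)+
  have "curve_piece (cball t r) (\<lambda>s. fst (\<gamma> s)) (\<lambda>s. snd (\<gamma> s)) (\<lambda>s. fst (\<gamma>1 s)) (\<lambda>s. snd (\<gamma>1 s))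
      (\<lambda>s. fst (\<gamma>2 s)) (\<lambda>s. snd (\<gamma>2 s)) a b"
  proof
    show "0 < a" "a \<le> 1" "1 \<le> b" using nz by (auto simp: a_def b_def)
    show "convex (cball t r)" "bounded (cball t r)" by auto
    show "continuous_on (cball t r) (\<lambda>s. fst (\<gamma>2 s))" "continuous_on (cball t r) (\<lambda>s. snd (\<gamma>2 s))"
      using cs(3,4) sub continuous_on_subset by blast+
    fix s assume s: "s \<in> cball t r"
    show "((\<lambda>s. fst (\<gamma> s)) has_real_derivative fst (\<gamma>1 s)) (at s within cball t r)"
      "((\<lambda>s. snd (\<gamma> s)) has_real_derivative snd (\<gamma>1 s)) (at s within cball t r)"
      "((\<lambda>s. fst (\<gamma>1 s)) has_real_derivative fst (\<gamma>2 s)) (at s within cball t r)"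
      "((\<lambda>s. snd (\<gamma>1 s)) has_real_derivative snd (\<gamma>2 s)) (at s within cball t r)"
      using has_vector_derivative_components[OF D(1)[OF s]] has_vector_derivative_components[OF D(2)[OF s]] by auto
    show "a \<le> \<bar>fst (\<gamma>1 s)\<bar> \<and> \<bar>fst (\<gamma>1 s)\<bar> \<le> b \<and> \<bar>fst (\<gamma>2 s)\<bar> \<le> b"
      "a \<le> \<bar>snd (\<gamma>1 s)\<bar> \<and> \<bar>snd (\<gamma>1 s)\<bar> \<le> b \<and> \<bar>snd (\<gamma>2 s)\<bar> \<le> b"
      "a \<le> \<bar>fst (\<gamma>1 s) * snd (\<gamma>2 s) - snd (\<gamma>1 s) * fst (\<gamma>2 s)\<bar>"
      using r(2)[OF s] unfolding P_def wedge_def by auto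
  qed
  then show ?thesis using r(1) sub by blast
qed

lemma eventually_nonzero_at:
  fixes f :: "real \<Rightarrow> real"
  assumes "(f has_real_derivative f') (at t)" "f t \<noteq> 0 \<or> f' \<noteq> 0"
  shows "\<forall>\<^sub>F s in at t. f s \<noteq> 0"
proof (cases "f t = 0")
  case True
  have "((\<lambda>s. (f s - f t) / (s - t)) \<longlongrightarrow> f') (at t)"
    using assms(1) unfolding has_field_derivative_iff .
  then have "\<forall>\<^sub>F s in at t. (f s - f t) / (s - t) \<noteq> 0"
    using assms(2) True by (intro tendsto_imp_eventually_ne) auto
  then show ?thesis by eventually_elim (use True in auto)
next
  case False
  have "(f \<longlongrightarrow> f t) (at t)" using DERIV_isCont[OF assms(1)] by (simp add: isCont_def)
  then show ?thesis using False by (rule tendsto_imp_eventually_ne)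
qed

text \<open>Near a point of nonzero curvature the coordinates of the tangent vector vanish at most at this point
  itself. Alice first reaches such a neighborhood, then removes the point, and afterwards plays the
  potential game on a piece of the curve where both coordinates are strictly monotone.\<close>

theorem winning_in_chart:
  assumes C: "regular_C2_curve C" and p: "C1_param C J \<gamma>" and \<beta>: "0 < \<beta>" "\<beta> < 1 / 3"
    and curved: "alice_wins (range (\<lambda>c. {c})) \<beta> J {t \<in> J. curvature C (torus_pt (\<gamma> t)) \<noteq> 0}"
  shows "alice_wins (range (\<lambda>c. {c})) \<beta> J {t \<in> J. \<not> fiberwise_divergent (torus_pt (\<gamma> t))}"
proof (rule alice_wins_switch[OF \<beta>(1) curved])
  let ?S = "{t \<in> J. \<not> fiberwise_divergent (torus_pt (\<gamma> t))}"
  have J: "open J" and \<gamma>: "\<gamma> C1_differentiable_on J" and \<gamma>0: "\<And>t. t \<in> J \<Longrightarrow> vector_derivative \<gamma> (at t) \<noteq> 0"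
    and op: "openin (subtopology X3_topology C) ((torus_pt \<circ> \<gamma>) ` J)"
    using p by (auto simp: C1_param_def)
  fix t0 assume "t0 \<in> {t \<in> J. curvature C (torus_pt (\<gamma> t)) \<noteq> 0}"
  then have t0: "t0 \<in> J" "curvature C (torus_pt (\<gamma> t0)) \<noteq> 0" by auto
  have "torus_pt (\<gamma> t0) \<in> C" using openin_subset[OF op] t0(1) by (auto simp: topspace_subtopology)
  then obtain J2 \<delta> where p2: "C2_param C J2 \<delta>" "torus_pt (\<gamma> t0) \<in> (torus_pt \<circ> \<delta>) ` J2"
    using C unfolding regular_C2_curve_def by blast
  then obtain t2 where t2: "t2 \<in> J2" "torus_pt (\<gamma> t0) = torus_pt (\<delta> t2)" by auto
  have p2': "C1_param C J2 \<delta>" and J2: "open J2" and \<delta>C: "\<delta> C1_differentiable_on J2"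
    and \<delta>0: "\<And>t. t \<in> J2 \<Longrightarrow> vector_derivative \<delta> (at t) \<noteq> 0"
    using p2(1) by (auto simp: C2_param_def C1_param_def)
  define \<delta>1 where "\<delta>1 = (\<lambda>t. vector_derivative \<delta> (at t))"
  define \<delta>2 where "\<delta>2 = (\<lambda>t. vector_derivative \<delta>1 (at t))"
  obtain r h where r: "0 < r" "ball t0 r \<subseteq> J" and hc: "continuous_on (ball t0 r) h" and hJ: "h ` ball t0 r \<subseteq> J2"
    and h0: "h t0 = t2" and inj: "inj_on h (ball t0 r)"
    and same: "\<forall>t\<in>ball t0 r. torus_pt (\<delta> (h t)) = torus_pt (\<gamma> t)"
    and chord: "\<forall>s\<in>ball t0 r. \<forall>t\<in>ball t0 r. \<delta> (h s) - \<delta> (h t) = \<gamma> s - \<gamma> t"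
    using param_transition[OF p p2' t0(1) t2] by - (elim exE conjE, rule that; assumption)
  have "param_curvature \<delta> t2 \<noteq> 0" using t0(2) curvature_eq[OF p2(1) t2(1)] t2(2) by simp
  then have W: "wedge (\<delta>1 t2) (\<delta>2 t2) \<noteq> 0"
    by (auto simp: param_curvature_def Let_def wedge_def \<delta>1_def \<delta>2_def)
  have D1: "(\<delta>1 has_vector_derivative \<delta>2 t2) (at t2)"
    unfolding \<delta>1_def \<delta>2_def by (rule C2_param_derivatives(2)[OF p2(1) t2(1)])
  have c12: "continuous_on J2 \<delta>1" "continuous_on J2 \<delta>2"
    using C2_param_continuous[OF p2(1)] by (simp_all add: \<delta>1_def \<delta>2_def)
  have cw: "continuous_on J2 (\<lambda>s. wedge (\<delta>1 s) (\<delta>2 s))"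
    unfolding wedge_def by (intro continuous_intros c12)
  then have "((\<lambda>s. wedge (\<delta>1 s) (\<delta>2 s)) \<longlongrightarrow> wedge (\<delta>1 t2) (\<delta>2 t2)) (at t2)"
    using J2 t2(1) by (simp add: continuous_on_eq_continuous_at isCont_def)
  then have "\<forall>\<^sub>F s in at t2. wedge (\<delta>1 s) (\<delta>2 s) \<noteq> 0" using W by (rule tendsto_imp_eventually_ne)
  moreover have "\<forall>\<^sub>F s in at t2. fst (\<delta>1 s) \<noteq> 0"
    by (rule eventually_nonzero_at[OF has_vector_derivative_components(1)[OF D1]])
       (use W in \<open>auto simp: wedge_def\<close>)
  moreover have "\<forall>\<^sub>F s in at t2. snd (\<delta>1 s) \<noteq> 0"
    by (rule eventually_nonzero_at[OF has_vector_derivative_components(2)[OF D1]])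
       (use W in \<open>auto simp: wedge_def\<close>)
  ultimately have ev: "\<forall>\<^sub>F s in at t2. fst (\<delta>1 s) \<noteq> 0 \<and> snd (\<delta>1 s) \<noteq> 0 \<and> wedge (\<delta>1 s) (\<delta>2 s) \<noteq> 0"
    by eventually_elim blast
  have near: "\<forall>\<^sub>F s in at t0. s \<in> ball t0 r" using r(1) by (intro eventually_at_in_open') auto
  have "isCont h t0" using hc r(1) by (simp add: continuous_on_eq_continuous_at)
  then have "(h \<longlongrightarrow> t2) (at t0)" using h0 by (simp add: isCont_def)
  moreover have "\<forall>\<^sub>F s in at t0. h s \<in> UNIV \<and> h s \<noteq> t2"
    using near eventually_neq_at_within[of t0]
  proof eventually_elim
    case (elim s)
    then show ?case using r(1) h0 inj by (metis UNIV_I centre_in_ball inj_onD)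
  qed
  ultimately have hlim: "filterlim h (at t2) (at t0)" by (simp add: filterlim_at)
  have "\<forall>\<^sub>F s in at t0. s \<in> ball t0 r \<and> fst (\<delta>1 (h s)) \<noteq> 0 \<and> snd (\<delta>1 (h s)) \<noteq> 0 \<and> wedge (\<delta>1 (h s)) (\<delta>2 (h s)) \<noteq> 0"
    using near eventually_compose_filterlim[OF ev hlim] by eventually_elim blast
  then obtain d where d: "0 < d" "\<And>s. s \<noteq> t0 \<Longrightarrow> dist s t0 < d \<Longrightarrow>
      s \<in> ball t0 r \<and> fst (\<delta>1 (h s)) \<noteq> 0 \<and> snd (\<delta>1 (h s)) \<noteq> 0 \<and> wedge (\<delta>1 (h s)) (\<delta>2 (h s)) \<noteq> 0"
    unfolding eventually_at by blast
  have "alice_wins (range (\<lambda>c. {c})) \<beta> (ball t0 d) ?S"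
  proof (rule alice_wins_switch[OF \<beta>(1) alice_wins_remove_point[OF \<beta>(1), of _ t0]])
    fix t1 assume "t1 \<in> ball t0 d - {t0}"
    then have t1: "t1 \<in> ball t0 r" "fst (\<delta>1 (h t1)) \<noteq> 0" "snd (\<delta>1 (h t1)) \<noteq> 0" "wedge (\<delta>1 (h t1)) (\<delta>2 (h t1)) \<noteq> 0"
      using d(2)[of t1] by (auto simp: dist_commute)
    have ht1: "h t1 \<in> J2" using t1(1) hJ by blast
    obtain r3 a b where r3: "0 < r3" "cball (h t1) r3 \<subseteq> J2" and piece:
      "curve_piece (cball (h t1) r3) (\<lambda>s. fst (\<delta> s)) (\<lambda>s. snd (\<delta> s)) (\<lambda>s. fst (\<delta>1 s)) (\<lambda>s. snd (\<delta>1 s))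
      (\<lambda>s. fst (\<delta>2 s)) (\<lambda>s. snd (\<delta>2 s)) a b"
      using curve_piece_exists[OF p2(1) ht1] t1 unfolding \<delta>1_def \<delta>2_def by blast
    have t1J: "t1 \<in> J" using t1(1) r(2) by blast
    obtain r1 L1 where r1: "0 < r1" "1 \<le> L1" and bil1: "\<forall>x\<in>ball t1 r1. \<forall>y\<in>ball t1 r1.
        \<bar>x - y\<bar> \<le> L1 * norm (\<gamma> x - \<gamma> y) \<and> norm (\<gamma> x - \<gamma> y) \<le> L1 * \<bar>x - y\<bar>"
      using locally_bilipschitz[OF J t1J \<gamma> \<gamma>0[OF t1J]] by blast
    obtain r2 L2 where r2: "0 < r2" "1 \<le> L2" and bil2: "\<forall>x\<in>ball (h t1) r2. \<forall>y\<in>ball (h t1) r2.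
        \<bar>x - y\<bar> \<le> L2 * norm (\<delta> x - \<delta> y) \<and> norm (\<delta> x - \<delta> y) \<le> L2 * \<bar>x - y\<bar>"
      using locally_bilipschitz[OF J2 ht1 \<delta>C \<delta>0[OF ht1]] by blast
    have "(h \<longlongrightarrow> h t1) (nhds t1)"
      using hc t1(1) by (simp add: continuous_on_eq_continuous_at isCont_def tendsto_nhds_iff)
    then have "\<forall>\<^sub>F s in nhds t1. h s \<in> ball (h t1) (min r2 r3)"
      using r2 r3 by (intro topological_tendstoD) auto
    moreover have "\<forall>\<^sub>F s in nhds t1. s \<in> ball t0 r" "\<forall>\<^sub>F s in nhds t1. s \<in> ball t1 r1"
      using eventually_nhds_in_open[OF open_ball t1(1)] eventually_nhds_in_open[OF open_ball, of t1 t1 r1] r1(1)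
      by simp_all
    ultimately have "\<forall>\<^sub>F s in nhds t1. h s \<in> ball (h t1) (min r2 r3) \<and> s \<in> ball t0 r \<and> s \<in> ball t1 r1"
      by eventually_elim blast
    then obtain d1 where d1: "0 < d1" "\<And>s. dist s t1 < d1 \<Longrightarrow>
        h s \<in> ball (h t1) (min r2 r3) \<and> s \<in> ball t0 r \<and> s \<in> ball t1 r1"
      unfolding eventually_nhds_metric by blast
    define V where "V = ball t1 d1"
    have V: "h s \<in> ball (h t1) r2" "h s \<in> cball (h t1) r3" "s \<in> ball t0 r" "s \<in> ball t1 r1" if "s \<in> V" for s
      using d1(2)[of s] that by (auto simp: V_def dist_commute)
    have bil: "\<bar>x - y\<bar> \<le> (L1 * L2) * \<bar>h x - h y\<bar> \<and> \<bar>h x - h y\<bar> \<le> (L1 * L2) * \<bar>x - y\<bar>"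
      if xy: "x \<in> V" "y \<in> V" for x y
    proof
      have eq: "norm (\<gamma> x - \<gamma> y) = norm (\<delta> (h x) - \<delta> (h y))" using chord V(3) xy by metis
      have b1: "\<bar>x - y\<bar> \<le> L1 * norm (\<gamma> x - \<gamma> y)" "norm (\<gamma> x - \<gamma> y) \<le> L1 * \<bar>x - y\<bar>"
        using bil1 V(4)[OF xy(1)] V(4)[OF xy(2)] by blast+
      have b2: "\<bar>h x - h y\<bar> \<le> L2 * norm (\<gamma> x - \<gamma> y)" "norm (\<gamma> x - \<gamma> y) \<le> L2 * \<bar>h x - h y\<bar>"
        unfolding eq using bil2 V(1)[OF xy(1)] V(1)[OF xy(2)] by blast+
      have "L1 * norm (\<gamma> x - \<gamma> y) \<le> L1 * (L2 * \<bar>h x - h y\<bar>)" using b2 r1 by (intro mult_left_mono) auto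
      then show "\<bar>x - y\<bar> \<le> (L1 * L2) * \<bar>h x - h y\<bar>" using b1 by (simp add: mult.assoc)
      have "L2 * norm (\<gamma> x - \<gamma> y) \<le> L2 * (L1 * \<bar>x - y\<bar>)" using b1 r2 by (intro mult_left_mono) auto
      then show "\<bar>h x - h y\<bar> \<le> (L1 * L2) * \<bar>x - y\<bar>" using b2 by (simp add: mult_ac)
    qed
    have "1 * 1 \<le> L1 * L2" using r1 r2 by (intro mult_mono) auto
    then have L: "1 \<le> L1 * L2" by simp
    have hV: "h ` V \<subseteq> cball (h t1) r3" using V(2) by blast
    have "\<beta> < 1" using \<beta> by simp
    from curve_piece.alice_wins_pullback[OF piece \<beta>(1) this L hV bil]
    have "alice_wins (range (\<lambda>c. {c})) \<beta> V ?S"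
    proof (rule alice_wins_mono[OF _ subset_refl])
      show "V \<inter> {t \<in> V. \<exists>\<epsilon>. 0 < \<epsilon> \<and> \<epsilon> \<le> 1 \<and>
           (\<forall>Q0. \<exists>Q\<ge>Q0. 1 \<le> Q \<and> \<not> bad_point Q \<epsilon> (fst (\<delta> (h t))) (snd (\<delta> (h t))))} \<subseteq> ?S"
      proof
        fix t assume t: "t \<in> V \<inter> {t \<in> V. \<exists>\<epsilon>. 0 < \<epsilon> \<and> \<epsilon> \<le> 1 \<and>
           (\<forall>Q0. \<exists>Q\<ge>Q0. 1 \<le> Q \<and> \<not> bad_point Q \<epsilon> (fst (\<delta> (h t))) (snd (\<delta> (h t))))}"
        then have "\<not> fiberwise_divergent (torus_pt (\<delta> (h t)))" using not_fiberwise_divergent by blast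
        moreover have "t \<in> ball t0 r" using V(3) t by blast
        ultimately show "t \<in> ?S" using same r(2) by auto
      qed
    qed
    then show "\<exists>V. open V \<and> t1 \<in> V \<and> alice_wins (range (\<lambda>c. {c})) \<beta> V ?S"
      using d1(1) unfolding V_def by (intro exI[of _ "ball t1 d1"]) auto
  qed
  then show "\<exists>V. open V \<and> t0 \<in> V \<and> alice_wins (range (\<lambda>c. {c})) \<beta> V ?S"
    using d(1) by (intro exI[of _ "ball t0 d"]) auto
qed

section \<open>Hausdorff dimension\<close>

text \<open>Intersecting a cover of \<open>B\<close> with \<open>A\<close> gives a cover of \<open>A\<close>.\<close>

lemma hausdorff_premeasure_mono:
  assumes "A \<subseteq> B"
  shows "hausdorff_premeasure d s \<delta> A \<le> hausdorff_premeasure d s \<delta> B"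
  unfolding hausdorff_premeasure_def
proof (rule INF_mono)
  fix E assume E: "E \<in> {E :: nat \<Rightarrow> _ set. (\<Union>i. E i) = B \<and> (\<forall>i. \<forall>x\<in>E i. \<forall>y\<in>E i. d x y \<le> \<delta>)}"
  show "\<exists>E'\<in>{E :: nat \<Rightarrow> _ set. (\<Union>i. E i) = A \<and> (\<forall>i. \<forall>x\<in>E i. \<forall>y\<in>E i. d x y \<le> \<delta>)}.
      (\<Sum>i. SUP x\<in>E' i. SUP y\<in>E' i. ennreal (d x y powr s)) \<le> (\<Sum>i. SUP x\<in>E i. SUP y\<in>E i. ennreal (d x y powr s))"
  proof (rule bexI[of _ "\<lambda>i. E i \<inter> A"])
    show "(\<Sum>i. SUP x\<in>E i \<inter> A. SUP y\<in>E i \<inter> A. ennreal (d x y powr s)) \<le> (\<Sum>i. SUP x\<in>E i. SUP y\<in>E i. ennreal (d x y powr s))"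
      by (intro suminf_le summableI SUP_subset_mono) auto
    show "(\<lambda>i. E i \<inter> A) \<in> {E. (\<Union>i. E i) = A \<and> (\<forall>i. \<forall>x\<in>E i. \<forall>y\<in>E i. d x y \<le> \<delta>)}"
      using E assms by auto
  qed
qed

lemma hausdorff_dim_mono:
  assumes "A \<subseteq> B"
  shows "hausdorff_dim d A \<le> hausdorff_dim d B"
proof -
  have "hausdorff_measure d s A \<le> hausdorff_measure d s B" for s
    unfolding hausdorff_measure_def by (intro SUP_mono') (rule hausdorff_premeasure_mono[OF assms])
  then have "hausdorff_measure d s A = 0" if "hausdorff_measure d s B = 0" for s
    using that by (metis le_zero_eq)
  then have "{ennreal s | s. s > 0 \<and> hausdorff_measure d s B = 0} \<subseteq> {ennreal s | s. s > 0 \<and> hausdorff_measure d s A = 0}"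
    by blast
  then show ?thesis unfolding hausdorff_dim_def by (rule Inf_superset_mono)
qed

lemma hausdorff_null_iff:
  "hausdorff_measure d s A = 0 \<longleftrightarrow> (\<forall>\<delta>>0. \<forall>\<eta>>0. \<exists>E :: nat \<Rightarrow> 'm set. (\<Union>i. E i) = A \<and>
     (\<forall>i. \<forall>x\<in>E i. \<forall>y\<in>E i. d x y \<le> \<delta>) \<and>
     (\<Sum>i. SUP x\<in>E i. SUP y\<in>E i. ennreal (d x y powr s)) < ennreal \<eta>)" (is "_ = ?R")
proof -
  have "hausdorff_measure d s A = 0 \<longleftrightarrow> (\<forall>\<delta>>0. hausdorff_premeasure d s \<delta> A = 0)"
    unfolding hausdorff_measure_def bot_ennreal[symmetric] by (subst SUP_bot_conv(1)) auto
  also have "\<dots> \<longleftrightarrow> (\<forall>\<delta>>0. \<forall>\<eta>>0. hausdorff_premeasure d s \<delta> A < ennreal \<eta>)"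
  proof (intro all_cong1 imp_cong refl iffI allI impI)
    fix \<delta> :: real and \<eta> :: real assume "hausdorff_premeasure d s \<delta> A = 0" "0 < \<eta>"
    then show "hausdorff_premeasure d s \<delta> A < ennreal \<eta>" by simp
  next
    fix \<delta> :: real assume *: "\<forall>\<eta>>0. hausdorff_premeasure d s \<delta> A < ennreal \<eta>"
    have "hausdorff_premeasure d s \<delta> A \<le> 0"
    proof (rule ennreal_le_epsilon)
      fix e :: real assume "0 < e"
      then show "hausdorff_premeasure d s \<delta> A \<le> 0 + ennreal e" using * by (simp add: less_imp_le)
    qed
    then show "hausdorff_premeasure d s \<delta> A = 0" by simp
  qed
  also have "\<dots> \<longleftrightarrow> ?R"
    unfolding hausdorff_premeasure_def INF_less_iff by (simp add: Bex_def conj_assoc)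
  finally show ?thesis .
qed

lemma hausdorff_null_UN:
  assumes null: "\<And>n::nat. hausdorff_measure d s (A n) = 0"
  shows "hausdorff_measure d s (\<Union>n. A n) = 0"
  unfolding hausdorff_null_iff
proof (intro allI impI)
  fix \<delta> \<eta> :: real assume \<delta>: "0 < \<delta>" and \<eta>: "0 < \<eta>"
  define S where "S = (\<lambda>E. SUP x\<in>E. SUP y\<in>E. ennreal (d x y powr s))"
  have "\<exists>E :: nat \<Rightarrow> _ set. (\<Union>i. E i) = A n \<and> (\<forall>i. \<forall>x\<in>E i. \<forall>y\<in>E i. d x y \<le> \<delta>) \<and>
       (\<Sum>i. S (E i)) < ennreal (\<eta> / 2 * (1 / 2) ^ Suc n)" for n
  proof -
    have "0 < \<eta> / 2 * (1 / 2) ^ Suc n" using \<eta> by simp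
    then show ?thesis using null[of n] \<delta> unfolding hausdorff_null_iff S_def by blast
  qed
  then obtain E where E: "\<And>n. (\<Union>i. E n i) = A n" "\<And>n i x y. x \<in> E n i \<Longrightarrow> y \<in> E n i \<Longrightarrow> d x y \<le> \<delta>"
    "\<And>n. (\<Sum>i. S (E n i)) < ennreal (\<eta> / 2 * (1 / 2) ^ Suc n)"
    by metis
  define E' where "E' = (\<lambda>k. E (fst (prod_decode k)) (snd (prod_decode k)))"
  have "(\<Union>k. E' k) = (\<Union>n. A n)"
  proof (intro equalityI subsetI)
    fix x assume "x \<in> (\<Union>n. A n)"
    then obtain n i where "x \<in> E n i" using E(1) by blast
    then have "x \<in> E' (prod_encode (n, i))" by (simp add: E'_def)
    then show "x \<in> (\<Union>k. E' k)" by blast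
  next
    fix x assume "x \<in> (\<Union>k. E' k)"
    then obtain k where "x \<in> E (fst (prod_decode k)) (snd (prod_decode k))" unfolding E'_def by blast
    then show "x \<in> (\<Union>n. A n)" using E(1) by blast
  qed
  moreover have "(\<Sum>k. S (E' k)) < ennreal \<eta>"
  proof -
    have "(\<Sum>k. S (E' k)) = (\<Sum>k. (\<lambda>(n, i). S (E n i)) (prod_decode k))"
      by (simp add: E'_def case_prod_beta)
    also have "\<dots> = (\<Sum>n. \<Sum>i. S (E n i))" by (rule suminf_ennreal_2dimen) simp
    also have "\<dots> \<le> (\<Sum>n. ennreal (\<eta> / 2 * (1 / 2) ^ Suc n))"
      using E(3) by (intro suminf_le summableI less_imp_le)
    also have "\<dots> = ennreal (\<eta> / 2)"
    proof -
      have "(\<lambda>n. \<eta> / 2 * (1 / 2) ^ Suc n) sums (\<eta> / 2 * 1)" by (intro sums_mult power_half_series)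
      then have "(\<lambda>n. ennreal (\<eta> / 2 * (1 / 2) ^ Suc n)) sums ennreal (\<eta> / 2)"
        using \<eta> by (subst sums_ennreal) auto
      then show ?thesis by (rule sums_unique[symmetric])
    qed
    also have "\<dots> < ennreal \<eta>" using \<eta> by (simp add: ennreal_less_iff)
    finally show ?thesis .
  qed
  ultimately show "\<exists>E. (\<Union>i. E i) = (\<Union>n. A n) \<and> (\<forall>i. \<forall>x\<in>E i. \<forall>y\<in>E i. d x y \<le> \<delta>) \<and>
     (\<Sum>i. SUP x\<in>E i. SUP y\<in>E i. ennreal (d x y powr s)) < ennreal \<eta>"
    using E(2) unfolding S_def by (intro exI[of _ E']) (auto simp: E'_def)
qed

lemma hausdorff_null_countable_UN:
  assumes "countable X" "\<And>x. x \<in> X \<Longrightarrow> hausdorff_measure d s (A x) = 0"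
  shows "hausdorff_measure d s (\<Union>x\<in>X. A x) = 0"
proof (cases "X = {}")
  case True
  then show ?thesis unfolding hausdorff_null_iff
    by (auto intro!: exI[of _ "\<lambda>_. {}"] simp: bot_ennreal)
next
  case False
  then have "(\<Union>x\<in>X. A x) = (\<Union>n. A (from_nat_into X n))"
    using range_from_nat_into[OF False assms(1)] by (metis image_image)
  moreover have "hausdorff_measure d s (A (from_nat_into X n)) = 0" for n
    by (rule assms(2)) (rule from_nat_into[OF False])
  ultimately show ?thesis using hausdorff_null_UN[of d s "\<lambda>n. A (from_nat_into X n)"] by simp
qed

lemma torus_dist_le: "torus_dist (torus_pt v) (torus_pt w) \<le> dist v w"
  unfolding torus_dist_def by (rule setdist_le_dist) auto

text \<open>Different points of the same fiber differ by an integer vector of length at least 1, so that for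
  points at distance at most \<open>1 / 2\<close> no other lifts are closer to each other.\<close>

lemma torus_dist_ge:
  assumes "norm (v - w) \<le> 1 / 2"
  shows "norm (v - w) \<le> torus_dist (torus_pt v) (torus_pt w)"
  unfolding torus_dist_def
proof (rule le_setdistI)
  fix v' w' assume "v' \<in> torus_pt -` {torus_pt v}" "w' \<in> torus_pt -` {torus_pt w}"
  then have eq: "torus_pt v' = torus_pt v" "torus_pt w' = torus_pt w" by auto
  define z where "z = (v' - v) - (w' - w)"
  have Z: "fst z \<in> \<int>" "snd z \<in> \<int>"
    using torus_pt_eq_imp[OF eq(1)] torus_pt_eq_imp[OF eq(2)] by (auto simp: z_def)
  have vw: "v' - w' = (v - w) + z" by (simp add: z_def)
  show "norm (v - w) \<le> dist v' w'"
  proof (cases "z = 0")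
    case True
    then show ?thesis using vw by (simp add: dist_norm)
  next
    case False
    then have "fst z \<noteq> 0 \<or> snd z \<noteq> 0" by (simp add: prod_eq_iff)
    then have "1 \<le> \<bar>fst z\<bar> \<or> 1 \<le> \<bar>snd z\<bar>" using Z Ints_nonzero_abs_ge1 by blast
    moreover have "\<bar>fst z\<bar> \<le> norm z" "\<bar>snd z\<bar> \<le> norm z"
      using dist_fst_le[of z 0] dist_snd_le[of z 0] by (auto simp: dist_norm)
    ultimately have "1 \<le> norm z" by linarith
    also have "norm z \<le> norm (v' - w') + norm (v - w)"
      using norm_triangle_ineq4[of "v' - w'" "v - w"] unfolding vw by simp
    finally show ?thesis using assms by (simp add: dist_norm)
  qed
qed auto

text \<open>Cutting the interval into \<open>n\<close> equal parts gives a cover of weight of order \<open>n powr (1 - s)\<close>.\<close>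

lemma lipschitz_arc_null:
  fixes f :: "real \<Rightarrow> 'm"
  assumes s: "1 < s" and L: "0 < L" and r: "0 < r"
    and lip: "\<And>x y. x \<in> ball t r \<Longrightarrow> y \<in> ball t r \<Longrightarrow> 0 \<le> d (f x) (f y) \<and> d (f x) (f y) \<le> L * \<bar>x - y\<bar>"
  shows "hausdorff_measure d s (f ` ball t r) = 0"
  unfolding hausdorff_null_iff
proof (intro allI impI)
  fix \<delta> \<eta> :: real assume \<delta>: "0 < \<delta>" and \<eta>: "0 < \<eta>"
  define D where "D = 2 * r * L"
  have D: "0 < D" using r L by (simp add: D_def)
  have "((\<lambda>n. D / real n) \<longlongrightarrow> 0) sequentially" by (rule lim_const_over_n)
  then have "\<forall>\<^sub>F n in sequentially. D / real n < \<delta>" using \<delta> by (rule order_tendstoD(2))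
  moreover have "((\<lambda>n. D powr s * real n powr (1 - s)) \<longlongrightarrow> D powr s * 0) sequentially"
    using s by (intro tendsto_mult tendsto_const tendsto_neg_powr filterlim_real_sequentially) auto
  then have "\<forall>\<^sub>F n in sequentially. D powr s * real n powr (1 - s) < \<eta>" using \<eta> by (intro order_tendstoD(2)) auto
  ultimately have "\<forall>\<^sub>F n in sequentially. D / real n < \<delta> \<and> D powr s * real n powr (1 - s) < \<eta> \<and> 0 < n"
    using eventually_gt_at_top[of 0] by eventually_elim blast
  then obtain n :: nat where n: "D / real n < \<delta>" "D powr s * real n powr (1 - s) < \<eta>" "0 < n"
    using eventually_happens'[OF sequentially_bot] by blast
  define h where "h = 2 * r / real n"
  have h: "0 < h" "n * h = 2 * r" using r n by (auto simp: h_def)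
  define P where "P = (\<lambda>k::nat. if k < n then ball t r \<inter> {t - r + k * h .. t - r + Suc k * h} else {})"
  have cov: "(\<Union>k. P k) = ball t r"
  proof (intro equalityI subsetI)
    fix x assume x: "x \<in> ball t r"
    define y where "y = (x - (t - r)) / h"
    have y: "0 \<le> y" "y < n" using x h r by (auto simp: y_def dist_real_def field_simps)
    define k where "k = nat \<lfloor>y\<rfloor>"
    have k: "real k \<le> y" "y \<le> real k + 1" using y by (auto simp: k_def)
    have "k < n" using k y by linarith
    moreover have "t - r + k * h \<le> x" "x \<le> t - r + Suc k * h"
      using k h unfolding y_def by (auto simp: field_simps)
    ultimately have "x \<in> P k" using x by (simp add: P_def)
    then show "x \<in> (\<Union>k. P k)" by blast
  qed (auto simp: P_def split: if_splits)
  have diam: "0 \<le> d (f x) (f y)" "d (f x) (f y) \<le> D / n" if "x \<in> P k" "y \<in> P k" for x y k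
  proof -
    have b: "x \<in> ball t r" "y \<in> ball t r" "\<bar>x - y\<bar> \<le> h"
      using that by (auto simp: P_def algebra_simps split: if_splits)
    show "0 \<le> d (f x) (f y)" using lip[OF b(1,2)] by blast
    have "d (f x) (f y) \<le> L * \<bar>x - y\<bar>" using lip[OF b(1,2)] by blast
    also have "\<dots> \<le> L * h" using b(3) L by (intro mult_left_mono) auto
    finally show "d (f x) (f y) \<le> D / n" by (simp add: D_def h_def mult_ac)
  qed
  have le: "(SUP x\<in>f ` P k. SUP y\<in>f ` P k. ennreal (d x y powr s)) \<le> (if k < n then ennreal ((D / n) powr s) else 0)" for k
  proof (cases "k < n")
    case True
    have "ennreal (d x y powr s) \<le> ennreal ((D / n) powr s)" if "x \<in> f ` P k" "y \<in> f ` P k" for x y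
      using that diam s by (auto intro!: ennreal_leI powr_mono2)
    then show ?thesis using True by (simp add: SUP_le_iff)
  next
    case False
    then show ?thesis by (simp add: P_def bot_ennreal)
  qed
  have "(\<Sum>k. SUP x\<in>f ` P k. SUP y\<in>f ` P k. ennreal (d x y powr s)) \<le> (\<Sum>k. if k < n then ennreal ((D / n) powr s) else 0)"
    by (intro suminf_le summableI le)
  also have "\<dots> = (\<Sum>k<n. ennreal ((D / n) powr s))"
    by (subst suminf_finite[of "{..<n}"]) auto
  also have "\<dots> = ennreal (n * (D / n) powr s)"
    by (simp add: ennreal_mult ennreal_of_nat_eq_real_of_nat)
  also have "n * (D / n) powr s = D powr s * real n powr (1 - s)"
    using n(3) D by (simp add: powr_divide powr_diff)
  also have "ennreal \<dots> < ennreal \<eta>" using n(2) \<eta> by (simp add: ennreal_less_iff)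
  finally have "(\<Sum>k. SUP x\<in>f ` P k. SUP y\<in>f ` P k. ennreal (d x y powr s)) < ennreal \<eta>" .
  moreover have "(\<Union>k. f ` P k) = f ` ball t r" using cov by blast
  moreover have "\<forall>i. \<forall>x\<in>f ` P i. \<forall>y\<in>f ` P i. d x y \<le> \<delta>" using diam(2) n(1) by fastforce
  ultimately show "\<exists>E. (\<Union>i. E i) = f ` ball t r \<and> (\<forall>i. \<forall>x\<in>E i. \<forall>y\<in>E i. d x y \<le> \<delta>) \<and>
     (\<Sum>i. SUP x\<in>E i. SUP y\<in>E i. ennreal (d x y powr s)) < ennreal \<eta>"
    by (intro exI[of _ "\<lambda>k. f ` P k"]) blast
qed

lemma torus_dist_nonneg: "0 \<le> torus_dist z w"
  unfolding torus_dist_def by (rule setdist_pos_le)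

lemma param_image_null:
  assumes p: "C1_param C J \<gamma>" and s: "1 < s"
  shows "hausdorff_measure torus_dist s ((torus_pt \<circ> \<gamma>) ` J) = 0"
proof -
  have J: "open J" "\<gamma> C1_differentiable_on J" "\<And>t. t \<in> J \<Longrightarrow> vector_derivative \<gamma> (at t) \<noteq> 0"
    using p by (auto simp: C1_param_def)
  have "\<exists>r L. 0 < r \<and> 0 < L \<and> ball t r \<subseteq> J \<and> (\<forall>x\<in>ball t r. \<forall>y\<in>ball t r. norm (\<gamma> x - \<gamma> y) \<le> L * \<bar>x - y\<bar>)"
    if "t \<in> J" for t
    using locally_bilipschitz[OF J(1) that J(2) J(3)[OF that]] by (meson zero_less_one order_less_le_trans)
  then obtain r L where rL: "\<And>t. t \<in> J \<Longrightarrow> 0 < r t \<and> 0 < L t \<and> ball t (r t) \<subseteq> J \<and>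
      (\<forall>x\<in>ball t (r t). \<forall>y\<in>ball t (r t). norm (\<gamma> x - \<gamma> y) \<le> L t * \<bar>x - y\<bar>)"
    by metis
  obtain \<F> where \<F>: "\<F> \<subseteq> (\<lambda>t. ball t (r t)) ` J" "countable \<F>" "\<Union>\<F> = \<Union>((\<lambda>t. ball t (r t)) ` J)"
    using Lindelof[of "(\<lambda>t. ball t (r t)) ` J"] by (metis (mono_tags, lifting) image_iff open_ball)
  have "J = \<Union>\<F>"
    unfolding \<F>(3) using rL by (force simp: subset_iff)
  then have "(torus_pt \<circ> \<gamma>) ` J = (\<Union>B\<in>\<F>. (torus_pt \<circ> \<gamma>) ` B)" by blast
  moreover have "hausdorff_measure torus_dist s ((torus_pt \<circ> \<gamma>) ` B) = 0" if B: "B \<in> \<F>" for B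
  proof -
    obtain t where t: "t \<in> J" "B = ball t (r t)" using B \<F>(1) by blast
    show ?thesis unfolding t(2)
    proof (rule lipschitz_arc_null[OF s, of "L t"])
      show "0 < L t" "0 < r t" using rL[OF t(1)] by auto
      fix x y assume "x \<in> ball t (r t)" "y \<in> ball t (r t)"
      then have "norm (\<gamma> x - \<gamma> y) \<le> L t * \<bar>x - y\<bar>" using rL[OF t(1)] by blast
      then show "0 \<le> torus_dist ((torus_pt \<circ> \<gamma>) x) ((torus_pt \<circ> \<gamma>) y) \<and>
          torus_dist ((torus_pt \<circ> \<gamma>) x) ((torus_pt \<circ> \<gamma>) y) \<le> L t * \<bar>x - y\<bar>"
        using torus_dist_le[of "\<gamma> x" "\<gamma> y"] torus_dist_nonneg by (simp add: dist_norm)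
    qed
  qed
  ultimately show ?thesis using hausdorff_null_countable_UN[OF \<F>(2)] by metis
qed

text \<open>The plane is second countable, so countably many parametrized arcs suffice to cover the curve: the
  open sets of lattices which cut out the arcs are pulled back to the plane.\<close>

lemma hausdorff_dim_curve_le_1:
  assumes C: "regular_C2_curve C"
  shows "hausdorff_dim torus_dist C \<le> 1"
proof -
  define \<O> where "\<O> = {B. \<exists>W J \<gamma>. B = torus_pt -` W \<and> openin X3_topology W \<and> C1_param C J \<gamma> \<and>
    (torus_pt \<circ> \<gamma>) ` J = W \<inter> C}"
  have "open B" if "B \<in> \<O>" for B
    using openin_continuous_map_preimage[OF continuous_torus_pt] that by (auto simp: \<O>_def vimage_def)
  then obtain \<F> where \<F>: "\<F> \<subseteq> \<O>" "countable \<F>" "\<Union>\<F> = \<Union>\<O>"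
    using Lindelof by metis
  have "C \<subseteq> (\<Union>B\<in>\<F>. torus_pt ` B \<inter> C)"
  proof
    fix z assume z: "z \<in> C"
    then obtain v where v: "z = torus_pt v" using C unfolding regular_C2_curve_def torus_def by blast
    obtain J \<gamma> where p: "C2_param C J \<gamma>" "z \<in> (torus_pt \<circ> \<gamma>) ` J"
      using C z unfolding regular_C2_curve_def by blast
    then have p1: "C1_param C J \<gamma>" by (simp add: C2_param_def)
    then have "openin (subtopology X3_topology C) ((torus_pt \<circ> \<gamma>) ` J)" by (simp add: C1_param_def)
    then obtain W where W: "openin X3_topology W" "(torus_pt \<circ> \<gamma>) ` J = W \<inter> C"
      unfolding openin_subtopology by blast
    have "torus_pt -` W \<in> \<O>" unfolding \<O>_def using p1 W by blast
    moreover have "v \<in> torus_pt -` W" using p(2) unfolding W(2) v by blast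
    ultimately have "v \<in> \<Union>\<F>" unfolding \<F>(3) by blast
    then show "z \<in> (\<Union>B\<in>\<F>. torus_pt ` B \<inter> C)" using z v by blast
  qed
  then have "C = (\<Union>B\<in>\<F>. torus_pt ` B \<inter> C)" by blast
  moreover have "hausdorff_measure torus_dist s (torus_pt ` B \<inter> C) = 0" if s: "1 < s" and B: "B \<in> \<F>" for s B
  proof -
    obtain W J \<gamma> where W: "B = torus_pt -` W" "C1_param C J \<gamma>" "(torus_pt \<circ> \<gamma>) ` J = W \<inter> C"
      using subsetD[OF \<F>(1) B] unfolding \<O>_def mem_Collect_eq by - (elim exE conjE, rule that; assumption)
    have "C \<subseteq> range torus_pt" using C unfolding regular_C2_curve_def torus_def by blast
    then have "torus_pt ` B \<inter> C = (torus_pt \<circ> \<gamma>) ` J" unfolding W(1,3) by blast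
    then show ?thesis using param_image_null[OF W(2) s] by simp
  qed
  ultimately have null: "hausdorff_measure torus_dist s C = 0" if "1 < s" for s
    using hausdorff_null_countable_UN[OF \<F>(2)] that by metis
  show ?thesis
  proof (rule ennreal_le_epsilon)
    fix e :: real assume e: "0 < e"
    have "hausdorff_dim torus_dist C \<le> ennreal (1 + e)"
      unfolding hausdorff_dim_def
      by (rule Inf_lower, intro CollectI exI[of _ "1 + e"] conjI refl null) (use e in auto)
    also have "\<dots> = 1 + ennreal e" using e by (simp add: ennreal_plus)
    finally show "hausdorff_dim torus_dist C \<le> 1 + ennreal e" .
  qed
qed

lemma summable_restrict:
  fixes w :: "nat \<Rightarrow> real"
  assumes "summable w" "\<And>i. 0 < w i"
  shows "summable (\<lambda>i. if P i then w i else 0)"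
  by (rule summable_comparison_test'[OF assms(1), of 0]) (use assms(2) in \<open>auto intro: less_imp_le\<close>)

lemma le_suminf_restrict:
  fixes w :: "nat \<Rightarrow> real"
  assumes "summable w" "\<And>i. 0 < w i" "P i"
  shows "w i \<le> (\<Sum>n. if P n then w n else 0)"
proof -
  have "sum (\<lambda>n. if P n then w n else 0) {i} \<le> (\<Sum>n. if P n then w n else 0)"
    by (rule sum_le_suminf[OF summable_restrict]) (use assms in \<open>auto intro: less_imp_le\<close>)
  then show ?thesis using assms(3) by simp
qed

lemma exists_fine_subdivision:
  fixes s :: real
  assumes s: "0 < s" "s < 1"
  shows "\<exists>N::nat. 4 \<le> N \<and> 3 * real N powr s \<le> real N - 3"
proof -
  have "((\<lambda>N. real N powr (s - 1)) \<longlongrightarrow> 0) sequentially"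
    using s by (intro tendsto_neg_powr filterlim_real_sequentially) auto
  then have "\<forall>\<^sub>F N in sequentially. real N powr (s - 1) < 1 / 6" by (rule order_tendstoD(2)) simp
  then have "\<forall>\<^sub>F N in sequentially. real N powr (s - 1) < 1 / 6 \<and> 6 \<le> N"
    using eventually_ge_at_top[of 6] by eventually_elim blast
  then obtain N :: nat where N: "real N powr (s - 1) < 1 / 6" "6 \<le> N"
    using eventually_happens'[OF sequentially_bot] by blast
  have "real N powr s = real N * real N powr (s - 1)" using N(2) by (simp add: powr_diff)
  also have "\<dots> \<le> real N * (1 / 6)" using N(1) by (intro mult_left_mono) auto
  finally have "3 * real N powr s \<le> real N - 3" using N(2) by simp
  then show ?thesis using N(2) by (intro exI[of _ N]) auto
qed

text \<open>Bob divides his ball into \<open>N\<close> equal parts. At most three of them meet the neighborhood that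
  Alice deletes, and a set of small weight meets at most three of them, so that one of the legal
  parts carries at most the fraction \<open>3 / (N - 3)\<close> of the weight.\<close>

lemma light_child_exists:
  fixes E :: "nat \<Rightarrow> real set" and w :: "nat \<Rightarrow> real"
  assumes N: "4 \<le> N" "3 * real N powr s \<le> real N - 3" and s: "0 < s" and \<rho>: "0 < \<rho>"
    and w: "\<And>i. 0 < w i" "summable w" and E: "\<And>i x y. x \<in> E i \<Longrightarrow> y \<in> E i \<Longrightarrow> \<bar>x - y\<bar> powr s \<le> w i"
    and light: "(\<Sum>i. if E i \<inter> cball c \<rho> \<noteq> {} then w i else 0) < (\<rho> / N) powr s"
    and r: "r \<le> \<rho> / N"
  shows "\<exists>c'. cball c' (\<rho> / N) \<subseteq> cball c \<rho> - cball z r \<and>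
    (\<Sum>i. if E i \<inter> cball c' (\<rho> / N) \<noteq> {} then w i else 0) < (\<rho> / N / N) powr s"
proof -
  define h where "h = \<rho> / N"
  have h: "0 < h" "\<rho> = N * h" using \<rho> N(1) by (auto simp: h_def)
  define a where "a = (\<lambda>j::nat. c - \<rho> + (2 * j + 1) * h)"
  define W where "W = (\<lambda>B. \<Sum>i. if E i \<inter> B \<noteq> {} then w i else 0)"
  have summ: "summable (\<lambda>i. if E i \<inter> B \<noteq> {} then w i else 0)" for B
    by (rule summable_restrict[OF w(2,1)])
  have inside: "cball (a j) h \<subseteq> cball c \<rho>" if "j < N" for j
  proof -
    have "real j + 1 \<le> N" using that by linarith
    then have "(real j + 1) * h \<le> N * h" "0 \<le> real j * h" using h by (auto intro: mult_right_mono)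
    moreover have "a j - h = c - \<rho> + 2 * (real j * h)" "a j + h = c - \<rho> + 2 * ((real j + 1) * h)"
      by (simp_all add: a_def algebra_simps)
    moreover have "a j - h \<le> x" "x \<le> a j + h" if "x \<in> cball (a j) h" for x
      using that by (auto simp: dist_real_def)
    ultimately have "\<bar>c - x\<bar> \<le> \<rho>" if "x \<in> cball (a j) h" for x
      using that unfolding h(2)[symmetric] by (smt (verit))
    then show ?thesis by (auto simp: dist_real_def)
  qed
  have few: "card {j. j < N \<and> cball (a j) h \<inter> X \<noteq> {}} \<le> 3"
    if X: "\<And>x y. x \<in> X \<Longrightarrow> y \<in> X \<Longrightarrow> \<bar>x - y\<bar> \<le> 2 * h" for X
  proof -
    define T where "T = {j. j < N \<and> cball (a j) h \<inter> X \<noteq> {}}"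
    have spread: "k \<le> j + 2" if jk: "j \<in> T" "k \<in> T" for j k
    proof (rule ccontr)
      assume "\<not> ?thesis"
      then have "real j + 3 \<le> real k" by linarith
      then have "(real j + 3) * h \<le> real k * h" using h(1) by (intro mult_right_mono) auto
      moreover obtain x y where "x \<in> X" "x \<in> cball (a j) h" "y \<in> X" "y \<in> cball (a k) h"
        using jk unfolding T_def by blast
      ultimately show False using X[of x y] h(1) by (auto simp: a_def dist_real_def algebra_simps)
    qed
    have finT: "finite T" unfolding T_def by simp
    show ?thesis
    proof (cases "T = {}")
      case True
      then show ?thesis unfolding T_def[symmetric] by simp
    next
      case False
      define m where "m = Min T"
      have m: "m \<in> T" "\<And>j. j \<in> T \<Longrightarrow> m \<le> j" using finT False unfolding m_def by auto
      have "T \<subseteq> {m..m + 2}" using spread[OF m(1)] m(2) by auto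
      then have "card T \<le> card {m..m + 2}" by (intro card_mono) auto
      then show ?thesis unfolding T_def[symmetric] by simp
    qed
  qed
  define Ch where "Ch = {j. j < N \<and> cball (a j) h \<inter> cball z r = {}}"
  have finCh: "finite Ch" unfolding Ch_def by simp
  have "card {j. j < N \<and> cball (a j) h \<inter> cball z r \<noteq> {}} \<le> 3"
    by (rule few) (use r in \<open>auto simp: h_def dist_real_def\<close>)
  moreover have "{..<N} = Ch \<union> {j. j < N \<and> cball (a j) h \<inter> cball z r \<noteq> {}}" unfolding Ch_def by auto
  then have "N \<le> card Ch + card {j. j < N \<and> cball (a j) h \<inter> cball z r \<noteq> {}}"
    using card_Un_le[of Ch "{j. j < N \<and> cball (a j) h \<inter> cball z r \<noteq> {}}"] by (metis card_lessThan)
  ultimately have cardCh: "real N - 3 \<le> card Ch" by linarith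
  have each: "(\<Sum>j\<in>Ch. if E i \<inter> cball (a j) h \<noteq> {} then w i else 0) \<le> 3 * (if E i \<inter> cball c \<rho> \<noteq> {} then w i else 0)" for i
  proof (cases "E i \<inter> cball c \<rho> \<noteq> {}")
    case True
    have "w i \<le> W (cball c \<rho>)"
      unfolding W_def using True by (intro le_suminf_restrict[OF w(2,1)])
    then have wi: "w i < h powr s" using light unfolding W_def h_def by linarith
    have diam: "\<bar>x - y\<bar> \<le> 2 * h" if "x \<in> E i" "y \<in> E i" for x y
    proof (rule ccontr)
      assume "\<not> ?thesis"
      then have "h powr s \<le> \<bar>x - y\<bar> powr s" using h(1) s by (intro powr_mono2) auto
      then show False using E[OF that] wi by linarith
    qed
    have "(\<Sum>j\<in>Ch. if E i \<inter> cball (a j) h \<noteq> {} then w i else 0) = card {j \<in> Ch. E i \<inter> cball (a j) h \<noteq> {}} * w i"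
      using finCh by (simp add: sum.If_cases Int_def conj_commute)
    also have "\<dots> \<le> card {j. j < N \<and> cball (a j) h \<inter> E i \<noteq> {}} * w i"
      using w(1)[of i] by (intro mult_right_mono of_nat_mono card_mono) (auto simp: Ch_def)
    also have "\<dots> \<le> 3 * w i"
      using few[OF diam] w(1)[of i] by (intro mult_right_mono) auto
    finally show ?thesis using True by simp
  next
    case False
    have "(if E i \<inter> cball (a j) h \<noteq> {} then w i else 0) = 0" if "j \<in> Ch" for j
      using False inside[of j] that unfolding Ch_def by auto
    then show ?thesis using False by simp
  qed
  have "(\<Sum>j\<in>Ch. W (cball (a j) h)) = (\<Sum>i. \<Sum>j\<in>Ch. if E i \<inter> cball (a j) h \<noteq> {} then w i else 0)"
    unfolding W_def using summ by (subst suminf_sum) auto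
  also have "\<dots> \<le> (\<Sum>i. 3 * (if E i \<inter> cball c \<rho> \<noteq> {} then w i else 0))"
    using each summ by (intro suminf_le summable_sum summable_mult) auto
  also have "\<dots> = 3 * W (cball c \<rho>)" unfolding W_def using summ by (intro suminf_mult) auto
  also have "\<dots> < 3 * h powr s" using light unfolding W_def h_def by simp
  finally have total: "(\<Sum>j\<in>Ch. W (cball (a j) h)) < 3 * h powr s" .
  have "\<exists>j\<in>Ch. W (cball (a j) h) < (h / N) powr s"
  proof (rule ccontr)
    assume "\<not> ?thesis"
    then have "card Ch * (h / N) powr s \<le> (\<Sum>j\<in>Ch. W (cball (a j) h))"
      by (intro sum_bounded_below) (auto simp: not_less)
    moreover have "3 * real N powr s * (h / N) powr s \<le> card Ch * (h / N) powr s"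
      using N(2) cardCh by (intro mult_right_mono) auto
    moreover have "real N powr s * (h / N) powr s = h powr s"
      using N(1) h(1) by (simp flip: powr_mult)
    ultimately show False using total by (simp add: mult.assoc)
  qed
  then obtain j where j: "j \<in> Ch" "W (cball (a j) h) < (h / N) powr s" by blast
  then have "cball (a j) h \<subseteq> cball c \<rho> - cball z r" using inside[of j] unfolding Ch_def by blast
  then show ?thesis using j(2) unfolding W_def h_def by blast
qed

text \<open>By moving repeatedly into a light part Bob reaches a point outside of any given cover of small
  weight, although Alice steers into \<open>S\<close>.\<close>

lemma HAW_not_null:
  fixes S J :: "real set"
  assumes HAW: "absolutely_winning_on J S" and \<rho>: "0 < \<rho>" "cball t \<rho> \<subseteq> J" and s: "0 < s" "s < 1"
  shows "\<exists>\<kappa>>0. \<forall>E w. (\<forall>i. \<forall>x\<in>E i. \<forall>y\<in>E i. ennreal (\<bar>x - y\<bar> powr s) \<le> w i) \<longrightarrow>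
     (\<Sum>i::nat. w i) < ennreal \<kappa> \<longrightarrow> \<not> S \<inter> cball t \<rho> \<subseteq> (\<Union>i. E i)"
proof -
  obtain N :: nat where N: "4 \<le> N" "3 * real N powr s \<le> real N - 3"
    using exists_fine_subdivision[OF s] by blast
  define \<beta> where "\<beta> = 1 / real N"
  have \<beta>: "0 < \<beta>" "\<beta> < 1 / 3" using N(1) by (auto simp: \<beta>_def field_simps)
  obtain \<sigma> where \<sigma>: "legal_strategy (range (\<lambda>c. {c})) \<beta> \<sigma>"
    "\<And>B. legal_play \<beta> J \<sigma> B \<Longrightarrow> (\<lambda>n. snd (B n)) \<longlonglongrightarrow> 0 \<Longrightarrow>
           (\<Inter>n. cball (fst (B n)) (snd (B n))) \<inter> S \<noteq> {}"
  proof -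
    have "alice_wins (range (\<lambda>c. {c})) \<beta> J S" using HAW \<beta> unfolding absolutely_winning_on_def by simp
    then show thesis using that unfolding alice_wins_def by blast
  qed
  define \<kappa> where "\<kappa> = (\<rho> / N) powr s / 3"
  have \<kappa>: "0 < \<kappa>" using \<rho> N by (simp add: \<kappa>_def)
  have False
    if E: "\<forall>i. \<forall>x\<in>E i. \<forall>y\<in>E i. ennreal (\<bar>x - y\<bar> powr s) \<le> v i"
      and v: "(\<Sum>i::nat. v i) < ennreal \<kappa>" and cov: "S \<inter> cball t \<rho> \<subseteq> (\<Union>i. E i)" for E v
  proof -
    have vfin: "v i < top" for i
      using ennreal_suminf_lessD[OF v, of i] by (rule less_trans) simp
    \<comment> \<open>Sets of diameter 0 have weight 0; to exclude the limit point from them, all weights are made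
      positive.\<close>
    define w where "w = (\<lambda>i. enn2real (v i) + \<kappa> * (1 / 2) ^ Suc i)"
    have wpos: "0 < w i" for i unfolding w_def using \<kappa> by (intro add_nonneg_pos) auto
    have vsum: "summable (\<lambda>i. enn2real (v i))" "(\<Sum>i. enn2real (v i)) \<le> \<kappa>"
    proof -
      have eq: "(\<Sum>i. ennreal (enn2real (v i))) = (\<Sum>i. v i)" using vfin by simp
      show sm: "summable (\<lambda>i. enn2real (v i))"
        using v eq by (intro summable_suminf_not_top) auto
      have "ennreal (\<Sum>i. enn2real (v i)) = (\<Sum>i. v i)"
        using suminf_ennreal2[OF _ sm] eq by simp
      then have "ennreal (\<Sum>i. enn2real (v i)) < ennreal \<kappa>" using v by simp
      then show "(\<Sum>i. enn2real (v i)) \<le> \<kappa>" using \<kappa> by (simp add: ennreal_less_iff suminf_nonneg[OF sm])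
    qed
    have gsum: "(\<lambda>i. \<kappa> * (1 / 2) ^ Suc i) sums (\<kappa> * 1)" by (intro sums_mult power_half_series)
    have wsum: "summable w" unfolding w_def using vsum(1) gsum by (intro summable_add) (auto simp: sums_iff)
    have "(\<Sum>i. w i) = (\<Sum>i. enn2real (v i)) + \<kappa>"
      unfolding w_def using suminf_add[OF vsum(1) sums_summable[OF gsum]] gsum by (simp add: sums_iff)
    then have wtot: "(\<Sum>i. w i) < (\<rho> / N) powr s" using vsum(2) \<kappa> unfolding \<kappa>_def by linarith
    have wE: "\<bar>x - y\<bar> powr s \<le> w i" if "x \<in> E i" "y \<in> E i" for i x y
    proof -
      have "ennreal (\<bar>x - y\<bar> powr s) \<le> ennreal (enn2real (v i))" using E that vfin by simp
      then have "\<bar>x - y\<bar> powr s \<le> enn2real (v i)" by (simp add: ennreal_le_iff)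
      then show ?thesis unfolding w_def using \<kappa> by (smt (verit) mult_pos_pos zero_less_power half_gt_zero_iff zero_less_one)
    qed
    define W where "W = (\<lambda>b. \<Sum>i. if E i \<inter> cball (fst b) (snd b) \<noteq> {} then w i else 0)"
    define light where "light = (\<lambda>b. 0 < snd b \<and> W b < (snd b / N) powr s)"
    define nxt where "nxt = (\<lambda>h. SOME b. snd b = snd (last h) / N \<and>
       cball (fst b) (snd b) \<subseteq> cball (fst (last h)) (snd (last h)) - case_prod closed_nbhd (\<sigma> h) \<and> light b)"
    have nxt: "snd (nxt h) = snd (last h) / N \<and>
       cball (fst (nxt h)) (snd (nxt h)) \<subseteq> cball (fst (last h)) (snd (last h)) - case_prod closed_nbhd (\<sigma> h) \<and> light (nxt h)"
      if h: "h \<noteq> []" "light (last h)" for h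
    proof -
      have pos: "0 < snd (last h)" using h(2) unfolding light_def by blast
      obtain z where z: "fst (\<sigma> h) = {z}" "snd (\<sigma> h) \<le> snd (last h) / N"
        using \<sigma>(1) h(1) pos unfolding legal_strategy_def \<beta>_def by auto
      have del: "case_prod closed_nbhd (\<sigma> h) = cball z (snd (\<sigma> h))"
        using z(1) closed_nbhd_singleton[of z "snd (\<sigma> h)"] by (simp add: case_prod_beta)
      have l: "(\<Sum>i. if E i \<inter> cball (fst (last h)) (snd (last h)) \<noteq> {} then w i else 0) < (snd (last h) / N) powr s"
        using h(2) unfolding light_def W_def by blast
      obtain c' where c': "cball c' (snd (last h) / N) \<subseteq> cball (fst (last h)) (snd (last h)) - cball z (snd (\<sigma> h))"
        "(\<Sum>i. if E i \<inter> cball c' (snd (last h) / N) \<noteq> {} then w i else 0) < (snd (last h) / N / N) powr s"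
        using light_child_exists[OF N s(1) pos wpos wsum wE l z(2)] by blast
      have "0 < snd (last h) / N" using pos N(1) by simp
      then have "\<exists>b. snd b = snd (last h) / N \<and>
        cball (fst b) (snd b) \<subseteq> cball (fst (last h)) (snd (last h)) - case_prod closed_nbhd (\<sigma> h) \<and> light b"
        unfolding del light_def W_def using c' by (intro exI[of _ "(c', snd (last h) / N)"]) simp
      then show ?thesis unfolding nxt_def by (rule someI_ex)
    qed
    define hist where "hist = rec_nat [(t, \<rho>)] (\<lambda>n h. h @ [nxt h])"
    have hist0: "hist 0 = [(t, \<rho>)]" and histS: "hist (Suc n) = hist n @ [nxt (hist n)]" for n
      by (simp_all add: hist_def)
    define B where "B = (\<lambda>n. last (hist n))"
    have hB: "hist n = map B [0..<Suc n]" for n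
      by (induction n) (simp_all add: hist0 histS B_def)
    have ne: "hist n \<noteq> []" for n by (simp add: hB)
    have BS: "B (Suc n) = nxt (hist n)" for n by (simp add: B_def histS)
    have light: "light (B n)" for n
    proof (induction n)
      case 0
      have "W (t, \<rho>) \<le> (\<Sum>i. w i)"
        unfolding W_def
      proof (rule suminf_le)
        show "summable (\<lambda>i. if E i \<inter> cball (fst (t, \<rho>)) (snd (t, \<rho>)) \<noteq> {} then w i else 0)"
          by (rule summable_restrict[OF wsum wpos])
      qed (use wpos wsum in \<open>auto intro: less_imp_le\<close>)
      also have "\<dots> < (\<rho> / N) powr s" by (rule wtot)
      finally show ?case using \<rho>(1) by (simp add: light_def B_def hist0)
    next
      case (Suc n)
      then have "light (last (hist n))" by (simp add: B_def)
      then show ?case using nxt[OF ne] unfolding BS by blast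
    qed
    have Brad: "snd (B (Suc n)) = snd (B n) / N"
      and Bsub: "cball (fst (B (Suc n))) (snd (B (Suc n))) \<subseteq> cball (fst (B n)) (snd (B n)) - case_prod closed_nbhd (\<sigma> (map B [0..<Suc n]))" for n
    proof -
      have lt: "light (last (hist n))" using light[of n] by (simp add: B_def)
      have Bn: "last (hist n) = B n" by (simp add: B_def)
      show "snd (B (Suc n)) = snd (B n) / N"
        using nxt[OF ne lt] unfolding BS by (simp add: B_def)
      show "cball (fst (B (Suc n))) (snd (B (Suc n))) \<subseteq> cball (fst (B n)) (snd (B n)) - case_prod closed_nbhd (\<sigma> (map B [0..<Suc n]))"
        using nxt[OF ne lt] unfolding BS[symmetric] Bn unfolding hB by (elim conjE)
    qed
    have B0: "B 0 = (t, \<rho>)" by (simp add: B_def hist0)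
    have play: "legal_play \<beta> J \<sigma> B"
      unfolding legal_play_def using \<rho> Bsub Brad by (simp add: B0 \<beta>_def)
    have rad: "snd (B n) = \<rho> * (1 / N) ^ n" for n
      by (induction n) (simp_all add: B0 Brad)
    have "(\<lambda>n. (1 / real N) ^ n) \<longlonglongrightarrow> 0" using N(1) by (intro LIMSEQ_realpow_zero) auto
    then have lim: "(\<lambda>n. snd (B n)) \<longlonglongrightarrow> 0" unfolding rad by (rule tendsto_mult_right_zero)
    obtain z where z: "\<And>n. z \<in> cball (fst (B n)) (snd (B n))" "z \<in> S" using \<sigma>(2)[OF play lim] by blast
    have "z \<in> cball t \<rho>" using z(1)[of 0] by (simp add: B0)
    then obtain i where i: "z \<in> E i" using cov z(2) by blast
    have "w i \<le> (snd (B n)) powr s" for n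
    proof -
      have "w i \<le> W (B n)"
        unfolding W_def using i z(1)[of n] by (intro le_suminf_restrict[OF wsum wpos]) blast
      also have "\<dots> \<le> (snd (B n) / N) powr s" using light[of n] unfolding light_def by simp
      also have "\<dots> \<le> (snd (B n)) powr s"
        using light[of n] N(1) s unfolding light_def by (intro powr_mono2) (auto simp: field_simps)
      finally show ?thesis .
    qed
    moreover have "(\<lambda>n. snd (B n) powr s) \<longlonglongrightarrow> 0"
    proof (rule tendsto_zero_powrI[OF lim tendsto_const _ s(1)])
      have "0 \<le> snd (B n)" for n using light[of n] unfolding light_def by simp
      then show "\<forall>\<^sub>F n in sequentially. 0 \<le> snd (B n)" by simp
    qed
    ultimately have "w i \<le> 0" by (intro LIMSEQ_le_const[of _ 0]) auto
    then show False using wpos[of i] by simp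
  qed
  then show ?thesis using \<kappa> by blast
qed

text \<open>A chart is locally bi-Lipschitz for the metric of the torus, so a cover of \<open>S\<close> of small weight would
  give one of the winning set in the chart.\<close>

lemma hausdorff_dim_ge_1:
  assumes p: "C1_param C J \<gamma>" and t: "t \<in> J"
    and win: "absolutely_winning_on J {x \<in> J. torus_pt (\<gamma> x) \<in> S}"
  shows "1 \<le> hausdorff_dim torus_dist S"
  unfolding hausdorff_dim_def
proof (rule Inf_greatest)
  fix x assume "x \<in> {ennreal s | s. s > 0 \<and> hausdorff_measure torus_dist s S = 0}"
  then obtain s where s: "x = ennreal s" "0 < s" and null: "hausdorff_measure torus_dist s S = 0" by blast
  have "\<not> s < 1"
  proof
    assume s1: "s < 1"
    have J: "open J" "\<gamma> C1_differentiable_on J" "vector_derivative \<gamma> (at t) \<noteq> 0"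
      using p t by (auto simp: C1_param_def)
    obtain r L where rL: "0 < r" "1 \<le> L" "ball t r \<subseteq> J" and bil: "\<forall>x\<in>ball t r. \<forall>y\<in>ball t r.
        \<bar>x - y\<bar> \<le> L * norm (\<gamma> x - \<gamma> y) \<and> norm (\<gamma> x - \<gamma> y) \<le> L * \<bar>x - y\<bar>"
      using locally_bilipschitz[OF J(1) t J(2,3)] by blast
    define \<rho> where "\<rho> = min (r / 2) (1 / (4 * L))"
    have \<rho>: "0 < \<rho>" "\<rho> < r" "L * (2 * \<rho>) \<le> 1 / 2"
      using rL by (auto simp: \<rho>_def min_def field_simps)
    then have sub: "cball t \<rho> \<subseteq> ball t r" by auto
    have le: "\<bar>x - y\<bar> \<le> L * torus_dist (torus_pt (\<gamma> x)) (torus_pt (\<gamma> y))" if xy: "x \<in> cball t \<rho>" "y \<in> cball t \<rho>" for x y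
    proof -
      have b: "\<bar>x - y\<bar> \<le> L * norm (\<gamma> x - \<gamma> y)" "norm (\<gamma> x - \<gamma> y) \<le> L * \<bar>x - y\<bar>"
        using bil subsetD[OF sub xy(1)] subsetD[OF sub xy(2)] by blast+
      have "L * \<bar>x - y\<bar> \<le> L * (2 * \<rho>)" using xy rL by (intro mult_left_mono) (auto simp: dist_real_def)
      then have "norm (\<gamma> x - \<gamma> y) \<le> 1 / 2" using b(2) \<rho>(3) by linarith
      then have "L * norm (\<gamma> x - \<gamma> y) \<le> L * torus_dist (torus_pt (\<gamma> x)) (torus_pt (\<gamma> y))"
        using rL by (intro mult_left_mono torus_dist_ge) auto
      then show ?thesis using b(1) by linarith
    qed
    have "cball t \<rho> \<subseteq> J" using sub rL(3) by blast
    from HAW_not_null[OF win \<rho>(1) this s(2) s1] obtain \<kappa> where \<kappa>: "0 < \<kappa>"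
      and not: "\<forall>E w. (\<forall>i. \<forall>x\<in>E i. \<forall>y\<in>E i. ennreal (\<bar>x - y\<bar> powr s) \<le> w i) \<longrightarrow>
         (\<Sum>i::nat. w i) < ennreal \<kappa> \<longrightarrow> \<not> {x \<in> J. torus_pt (\<gamma> x) \<in> S} \<inter> cball t \<rho> \<subseteq> (\<Union>i. E i)"
      by blast
    define \<eta> where "\<eta> = \<kappa> / 2 / L powr s"
    have \<eta>: "0 < \<eta>" using \<kappa> rL by (simp add: \<eta>_def)
    obtain E :: "nat \<Rightarrow> (real^3^3) set set" where E: "(\<Union>i. E i) = S"
      "(\<Sum>i. SUP x\<in>E i. SUP y\<in>E i. ennreal (torus_dist x y powr s)) < ennreal \<eta>"
      using null \<eta> unfolding hausdorff_null_iff by (meson zero_less_one)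
    define E' where "E' = (\<lambda>i. {x \<in> cball t \<rho>. torus_pt (\<gamma> x) \<in> E i})"
    define w where "w = (\<lambda>i. ennreal (L powr s) * (SUP x\<in>E i. SUP y\<in>E i. ennreal (torus_dist x y powr s)))"
    have "ennreal (\<bar>x - y\<bar> powr s) \<le> w i" if "x \<in> E' i" "y \<in> E' i" for i x y
    proof -
      have xy: "x \<in> cball t \<rho>" "y \<in> cball t \<rho>" "torus_pt (\<gamma> x) \<in> E i" "torus_pt (\<gamma> y) \<in> E i"
        using that unfolding E'_def by auto
      have "\<bar>x - y\<bar> powr s \<le> (L * torus_dist (torus_pt (\<gamma> x)) (torus_pt (\<gamma> y))) powr s"
        using le[OF xy(1,2)] s(2) by (intro powr_mono2) auto
      also have "\<dots> = L powr s * torus_dist (torus_pt (\<gamma> x)) (torus_pt (\<gamma> y)) powr s"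
        using rL torus_dist_nonneg by (simp add: powr_mult)
      finally have "ennreal (\<bar>x - y\<bar> powr s) \<le> ennreal (L powr s) * ennreal (torus_dist (torus_pt (\<gamma> x)) (torus_pt (\<gamma> y)) powr s)"
        by (simp add: ennreal_mult[symmetric] ennreal_leI)
      also have "\<dots> \<le> w i"
        unfolding w_def using xy(3,4) by (intro mult_left_mono SUP_upper2[OF xy(3)] SUP_upper) auto
      finally show ?thesis .
    qed
    moreover have "(\<Sum>i. w i) < ennreal \<kappa>"
    proof -
      have "(\<Sum>i. w i) = ennreal (L powr s) * (\<Sum>i. SUP x\<in>E i. SUP y\<in>E i. ennreal (torus_dist x y powr s))"
        unfolding w_def by (rule ennreal_suminf_cmult)
      also have "\<dots> \<le> ennreal (L powr s) * ennreal \<eta>" using E(2) by (intro mult_left_mono) auto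
      also have "\<dots> = ennreal (\<kappa> / 2)" using \<eta> rL by (simp add: ennreal_mult[symmetric] \<eta>_def)
      also have "\<dots> < ennreal \<kappa>" using \<kappa> by (simp add: ennreal_less_iff)
      finally show ?thesis .
    qed
    moreover have "{x \<in> J. torus_pt (\<gamma> x) \<in> S} \<inter> cball t \<rho> \<subseteq> (\<Union>i. E' i)"
      using E(1) unfolding E'_def by blast
    ultimately show False using not by blast
  qed
  then show "1 \<le> x" using s by simp
qed

theorem theorem1p11:
  fixes C :: "(real^3^3) set set"
    and \<A> :: "((real^3^3) set set \<times> ((real^3^3) set \<Rightarrow> real)) set"
  assumes "regular_C2_curve C"
    and "C1_atlas C \<A>"
    and "absolutely_winning_on_manifold \<A> {z \<in> C. curvature C z \<noteq> 0}"
  shows "HAW_on_manifold \<A> {p \<in> C. \<not> fiberwise_divergent p} \<and>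
         hausdorff_dim torus_dist {p \<in> C. \<not> fiberwise_divergent p} = hausdorff_dim torus_dist C"
proof -
  let ?S = "{p \<in> C. \<not> fiberwise_divergent p}"
  have chart: "\<exists>\<gamma>. C1_param C (\<phi> ` U) \<gamma> \<and>
      (\<forall>P. \<phi> ` ({z \<in> C. P z} \<inter> U) = {t \<in> \<phi> ` U. P (torus_pt (\<gamma> t))}) \<and>
      (\<forall>t\<in>\<phi> ` U. torus_pt (\<gamma> t) \<in> C)" if "(U, \<phi>) \<in> \<A>" for U \<phi>
  proof -
    have "C1_chart C (U, \<phi>)" using assms(2) that unfolding C1_atlas_def by blast
    then obtain \<gamma> where \<gamma>: "C1_param C (\<phi> ` U) \<gamma>" "\<And>z. z \<in> U \<Longrightarrow> torus_pt (\<gamma> (\<phi> z)) = z"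
      unfolding C1_chart_def by auto
    have UC: "z \<in> C" if "z \<in> U" for z
      using assms(2) \<open>(U, \<phi>) \<in> \<A>\<close> that unfolding C1_atlas_def by force
    have "\<phi> ` ({z \<in> C. P z} \<inter> U) = {t \<in> \<phi> ` U. P (torus_pt (\<gamma> t))}" for P
    proof (intro equalityI subsetI)
      fix t assume "t \<in> {t \<in> \<phi> ` U. P (torus_pt (\<gamma> t))}"
      then obtain z where "z \<in> U" "t = \<phi> z" "P z" using \<gamma>(2) by auto
      then show "t \<in> \<phi> ` ({z \<in> C. P z} \<inter> U)" using UC by blast
    qed (use \<gamma>(2) in auto)
    moreover have "\<forall>t\<in>\<phi> ` U. torus_pt (\<gamma> t) \<in> C" using \<gamma>(2) UC by auto
    ultimately show ?thesis using \<gamma>(1) by (intro exI[of _ \<gamma>]) simp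
  qed
  have win: "absolutely_winning_on (\<phi> ` U) {t \<in> \<phi> ` U. \<not> fiberwise_divergent (torus_pt (\<gamma> t))}"
    if U: "(U, \<phi>) \<in> \<A>" and \<gamma>: "C1_param C (\<phi> ` U) \<gamma>"
      "\<And>P. \<phi> ` ({z \<in> C. P z} \<inter> U) = {t \<in> \<phi> ` U. P (torus_pt (\<gamma> t))}" for U \<phi> \<gamma>
    unfolding absolutely_winning_on_def
  proof
    fix \<beta> :: real assume \<beta>: "\<beta> \<in> {0<..<1 / 3}"
    have "alice_wins (range (\<lambda>c. {c})) \<beta> (\<phi> ` U) (\<phi> ` ({z \<in> C. curvature C z \<noteq> 0} \<inter> U))"
      using assms(3) U \<beta> unfolding absolutely_winning_on_manifold_def absolutely_winning_on_def by blast
    then show "alice_wins (range (\<lambda>c. {c})) \<beta> (\<phi> ` U) {t \<in> \<phi> ` U. \<not> fiberwise_divergent (torus_pt (\<gamma> t))}"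
      unfolding \<gamma>(2) using \<beta> by (intro winning_in_chart[OF assms(1) \<gamma>(1)]) auto
  qed
  have haw: "HAW_on_manifold \<A> ?S"
    unfolding HAW_on_manifold_def
  proof (clarify)
    fix U \<phi> assume U: "(U, \<phi>) \<in> \<A>"
    then obtain \<gamma> where \<gamma>: "C1_param C (\<phi> ` U) \<gamma>"
      "\<And>P. \<phi> ` ({z \<in> C. P z} \<inter> U) = {t \<in> \<phi> ` U. P (torus_pt (\<gamma> t))}"
      using chart[OF U] by blast
    show "HAW_on (\<phi> ` U) (\<phi> ` (?S \<inter> U))"
      unfolding \<gamma>(2) absolutely_winning_on_real_iff_HAW_on[symmetric] by (rule win[OF U \<gamma>])
  qed
  moreover have "hausdorff_dim torus_dist ?S = hausdorff_dim torus_dist C"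
  proof (cases "C = {}")
    case True
    then show ?thesis by simp
  next
    case False
    then obtain z where "z \<in> C" by blast
    then obtain U \<phi> where U: "(U, \<phi>) \<in> \<A>" "z \<in> U" using assms(2) unfolding C1_atlas_def by force
    from chart[OF U(1)] obtain \<gamma> where \<gamma>1: "C1_param C (\<phi> ` U) \<gamma>"
      and \<gamma>P: "\<forall>P. \<phi> ` ({z \<in> C. P z} \<inter> U) = {t \<in> \<phi> ` U. P (torus_pt (\<gamma> t))}"
      and inC: "\<forall>t\<in>\<phi> ` U. torus_pt (\<gamma> t) \<in> C"
      by - (elim exE conjE, rule that; assumption)
    note \<gamma> = \<gamma>1 \<gamma>P[rule_format]
    have "{t \<in> \<phi> ` U. torus_pt (\<gamma> t) \<in> ?S} = {t \<in> \<phi> ` U. \<not> fiberwise_divergent (torus_pt (\<gamma> t))}"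
      using inC by blast
    then have "absolutely_winning_on (\<phi> ` U) {t \<in> \<phi> ` U. torus_pt (\<gamma> t) \<in> ?S}"
      using win[OF U(1) \<gamma>] by simp
    then have ge: "1 \<le> hausdorff_dim torus_dist ?S"
      using U(2) by (intro hausdorff_dim_ge_1[OF \<gamma>(1), of "\<phi> z"]) auto
    have "hausdorff_dim torus_dist ?S \<le> hausdorff_dim torus_dist C"
      by (rule hausdorff_dim_mono) auto
    then show ?thesis
      using order_trans[OF hausdorff_dim_curve_le_1[OF assms(1)] ge] by (rule antisym)
  qed
  ultimately show ?thesis by blast
qed

end
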